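(* Consider the batch-service M/G/1 queue described in the context, with $\mathrm{E}[H]+\mathrm{E}[V]>0$. If $\rho=\lambda\mathrm{E}[H]<1$ and $\mathrm{E}[V]<\infty$, then the Laplace–Stieltjes transform $d^*(\omega)=\mathrm{E}[e^{-\omega D}]$ ($\omega>0$) of the system delay $D$ in steady state is given by \[ d^*(\omega)=h^*(\omega)v^*(\omega)\left[1-\rho^*+\rho^*\cdot\frac{\ell_E^*\big(h^*(\omega)\big)-\ell_S^*\big(h^*(\omega+\lambda-\lambda h^*(\omega))\big)\,v^*\big(\omega+\lambda-\lambda h^*(\omega)\big)}{\mathrm{E}[S^{\rm B}]\,\omega}\right], \] where \[ \ell_E^*(z)=\prod_{k=1}^{\infty}\psi_k^V(z)-\ell_E^*(0)\sum_{n=1}^{\infty}\big(1-\psi_n^H(z)\big)\prod_{k=1}^n\psi_k^V(z), \qquad \ell_S^*(z)=\ell_E^*(z)+(z-1)\ell_E^*(0). \]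
   Context: Model (batch-service M/G/1 queue). Customers arrive according to a Poisson process with rate $\lambda>0$ and are served by a single server. If the system is empty, the server is idle, and as soon as the next customer arrives the server starts the service of this customer (as a batch of size 1). If some customers are waiting at the end of a service, the server serves all of those customers in one batch; otherwise the server becomes idle. Customers served in the same batch leave simultaneously at the end of the service. The service time of a batch of $k$ customers ($k=1,2,\ldots$) is $S^{\rm B}=H_1+\cdots+H_k+V$, where the $H_i$ are i.i.d. copies of a nonnegative random variable $H$ and $V$ is a nonnegative random variable, all independent of each other, of the arrivals, and (fresh copies being used) of the other batches. $D$ is the system delay (time from arrival to departure, i.e. to the end of the service of the batch containing the customer) of a randomly chosen customer in steady state. Notation: $h^*(s)=\mathrm{E}[e^{-sH}]$, $v^*(s)=\mathrm{E}[e^{-sV}]$ for $\mathrm{Re}\,s\ge0$; $a_H^*(z)=h^*(\lambda-\lambda z)$, $a_V^*(z)=v^*(\lambda-\lambda z)$ for $|z|\le 1$. Recursively, $\psi_1^H(z)=a_H^*(z)$, $\psi_n^H(z)=a_H^*(\psi_{n-1}^H(z))$ for $n\ge 2$; $\psi_1^V(z)=a_V^*(z)$, $\psi_n^V(z)=a_V^*(\psi_{n-1}^H(z))$ for $n\ge 2$. $L_E$ is the number of customers in the system just after the end of a randomly chosen batch service in steady state; $\ell_E^*(z)=\mathrm{E}[z^{L_E}]$ is its probability generating function, and \[ \ell_E^*(0)=\frac{\prod_{k=1}^{\infty}\psi_k^V(0)}{1+\sum_{n=1}^{\infty}\big(1-\psi_n^H(0)\big)\prod_{k=1}^n\psi_k^V(0)}.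 \] $\ell_S^*$ is the generating function of the number of customers at the beginning of a randomly chosen batch service. The mean batch service time in steady state and the server utilization are \[ \mathrm{E}[S^{\rm B}]=\big(\mathrm{E}[L_E]+\ell_E^*(0)\big)\mathrm{E}[H]+\mathrm{E}[V],\qquad \rho^*=\frac{\rho\,\mathrm{E}[L_E]+\rho\,\ell_E^*(0)+\lambda\mathrm{E}[V]}{\rho\,\mathrm{E}[L_E]+(1+\rho)\ell_E^*(0)+\lambda\mathrm{E}[V]}. \] *)

theory Defs
  imports "HOL-Probability.Probability"
begin

section \<open>Sample paths of the queue\<close>

text \<open>
  Customers and batches are numbered from \<open>0\<close>, and \<open>x\<close> is the sample point. The data are the
  interarrival times \<open>A n\<close>, the individual components \<open>H n i\<close> (\<open>i = 0, 1, \<dots>\<close>) and the common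
  component \<open>V n\<close> of the service time of batch \<open>n\<close>; a batch of \<open>k\<close> customers uses
  \<open>H n 0, \<dots>, H n (k - 1)\<close>. The system is empty at time \<open>0\<close>.
\<close>

definition arrival_time :: "(nat \<Rightarrow> 'a \<Rightarrow> real) \<Rightarrow> nat \<Rightarrow> 'a \<Rightarrow> real" where
  "arrival_time A j x = (\<Sum>i\<le>j. A i x)"

text \<open>If the customers \<open>0, \<dots>, c - 1\<close> have left by time \<open>t\<close> and no service is in progress,
  this is the number of customers in the system at time \<open>t\<close>.\<close>

definition waiting :: "(nat \<Rightarrow> 'a \<Rightarrow> real) \<Rightarrow> nat \<Rightarrow> real \<Rightarrow> 'a \<Rightarrow> nat" where
  "waiting A c t x = card {j. c \<le> j \<and> arrival_time A j x \<le> t}"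

text \<open>
  \<open>epoch A H V n x = (c, t)\<close>: after the first \<open>n\<close> batches exactly the customers \<open>0, \<dots>, c - 1\<close> have
  been served, and \<open>t\<close> is the end of the last of these services (\<open>t = 0\<close> for \<open>n = 0\<close>).
\<close>

primrec epoch ::
  "(nat \<Rightarrow> 'a \<Rightarrow> real) \<Rightarrow> (nat \<Rightarrow> nat \<Rightarrow> 'a \<Rightarrow> real) \<Rightarrow> (nat \<Rightarrow> 'a \<Rightarrow> real) \<Rightarrow> nat \<Rightarrow> 'a \<Rightarrow> nat \<times> real"
where
  "epoch A H V 0 x = (0, 0)"
| "epoch A H V (Suc n) x =
    (let (c, t) = epoch A H V n x;
         w = waiting A c t x;
         k = (if w = 0 then 1 else w);
         start = (if w = 0 then arrival_time A c x else t)
     in (c + k, start + (\<Sum>i<k. H n i x) + V n x))"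

text \<open>The number of customers in the system just after the end of the service of batch \<open>n\<close>.\<close>

definition left_behind ::
  "(nat \<Rightarrow> 'a \<Rightarrow> real) \<Rightarrow> (nat \<Rightarrow> nat \<Rightarrow> 'a \<Rightarrow> real) \<Rightarrow> (nat \<Rightarrow> 'a \<Rightarrow> real) \<Rightarrow> nat \<Rightarrow> 'a \<Rightarrow> nat"
where
  "left_behind A H V n x =
    waiting A (fst (epoch A H V (Suc n) x)) (snd (epoch A H V (Suc n) x)) x"

text \<open>The number of customers in the system at the beginning of the service of batch \<open>n\<close>, which
  is the size of that batch.\<close>

definition batch_size ::
  "(nat \<Rightarrow> 'a \<Rightarrow> real) \<Rightarrow> (nat \<Rightarrow> nat \<Rightarrow> 'a \<Rightarrow> real) \<Rightarrow> (nat \<Rightarrow> 'a \<Rightarrow> real) \<Rightarrow> nat \<Rightarrow> 'a \<Rightarrow> nat"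
where
  "batch_size A H V n x = fst (epoch A H V (Suc n) x) - fst (epoch A H V n x)"

definition batch_of ::
  "(nat \<Rightarrow> 'a \<Rightarrow> real) \<Rightarrow> (nat \<Rightarrow> nat \<Rightarrow> 'a \<Rightarrow> real) \<Rightarrow> (nat \<Rightarrow> 'a \<Rightarrow> real) \<Rightarrow> nat \<Rightarrow> 'a \<Rightarrow> nat"
where
  "batch_of A H V j x = (LEAST n. j < fst (epoch A H V (Suc n) x))"

definition system_delay ::
  "(nat \<Rightarrow> 'a \<Rightarrow> real) \<Rightarrow> (nat \<Rightarrow> nat \<Rightarrow> 'a \<Rightarrow> real) \<Rightarrow> (nat \<Rightarrow> 'a \<Rightarrow> real) \<Rightarrow> nat \<Rightarrow> 'a \<Rightarrow> real"
where
  "system_delay A H V j x =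
    snd (epoch A H V (Suc (batch_of A H V j x)) x) - arrival_time A j x"


section \<open>Stochastic assumptions\<close>

datatype source = Interarrival nat | Individual nat nat | Common nat

text \<open>\<open>FH\<close> and \<open>FV\<close> are the laws of the generic service components $H$ and $V$.\<close>

locale batch_queue = prob_space M
  for M :: "'a measure" and lam :: real and FH FV :: "real measure"
    and A :: "nat \<Rightarrow> 'a \<Rightarrow> real" and H :: "nat \<Rightarrow> nat \<Rightarrow> 'a \<Rightarrow> real" and V :: "nat \<Rightarrow> 'a \<Rightarrow> real" +
  assumes lam_pos: "0 < lam"
    and law_A: "\<And>n. distributed M lborel (A n) (exponential_density lam)"
    and law_H: "\<And>n i. distr M borel (H n i) = FH"
    and law_V: "\<And>n. distr M borel (V n) = FV"
    and H_nonneg: "AE h in FH. 0 \<le> h"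
    and V_nonneg: "AE v in FV. 0 \<le> v"
    and indep: "indep_vars (\<lambda>_. borel)
      (\<lambda>s. case s of Interarrival n \<Rightarrow> A n | Individual n i \<Rightarrow> H n i | Common n \<Rightarrow> V n) UNIV"


section \<open>Steady state\<close>

text \<open>
  The steady-state quantity seen by a randomly chosen customer (batch) is the limit in law of the
  corresponding quantity of the \<open>n\<close>-th customer (batch). For variables with values in \<^typ>\<open>nat\<close>,
  convergence in law is pointwise convergence of the probabilities to a probability mass function.
\<close>

definition steady_state_nat :: "'a measure \<Rightarrow> (nat \<Rightarrow> 'a \<Rightarrow> nat) \<Rightarrow> nat pmf \<Rightarrow> bool" where
  "steady_state_nat M X p \<longleftrightarrow>
    (\<forall>n. X n \<in> measurable M (count_space UNIV)) \<and>
    (\<forall>k. (\<lambda>n. measure M {x \<in> space M. X n x = k}) \<longlonglongrightarrow> pmf p k)"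

definition steady_state_real :: "'a measure \<Rightarrow> (nat \<Rightarrow> 'a \<Rightarrow> real) \<Rightarrow> real measure \<Rightarrow> bool" where
  "steady_state_real M X F \<longleftrightarrow>
    (\<forall>n. X n \<in> borel_measurable M) \<and> real_distribution F \<and>
    weak_conv_m (\<lambda>n. distr M borel (X n)) F"


section \<open>Transforms\<close>

definition lst :: "real measure \<Rightarrow> complex \<Rightarrow> complex" where
  "lst F s = (\<integral>y. exp (- s * of_real y) \<partial>F)"

definition mean :: "real measure \<Rightarrow> real" where
  "mean F = (\<integral>y. y \<partial>F)"

definition pgf :: "nat pmf \<Rightarrow> complex \<Rightarrow> complex" where
  "pgf p z = measure_pmf.expectation p (\<lambda>k. z ^ k)"

text \<open>The generating function of the number of arrivals during a period with law \<open>F\<close>.\<close>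

definition arrivals_gf :: "real \<Rightarrow> real measure \<Rightarrow> complex \<Rightarrow> complex" where
  "arrivals_gf lam F z = lst F (of_real lam - of_real lam * z)"

text \<open>The recursions start at index \<open>1\<close>; setting \<open>psi_H lam FH 0 z = z\<close> makes the case \<open>n = 1\<close> of
  both of them an instance of the general one. The value \<open>psi_V lam FH FV 0 z\<close> is not used.\<close>

definition psi_H :: "real \<Rightarrow> real measure \<Rightarrow> nat \<Rightarrow> complex \<Rightarrow> complex" where
  "psi_H lam FH n z = (arrivals_gf lam FH ^^ n) z"

definition psi_V :: "real \<Rightarrow> real measure \<Rightarrow> real measure \<Rightarrow> nat \<Rightarrow> complex \<Rightarrow> complex" where
  "psi_V lam FH FV n z = arrivals_gf lam FV (psi_H lam FH (n - 1) z)"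


section \<open>Mean batch service time and utilization\<close>

text \<open>\<open>p\<close> is the law of the number $L_E$ of customers left behind by a batch, so \<open>pmf p 0\<close> is the
  value at \<open>0\<close> of its generating function. A batch has $L_E$ customers, or one if $L_E = 0$. The
  utilization is the ratio of the mean batch service time to the mean time between successive
  service completions, which is longer by the mean idle time \<open>pmf p 0 / lam\<close>; both are multiplied
  by \<open>lam\<close>.\<close>

definition mean_batch_service :: "real measure \<Rightarrow> real measure \<Rightarrow> nat pmf \<Rightarrow> real" where
  "mean_batch_service FH FV p =
    (measure_pmf.expectation p real + pmf p 0) * mean FH + mean FV"

definition utilization :: "real \<Rightarrow> real measure \<Rightarrow> real measure \<Rightarrow> nat pmf \<Rightarrow> real" where
  "utilization lam FH FV p =
    (let rho = lam * mean FH; EL = measure_pmf.expectation p real in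
     (rho * EL + rho * pmf p 0 + lam * mean FV) /
     (rho * EL + (1 + rho) * pmf p 0 + lam * mean FV))"

end

theory Submission
  imports Defs
begin

text \<open>
  At the start of a service the residual interarrival times are again i.i.d. exponential, and the
  service data of this and the later batches are fresh, independently of the queue length that
  decides on the size of the batch. So the queue lengths at the service completions form a Markov
  chain, which moves from \<open>w\<close> to the number of Poisson arrivals during the service of \<open>max w 1\<close>
  customers. One more customer in a batch brings \<open>\<rho> < 1\<close> more arrivals on average, so that the
  chain contracts Lipschitz functions, and it has a stationary law with a finite mean. Iterating
  the stationarity equation of its generating function gives the infinite product and the series.

  The delay of customer \<open>j\<close> is determined by the service during which it arrives (or which it
  starts), so the expected value of \<open>f\<close> at this delay is a convolution over the index \<open>i \<le> j\<close> of
  the first customer of that batch. Counted in customers, the starts of services that find nobody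
  waiting form a renewal sequence with strictly aperiodic steps, and the renewal theorem turns the
  convolution into an average over the stationary law, in which every service counts with the
  number of customers whose delay it determines. That the \<open>f\<close>-weighted sums converge for all
  bounded \<open>f\<close> gives the limit law, and for \<open>f y = exp (- \<omega> * y)\<close> they are computed from
  the fact that the arrivals after an arrival epoch are again Poisson.
\<close>

section \<open>The renewal theorem\<close>

text \<open>The delay is awkward as a function of the batch that serves the customer, because the
  size of that batch is already an outcome of the preceding service. Charging the customer to the
  service during which it arrives makes the delay a function of the queue length at the start of
  that service and of fresh randomness, which the Markov property can integrate out. The index of
  the first customer is carried in the state because \<open>j\<close> is a fixed index, while the
  number of the service that covers it is random. The renewal theorem asks for a summable
  \<open>r\<close> whose convolution with the renewal sequence is constantly 1. That every customer
  is charged to exactly one service is such an identity, so the law of the cycle length is never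
  computed: the sum of \<open>r\<close> is the stationary mean number of customers charged to a
  service, divided by \<open>pmf \<pi> 0\<close>. Every service has a positive probability of no
  arrivals. This is used three times: the stationary law charges 0, the visits in a cycle determine
  the invariant measure, and a cycle can consist of a single customer.\<close>

lemma convolution_tendsto_along:
  fixes g x :: "nat \<Rightarrow> real"
  assumes g: "summable (\<lambda>n. \<bar>g n\<bar>)" and x: "\<And>n. \<bar>x n\<bar> \<le> B"
    and s: "filterlim s at_top sequentially"
    and lim: "\<And>k. (\<lambda>i. x (s i - k)) \<longlonglongrightarrow> l"
  shows "(\<lambda>i. \<Sum>m\<le>s i. g m * x (s i - m)) \<longlonglongrightarrow> (\<Sum>m. g m) * l"
proof -
  \<comment> \<open>Extended by 0 beyond \<open>s i\<close>, the finite sums become series over a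
    fixed index set, dominated by \<open>\<bar>g k\<bar> * B\<close>, and Tannery's theorem passes
    to the limit term by term.\<close>
  define a where "a k i = (if k \<le> s i then g k * x (s i - k) else 0)" for k i
  have a: "(\<lambda>i. a k i) \<longlonglongrightarrow> g k * l" for k
  proof (rule Lim_transform_eventually)
    show "(\<lambda>i. g k * x (s i - k)) \<longlonglongrightarrow> g k * l"
      by (intro tendsto_intros lim)
    show "\<forall>\<^sub>F i in sequentially. g k * x (s i - k) = a k i"
      using s[unfolded filterlim_at_top, rule_format, of k]
      by eventually_elim (simp add: a_def)
  qed
  have "0 \<le> B" using x[of 0] by linarith
  have bound: "norm (a k i) \<le> \<bar>g k\<bar> * B" for k i
    using x[of "s i - k"] \<open>0 \<le> B\<close> by (auto simp: a_def abs_mult intro!: mult_left_mono)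
  have "((\<lambda>i. suminf (\<lambda>k. a k i)) \<longlongrightarrow> suminf (\<lambda>k. g k * l)) sequentially"
    using tannerys_theorem[of a "\<lambda>k. g k * l" sequentially "\<lambda>k. \<bar>g k\<bar> * B"] a bound
      summable_mult2[OF g] by (auto simp: case_prod_unfold)
  moreover have "suminf (\<lambda>k. a k i) = (\<Sum>m\<le>s i. g m * x (s i - m))" for i
    by (subst suminf_finite[of "{..s i}"]) (auto simp: a_def)
  moreover have "suminf (\<lambda>k. g k * l) = (\<Sum>m. g m) * l"
    using summable_rabs_cancel[OF g] by (simp add: suminf_mult2)
  ultimately show ?thesis by simp
qed

lemma convolution_tendsto:
  fixes g x :: "nat \<Rightarrow> real"
  assumes g: "summable (\<lambda>n. \<bar>g n\<bar>)" and x: "x \<longlonglongrightarrow> l"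
  shows "(\<lambda>n. \<Sum>m\<le>n. g m * x (n - m)) \<longlonglongrightarrow> (\<Sum>m. g m) * l"
proof -
  obtain B where "\<And>n. \<bar>x n\<bar> \<le> B"
    using convergent_imp_Bseq[of x] x by (auto simp: convergent_def Bseq_def)
  moreover have "(\<lambda>i. x (i - k)) \<longlonglongrightarrow> l" for k
    using x filterlim_minus_const_nat_at_top[of k] by (rule filterlim_compose)
  ultimately show ?thesis
    using convolution_tendsto_along[OF g, of x B "\<lambda>i. i" l] by (auto simp: filterlim_ident)
qed

text \<open>Along a subsequence on which \<open>x\<close> approaches its limit superior \<open>l\<close>, the renewal equation
  writes \<open>l\<close> as an average of values that are asymptotically at most \<open>l\<close>, so that each
  of them with a positive weight tends to \<open>l\<close> as well.\<close>

lemma renewal_limsup_pred: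
  fixes f x :: "nat \<Rightarrow> real"
  assumes f: "\<And>n. 0 \<le> f n" "f sums 1" "0 < f 0"
    and x: "\<And>n. \<bar>x n\<bar> \<le> B" "\<And>n. x (Suc n) = (\<Sum>m\<le>n. f m * x (n - m))"
    and l: "\<And>e. 0 < e \<Longrightarrow> \<forall>\<^sub>F n in sequentially. x n < l + e"
    and s: "filterlim s at_top sequentially" "(\<lambda>i. x (s i)) \<longlonglongrightarrow> l"
  shows "(\<lambda>i. x (s i - 1)) \<longlonglongrightarrow> l"
proof -
  \<comment> \<open>The excess over \<open>l\<close> tends to 0 by the limsup hypothesis. It turns
    that asymptotic hypothesis into the bound \<open>x n \<le> l + p n\<close> for all
    \<open>n\<close>, which can be convolved with \<open>f\<close>.\<close>
  define p where "p n = max (x n - l) 0" for n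
  have p: "p \<longlonglongrightarrow> 0"
  proof (rule order_tendstoI)
    fix a :: real assume "0 < a"
    then show "\<forall>\<^sub>F n in sequentially. p n < a"
      using l[of a] by (auto simp: p_def elim!: eventually_mono)
  next
    fix a :: real assume "a < 0"
    then show "\<forall>\<^sub>F n in sequentially. a < p n"
      by (intro always_eventually) (auto simp: p_def less_max_iff_disj)
  qed
  have xp: "x n \<le> l + p n" for n by (simp add: p_def)
  define c where "c n = (\<Sum>m\<le>n. f m * p (n - m))" for n
  have c: "c \<longlonglongrightarrow> 0"
    unfolding c_def[abs_def]
    using convolution_tendsto[of f p 0] f p sums_summable[OF f(2)] by simp
  have F: "(\<lambda>n. \<Sum>m\<le>n. f m) \<longlonglongrightarrow> 1"
    using f(2) by (simp add: sums_def_le)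
  \<comment> \<open>Solving the renewal equation for \<open>x n\<close>, the value with weight
    \<open>f 0\<close>, and bounding all the other values by \<open>l + p\<close> gives this lower
    bound for \<open>x n\<close>.\<close>
  define b where "b n = (x (Suc n) - l * ((\<Sum>m\<le>n. f m) - f 0) - c n) / f 0" for n
  have bx: "b n \<le> x n" for n
  proof -
    have sp: "{..n} = insert 0 {1..n}" by auto
    have "x (Suc n) = f 0 * x n + (\<Sum>m=1..n. f m * x (n - m))"
      unfolding x(2) sp by simp
    also have "(\<Sum>m=1..n. f m * x (n - m)) \<le> (\<Sum>m=1..n. f m * (l + p (n - m)))"
      by (intro sum_mono mult_left_mono xp f)
    also have "\<dots> = l * (\<Sum>m=1..n. f m) + (\<Sum>m=1..n. f m * p (n - m))"
      by (simp add: algebra_simps sum.distrib sum_distrib_left)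
    also have "(\<Sum>m=1..n. f m * p (n - m)) \<le> c n"
      unfolding c_def sp using f by (simp add: p_def)
    also have "(\<Sum>m=1..n. f m) = (\<Sum>m\<le>n. f m) - f 0"
      unfolding sp by simp
    finally show ?thesis using f(3) by (simp add: b_def field_simps)
  qed
  have s1: "filterlim (\<lambda>i. s i - 1) at_top sequentially"
    using filterlim_compose[OF filterlim_minus_const_nat_at_top s(1)] .
  have sS: "\<forall>\<^sub>F i in sequentially. x (s i) = x (Suc (s i - 1))"
    using s(1)[unfolded filterlim_at_top, rule_format, of 1] by eventually_elim simp
  have "(\<lambda>i. x (Suc (s i - 1))) \<longlonglongrightarrow> l"
    by (rule Lim_transform_eventually[OF s(2) sS])
  then have "(\<lambda>i. b (s i - 1)) \<longlonglongrightarrow> (l - l * (1 - f 0) - 0) / f 0"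
    unfolding b_def using f(3)
    by (intro tendsto_intros filterlim_compose[OF F s1] filterlim_compose[OF c s1]) auto
  also have "(l - l * (1 - f 0) - 0) / f 0 = l" using f(3) by (simp add: field_simps)
  finally have lo: "(\<lambda>i. b (s i - 1)) \<longlonglongrightarrow> l" .
  have hi: "(\<lambda>i. l + p (s i - 1)) \<longlonglongrightarrow> l"
    using tendsto_add[OF tendsto_const filterlim_compose[OF p s1], of l] by simp
  show ?thesis
    by (rule tendsto_sandwich[OF _ _ lo hi]) (auto simp: bx xp)
qed

text \<open>Repeating the predecessor step gives convergence to \<open>l\<close> at every fixed lag
  \<open>k\<close> behind \<open>s i\<close>: seen backwards from \<open>s i\<close>, the sequence
  looks constant. Passing to the limit in the identity for \<open>r\<close> then determines
  \<open>l\<close>.\<close>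

lemma renewal_limsup:
  fixes f x r :: "nat \<Rightarrow> real"
  assumes f: "\<And>n. 0 \<le> f n" "f sums 1" "0 < f 0"
    and x: "\<And>n. \<bar>x n\<bar> \<le> B" "\<And>n. x (Suc n) = (\<Sum>m\<le>n. f m * x (n - m))"
    and l: "\<And>e. 0 < e \<Longrightarrow> \<forall>\<^sub>F n in sequentially. x n < l + e"
    and s: "filterlim s at_top sequentially" "(\<lambda>i. x (s i)) \<longlonglongrightarrow> l"
    and r: "summable (\<lambda>n. \<bar>r n\<bar>)" "\<And>n. (\<Sum>m\<le>n. r m * x (n - m)) = c"
  shows "c = (\<Sum>m. r m) * l"
proof -
  have "(\<lambda>i. x (s i - k)) \<longlonglongrightarrow> l" for k
  proof (induction k)
    case (Suc k)
    have "(\<lambda>i. x (s i - k - 1)) \<longlonglongrightarrow> l"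
      by (rule renewal_limsup_pred[OF f x l _ Suc.IH])
         (use filterlim_compose[OF filterlim_minus_const_nat_at_top s(1)] in auto)
    then show ?case by simp
  qed (use s in simp)
  from convolution_tendsto_along[OF r(1) x(1) s(1) this]
  show ?thesis unfolding r(2) by (simp add: LIMSEQ_const_iff)
qed

lemma limsup_subsequence_real:
  fixes x :: "nat \<Rightarrow> real"
  assumes "\<And>n. \<bar>x n\<bar> \<le> B"
  shows "\<exists>l s. (\<forall>e>0. \<forall>\<^sub>F n in sequentially. x n < l + e) \<and>
    filterlim s at_top sequentially \<and> (\<lambda>i. x (s i)) \<longlonglongrightarrow> l"
proof -
  let ?L = "limsup (\<lambda>n. ereal (x n))"
  have up: "?L \<le> ereal B"
    by (intro Limsup_bounded always_eventually) (use assms abs_le_D1 in auto)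
  have "ereal (- B) \<le> liminf (\<lambda>n. ereal (x n))"
  proof (intro Liminf_bounded always_eventually allI)
    show "ereal (- B) \<le> ereal (x n)" for n
      using assms[of n] by (simp add: abs_le_iff)
  qed
  also have "\<dots> \<le> ?L" by (intro Liminf_le_Limsup) simp
  finally have lo: "ereal (- B) \<le> ?L" .
  obtain l where l: "?L = ereal l"
    using up lo by (cases ?L) auto
  obtain s where s: "strict_mono s" "((\<lambda>n. ereal (x n)) \<circ> s) \<longlonglongrightarrow> ?L"
    using limsup_subseq_lim[of "\<lambda>n. ereal (x n)"] by blast
  show ?thesis
  proof (intro exI conjI allI impI)
    show "\<forall>\<^sub>F n in sequentially. x n < l + e" if "0 < e" for e
    proof -
      have "?L < ereal (l + e)" using that l by simp
      from Limsup_lessD[OF this] show ?thesis by simp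
    qed
    show "filterlim s at_top sequentially" by (rule filterlim_subseq[OF s(1)])
    show "(\<lambda>i. x (s i)) \<longlonglongrightarrow> l" using s(2) l by (simp add: o_def)
  qed
qed

text \<open>The renewal theorem of Erdos, Feller and Pollard, in the strongly aperiodic case
  \<open>0 < f 0\<close>. The index of \<open>f\<close> is shifted by one, and \<open>r\<close> plays the role of the tails of \<open>f\<close>.\<close>

lemma renewal_theorem:
  fixes f u r :: "nat \<Rightarrow> real"
  assumes f: "\<And>n. 0 \<le> f n" "f sums 1" "0 < f 0"
    and u: "\<And>n. \<bar>u n\<bar> \<le> B" "\<And>n. u (Suc n) = (\<Sum>m\<le>n. f m * u (n - m))"
    and r: "summable (\<lambda>n. \<bar>r n\<bar>)" "\<And>n. (\<Sum>m\<le>n. r m * u (n - m)) = 1"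
  shows "u \<longlonglongrightarrow> 1 / (\<Sum>m. r m)"
proof -
  obtain l s where l: "\<forall>e>0. \<forall>\<^sub>F n in sequentially. u n < l + e"
    "filterlim s at_top sequentially" "(\<lambda>i. u (s i)) \<longlonglongrightarrow> l"
    using limsup_subsequence_real[of u B, OF u(1)] by (elim exE conjE) (rule that)
  have 1: "1 = (\<Sum>m. r m) * l"
    by (rule renewal_limsup[OF f u l(1)[rule_format] l(2,3) r])
  have mb: "\<bar>- u n\<bar> \<le> B" for n using u(1) by simp
  obtain l' s' where l': "\<forall>e>0. \<forall>\<^sub>F n in sequentially. - u n < l' + e"
    "filterlim s' at_top sequentially" "(\<lambda>i. - u (s' i)) \<longlonglongrightarrow> l'"
    using limsup_subsequence_real[of "\<lambda>n. - u n" B, OF mb] by (elim exE conjE) (rule that)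
  \<comment> \<open>The same result for \<open>- u\<close>, whose limit superior is minus the limit
    inferior of \<open>u\<close>. Both are determined by the sum of \<open>r\<close>, which is
    nonzero by these very identities, so they coincide.\<close>
  have "- 1 = (\<Sum>m. r m) * l'"
    by (rule renewal_limsup[OF f _ _ l'(1)[rule_format] l'(2,3), where B = B])
       (use u r in \<open>simp_all add: sum_negf\<close>)
  with 1 have R: "(\<Sum>m. r m) \<noteq> 0" and "(\<Sum>m. r m) * (l' + l) = 0"
    by (auto simp: distrib_left)
  then have "l' + l = 0" by simp
  then have ll: "l' = - l" "l = 1 / (\<Sum>m. r m)"
    using 1 R by (auto simp: field_simps)
  show ?thesis unfolding ll(2)[symmetric]
  proof (rule order_tendstoI)
    fix a assume "a < l"
    then show "\<forall>\<^sub>F n in sequentially. a < u n"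
      using l'(1)[rule_format, of "l - a"] by (auto simp: ll(1) elim!: eventually_mono)
  next
    fix a assume "l < a"
    then show "\<forall>\<^sub>F n in sequentially. u n < a"
      using l(1)[rule_format, of "a - l"] by (auto elim!: eventually_mono)
  qed
qed

section \<open>Customers as the time scale of the queue length\<close>

text \<open>Tonelli for nonnegative double series: the exchange takes place in
  \<open>ennreal\<close>, where all sums exist, and finiteness of the total brings it back to the
  reals.\<close>

lemma double_series_swap:
  fixes t :: "nat \<Rightarrow> nat \<Rightarrow> real"
  assumes t: "\<And>k m. 0 \<le> t k m" "\<And>k. t k sums s k" and s: "s sums S"
  shows "summable (\<lambda>k. t k m)" "(\<lambda>m. \<Sum>k. t k m) sums S"
proof -
  have s0: "0 \<le> s k" for k using t sums_le[of "\<lambda>_. 0" "t k" 0 "s k"] by auto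
  have S0: "0 \<le> S" using s0 sums_le[of "\<lambda>_. 0" s 0 S] s by auto
  have "(\<Sum>m. \<Sum>k. ennreal (t k m)) = (\<Sum>k. \<Sum>m. ennreal (t k m))"
    using nn_integral_suminf[of "\<lambda>k m. ennreal (t k m)" "count_space UNIV"]
    by (simp add: nn_integral_count_space_nat)
  also have "\<dots> = (\<Sum>k. ennreal (s k))"
    using t suminf_ennreal2[OF t(1)] by (simp add: sums_iff)
  also have "\<dots> = ennreal S"
    using s s0 suminf_ennreal2[OF s0] by (simp add: sums_iff)
  finally have eq: "(\<Sum>m. \<Sum>k. ennreal (t k m)) = ennreal S" .
  have fin: "(\<Sum>k. ennreal (t k m)) \<noteq> \<top>" for m
  proof -
    have "(\<Sum>k. ennreal (t k m)) \<le> (\<Sum>m. \<Sum>k. ennreal (t k m))"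
      by (rule order_trans[OF _ sum_le_suminf[of _ "{m}"]]) auto
    with eq show ?thesis by (auto simp: top_unique)
  qed
  show sm: "summable (\<lambda>k. t k m)" for m
    by (rule summable_suminf_not_top[OF t(1) fin])
  have eq': "(\<Sum>m. ennreal (\<Sum>k. t k m)) = ennreal S"
    using eq suminf_ennreal2[OF t(1) sm] by simp
  have n: "0 \<le> (\<Sum>k. t k m)" for m by (rule suminf_nonneg[OF sm t(1)])
  have sm': "summable (\<lambda>m. \<Sum>k. t k m)"
    by (rule summable_suminf_not_top[OF n]) (subst eq', simp)
  have "ennreal (\<Sum>m. \<Sum>k. t k m) = ennreal S"
    unfolding eq'[symmetric] by (rule suminf_ennreal2[OF n sm', symmetric])
  then have "(\<Sum>m. \<Sum>k. t k m) = S"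
    using S0 suminf_nonneg[OF sm' n] by simp
  with sm' show "(\<lambda>m. \<Sum>k. t k m) sums S"
    by (simp add: sums_iff)
qed

lemma nonneg_sums_zero:
  fixes f :: "nat \<Rightarrow> real"
  assumes "f sums 0" "\<And>k. 0 \<le> f k"
  shows "f k = 0"
  using suminf_eq_zero_iff[of f] assms by (auto simp: sums_iff)

lemma integral_pmf_nat_sums:
  fixes p :: "nat pmf" and g :: "nat \<Rightarrow> 'b :: {banach, second_countable_topology}"
  assumes "integrable (measure_pmf p) g"
  shows "(\<lambda>k. pmf p k *\<^sub>R g k) sums measure_pmf.expectation p g"
proof -
  have "integrable (count_space UNIV) (\<lambda>k. pmf p k *\<^sub>R g k)"
    using assms by (simp add: measure_pmf_eq_density integrable_density)
  from sums_integral_count_space_nat[OF this] show ?thesis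
    by (simp add: measure_pmf_eq_density integral_density)
qed

lemma integrable_pmf_nat:
  fixes p :: "nat pmf"
  assumes "summable (\<lambda>k. pmf p k * g k)" "\<And>k. 0 \<le> (g k :: real)"
  shows "integrable (measure_pmf p) g"
  using assms by (simp add: measure_pmf_eq_density integrable_density integrable_count_space_nat_iff)

lemma pmf_nat_sums: "pmf (p :: nat pmf) sums 1"
  using integral_pmf_nat_sums[of p "\<lambda>_. 1 :: real"] by simp

lemma integrable_pmf_bounded:
  fixes p :: "'a pmf" and g :: "'a \<Rightarrow> 'b :: {banach, second_countable_topology}"
  assumes "\<And>k. norm (g k) \<le> B"
  shows "integrable (measure_pmf p) g"
  by (rule measure_pmf.integrable_const_bound[where B = B]) (use assms in auto)

locale customer_chain =
  fixes K :: "nat \<Rightarrow> nat pmf" and \<pi> :: "nat pmf"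
  assumes stationary: "bind_pmf \<pi> K = \<pi>"
    and K_pos: "\<And>w. 0 < pmf (K w) 0"
begin

text \<open>Measured in customers: a batch that starts with \<open>w\<close> customers waiting serves \<open>max w 1\<close> of
  them. \<open>taboo i w\<close> is the probability that some batch starts with customer \<open>i\<close> while \<open>w\<close>
  customers wait, and that no batch in between started with nobody waiting.\<close>

fun taboo :: "nat \<Rightarrow> nat \<Rightarrow> real" where
  "taboo i w = (if i = 0 then of_bool (w = 0) else if w = 0 then 0
     else \<Sum>k\<in>{k. max k 1 \<le> i}. taboo (i - max k 1) k * pmf (K k) w)"

declare taboo.simps [simp del]

text \<open>The recursion of \<open>taboo\<close> without the exclusion of state 0. For
  \<open>w = 0\<close> this is the law of the cycle length: the next service that finds nobody
  waiting starts exactly \<open>i\<close> customers later.\<close>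

definition next_taboo :: "nat \<Rightarrow> nat \<Rightarrow> real" where
  "next_taboo i w = (\<Sum>k\<in>{k. max k 1 \<le> i}. taboo (i - max k 1) k * pmf (K k) w)"

lemma finite_max_le [simp]: "finite {k::nat. max k 1 \<le> i}"
  by (rule finite_subset[of _ "{..i}"]) auto

lemma taboo_0: "taboo 0 w = of_bool (w = 0)"
  and taboo_Suc_0: "0 < i \<Longrightarrow> taboo i 0 = 0"
  and taboo_next: "0 < w \<Longrightarrow> taboo i w = next_taboo i w"
  by (subst taboo.simps; simp add: next_taboo_def)+

lemma taboo_nonneg: "0 \<le> taboo i w"
proof (induction i arbitrary: w rule: less_induct)
  case (less i)
  then show ?case
    by (cases "i = 0"; cases "w = 0")
       (auto simp: taboo_0 taboo_Suc_0 taboo_next next_taboo_def intro!: sum_nonneg mult_nonneg_nonneg)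
qed

lemma stationary_sums: "(\<lambda>k. pmf \<pi> k * pmf (K k) w) sums pmf \<pi> w"
  using integral_pmf_nat_sums[of \<pi> "\<lambda>k. pmf (K k) w"] integrable_pmf_bounded[of "\<lambda>k. pmf (K k) w" 1]
    pmf_bind[of \<pi> K w] stationary by (simp add: pmf_le_1)

lemma stationary_pos: "0 < pmf \<pi> 0"
proof -
  have "pmf \<pi> 0 \<noteq> 0"
  proof
    assume "pmf \<pi> 0 = 0"
    with stationary_sums[of 0] have "pmf \<pi> k * pmf (K k) 0 = 0" for k
      by (intro nonneg_sums_zero[of "\<lambda>k. pmf \<pi> k * pmf (K k) 0"]) auto
    then have "pmf \<pi> k = 0" for k using K_pos[of k] by (metis less_irrefl mult_eq_0_iff)
    then have "pmf \<pi> = (\<lambda>_. 0)" by auto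
    with pmf_nat_sums[of \<pi>] show False by (simp add: sums_iff)
  qed
  then show ?thesis by (simp add: pmf_nonneg less_le)
qed

text \<open>\<open>pmf \<pi> w / pmf \<pi> 0\<close> is an invariant measure with value 1 at 0, and
  the expected visits in a cycle are bounded by any such measure. The induction works because a
  batch advances the index by \<open>max k 1 \<ge> 1\<close>, so that the recursion for
  \<open>Suc n\<close> refers to sums up to \<open>n\<close> only.\<close>

lemma sum_taboo_le: "(\<Sum>i\<le>n. taboo i w) \<le> pmf \<pi> w / pmf \<pi> 0"
proof (induction n arbitrary: w)
  case 0
  show ?case using stationary_pos by (cases "w = 0") (simp_all add: taboo_0)
next
  case (Suc n)
  show ?case
  proof (cases "w = 0")
    case True
    have "(\<Sum>i\<le>Suc n. taboo i w) = taboo 0 w"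
      using True by (subst sum.atMost_Suc_shift) (simp add: taboo_Suc_0)
    then show ?thesis using True stationary_pos by (simp add: taboo_0)
  next
    case False
    have "(\<Sum>i\<le>Suc n. taboo i w) = (\<Sum>i\<le>Suc n. \<Sum>k\<in>{k\<in>{..Suc n}. max k 1 \<le> i}. taboo (i - max k 1) k * pmf (K k) w)"
      using False unfolding next_taboo_def[abs_def]
      by (intro sum.cong) (auto simp: taboo_next next_taboo_def intro!: sum.cong)
    also have "\<dots> = (\<Sum>k\<le>Suc n. \<Sum>i\<in>{i\<in>{..Suc n}. max k 1 \<le> i}. taboo (i - max k 1) k * pmf (K k) w)"
      by (rule sum.swap_restrict) auto
    also have "\<dots> \<le> (\<Sum>k\<le>Suc n. pmf (K k) w * (pmf \<pi> k / pmf \<pi> 0))"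
    proof (rule sum_mono)
      fix k
      have "(\<Sum>i\<in>{i\<in>{..Suc n}. max k 1 \<le> i}. taboo (i - max k 1) k) = (\<Sum>i\<in>(\<lambda>i. i - max k 1) ` {i\<in>{..Suc n}. max k 1 \<le> i}. taboo i k)"
        by (subst sum.reindex) (auto simp: inj_on_def)
      also have "\<dots> \<le> (\<Sum>i\<le>n. taboo i k)"
        by (rule sum_mono2) (auto simp: taboo_nonneg)
      also have "\<dots> \<le> pmf \<pi> k / pmf \<pi> 0" by (rule Suc.IH)
      finally have "pmf (K k) w * (\<Sum>i\<in>{i\<in>{..Suc n}. max k 1 \<le> i}. taboo (i - max k 1) k) \<le> pmf (K k) w * (pmf \<pi> k / pmf \<pi> 0)"
        by (rule mult_left_mono) simp
      then show "(\<Sum>i\<in>{i\<in>{..Suc n}. max k 1 \<le> i}. taboo (i - max k 1) k * pmf (K k) w) \<le> pmf (K k) w * (pmf \<pi> k / pmf \<pi> 0)"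
        by (simp only: sum_distrib_left mult.commute[of _ "pmf (K k) w"])
    qed
    also have "\<dots> = (\<Sum>k\<le>Suc n. pmf \<pi> k * pmf (K k) w) / pmf \<pi> 0"
      by (simp add: sum_divide_distrib add_divide_distrib mult.commute)
    also have "\<dots> \<le> pmf \<pi> w / pmf \<pi> 0"
    proof (rule divide_right_mono)
      show "(\<Sum>k\<le>Suc n. pmf \<pi> k * pmf (K k) w) \<le> pmf \<pi> w"
        using stationary_sums[of w] sum_le_suminf[of "\<lambda>k. pmf \<pi> k * pmf (K k) w" "{..Suc n}"]
        by (auto simp: sums_iff)
    qed simp
    finally show ?thesis .
  qed
qed

text \<open>Expected number of services in one cycle that start with \<open>w\<close> customers
  waiting. A cycle contains the service at its beginning but not the one at its end, so the value at
  0 is 1.\<close>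

definition occupation :: "nat \<Rightarrow> real" where
  "occupation w = (\<Sum>i. taboo i w)"

lemma taboo_sums: "(\<lambda>i. taboo i w) sums occupation w"
  and occupation_le: "occupation w \<le> pmf \<pi> w / pmf \<pi> 0"
proof -
  have "summable (\<lambda>i. taboo i w)"
    by (rule bounded_imp_summable[OF taboo_nonneg sum_taboo_le])
  then show *: "(\<lambda>i. taboo i w) sums occupation w"
    by (simp add: occupation_def summable_sums)
  then have "(\<lambda>n. \<Sum>i\<le>n. taboo i w) \<longlonglongrightarrow> occupation w" by (simp add: sums_def_le)
  then show "occupation w \<le> pmf \<pi> w / pmf \<pi> 0"
    by (rule LIMSEQ_le_const2) (use sum_taboo_le in auto)
qed

lemma occupation_nonneg: "0 \<le> occupation w"
  using taboo_sums sums_le[of "\<lambda>_. 0" "\<lambda>i. taboo i w" 0] taboo_nonneg by auto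

lemma occupation_0: "occupation 0 = 1"
proof -
  have "(\<lambda>i. taboo i 0) = (\<lambda>i. of_bool (i = 0))"
    by (auto simp: taboo_0 taboo_Suc_0)
  moreover have "(\<lambda>i. of_bool (i = (0::nat)) :: real) sums 1"
    using sums_single[of 0 "\<lambda>_. 1 :: real"] by (simp add: of_bool_def)
  ultimately show ?thesis using taboo_sums[of 0] sums_unique2 by fastforce
qed

text \<open>For fixed \<open>k\<close> the sum over \<open>m\<close> is a Cauchy product, and
  Tonelli exchanges it with the sum over \<open>k\<close>. Since \<open>g k l\<close> vanishes for
  \<open>l < k\<close>, only the terms with \<open>k \<le> m\<close> contribute.\<close>

lemma occupation_convolution_sums:
  fixes g :: "nat \<Rightarrow> nat \<Rightarrow> real"
  assumes g: "\<And>k l. 0 \<le> g k l" "\<And>k l. l < k \<Longrightarrow> g k l = 0" "\<And>k. g k sums s k"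
    and S: "(\<lambda>k. occupation k * s k) sums S"
  shows "(\<lambda>m. \<Sum>i\<le>m. \<Sum>k\<le>m. taboo i k * g k (m - i)) sums S"
proof -
  define t where "t k m = (\<Sum>i\<le>m. taboo i k * g k (m - i))" for k m
  have nn: "summable (\<lambda>l. norm (g k l))" for k
    using g(1,3)[of k] by (simp add: sums_iff)
  have nt: "summable (\<lambda>l. norm (taboo l k))" for k
    using taboo_sums taboo_nonneg by (simp add: sums_iff)
  have "t k sums (occupation k * s k)" for k
    using Cauchy_product_sums[OF nt nn, of k k] g(3)[of k] taboo_sums[of k]
    unfolding t_def[abs_def] by (simp add: sums_iff)
  moreover have "0 \<le> t k m" for k m
    unfolding t_def by (intro sum_nonneg mult_nonneg_nonneg taboo_nonneg g)
  ultimately have "(\<lambda>m. \<Sum>k. t k m) sums S"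
    using double_series_swap(2)[OF _ _ S] by blast
  moreover have "(\<Sum>k. t k m) = (\<Sum>i\<le>m. \<Sum>k\<le>m. taboo i k * g k (m - i))" for m
  proof -
    have "(\<Sum>k. t k m) = (\<Sum>k\<le>m. t k m)"
      by (rule suminf_finite) (auto simp: t_def g(2) intro!: sum.neutral)
    then show ?thesis unfolding t_def by (subst (asm) sum.swap)
  qed
  ultimately show ?thesis by simp
qed

lemma next_taboo_sums:
  assumes "(\<lambda>k. occupation k * pmf (K k) w) sums S"
  shows "(\<lambda>i. next_taboo i w) sums S"
proof -
  \<comment> \<open>A point mass at the batch size \<open>max k 1\<close>, weighted with the
    transition probability: convolving \<open>taboo\<close> with it reproduces the recursion of
    \<open>next_taboo\<close>.\<close>
  define g where "g k l = of_bool (l = max k 1) * pmf (K k) w" for k l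
  have "g k sums pmf (K k) w" for k
    
  proof -
    have "g k = (\<lambda>l. if l = max k 1 then pmf (K k) w else 0)" by (auto simp: g_def)
    then show ?thesis using sums_single[of "max k 1" "\<lambda>_. pmf (K k) w"] by simp
  qed
  then have "(\<lambda>m. \<Sum>i\<le>m. \<Sum>k\<le>m. taboo i k * g k (m - i)) sums S"
    by (rule occupation_convolution_sums[OF _ _ _ assms, rotated 2]) (auto simp: g_def)
  moreover have "(\<Sum>i\<le>m. \<Sum>k\<le>m. taboo i k * g k (m - i)) = next_taboo m w" for m
  proof -
    have "(\<Sum>i\<le>m. taboo i k * g k (m - i)) = of_bool (max k 1 \<le> m) * (taboo (m - max k 1) k * pmf (K k) w)" for k
    proof -
      have "(\<Sum>i\<le>m. taboo i k * g k (m - i)) = (\<Sum>i\<le>m. if i = m - max k 1 then of_bool (max k 1 \<le> m) * (taboo i k * pmf (K k) w) else 0)"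
        by (intro sum.cong) (auto simp: g_def)
      then show ?thesis by simp
    qed
    then have "(\<Sum>i\<le>m. \<Sum>k\<le>m. taboo i k * g k (m - i)) = (\<Sum>k\<le>m. of_bool (max k 1 \<le> m) * (taboo (m - max k 1) k * pmf (K k) w))"
      by (subst sum.swap) simp
    also have "\<dots> = next_taboo m w"
      unfolding next_taboo_def by (rule sum.mono_neutral_cong_right) auto
    finally show ?thesis .
  qed
  ultimately show ?thesis by simp
qed

lemma occupation_summable: "summable occupation"
  by (rule summable_comparison_test'[of "\<lambda>w. pmf \<pi> w / pmf \<pi> 0" 0])
     (use pmf_nat_sums[of \<pi>] occupation_le occupation_nonneg in \<open>auto simp: sums_iff intro: summable_divide\<close>)

lemma occupation_K_summable: "summable (\<lambda>k. occupation k * pmf (K k) w)"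
  by (rule summable_comparison_test'[OF occupation_summable, of 0])
     (auto simp: occupation_nonneg abs_mult pmf_le_1 mult_left_le)

text \<open>Summing \<open>occupation k * K k w\<close> over all \<open>w\<close> returns the total occupation, and the
  terms with \<open>w > 0\<close> account for all of it but the initial visit to \<open>0\<close>: returns are certain.\<close>

lemma occupation_stationary: "(\<lambda>k. occupation k * pmf (K k) w) sums occupation w"
proof -
  define R where "R w = (\<Sum>k. occupation k * pmf (K k) w)" for w
  have R: "(\<lambda>k. occupation k * pmf (K k) w) sums R w" for w
    unfolding R_def by (rule summable_sums[OF occupation_K_summable])
  have pos: "R w = occupation w" if "0 < w" for w
    using next_taboo_sums[OF R[of w]] taboo_sums[of w] that
    by (simp add: taboo_next sums_unique2)
  have "(\<lambda>w. occupation k * pmf (K k) w) sums occupation k" for k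
    using sums_mult[OF pmf_nat_sums[of "K k"], of "occupation k"] by simp
  from double_series_swap(2)[OF _ this summable_sums[OF occupation_summable]]
  have "R sums (\<Sum>w. occupation w)"
    unfolding R_def by (simp add: occupation_nonneg)
  then have "(\<lambda>w. R w - occupation w) sums 0"
    using sums_diff[OF _ summable_sums[OF occupation_summable], of R] by fastforce
  moreover have "(\<lambda>w. R w - occupation w) sums (R 0 - occupation 0)"
    using sums_finite[of "{0}" "\<lambda>w. R w - occupation w"] pos by auto
  ultimately have "R 0 = occupation 0" using sums_unique2 by fastforce
  then have "R w = occupation w" using pos by (cases "w = 0") auto
  then show ?thesis using R[of w] by simp
qed

text \<open>The difference \<open>d\<close> of the two sides is nonnegative, vanishes at 0 and
  satisfies the invariance equation there. So every term \<open>d k * pmf (K k) 0\<close> is 0, and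
  the second factor is positive.\<close>

lemma occupation_eq: "occupation w = pmf \<pi> w / pmf \<pi> 0"
proof -
  define d where "d w = pmf \<pi> w / pmf \<pi> 0 - occupation w" for w
  have d0: "0 \<le> d w" for w using occupation_le by (simp add: d_def)
  have "(\<lambda>k. d k * pmf (K k) 0) sums d 0"
    using sums_diff[OF sums_divide[OF stationary_sums[of 0], of "pmf \<pi> 0"] occupation_stationary[of 0]]
    by (simp add: d_def algebra_simps)
  moreover have "d 0 = 0" using stationary_pos by (simp add: d_def occupation_0)
  ultimately have "d w * pmf (K w) 0 = 0"
    by (intro nonneg_sums_zero[of "\<lambda>k. d k * pmf (K k) 0"]) (simp_all add: d0)
  then have "d w = 0" using K_pos[of w] by (metis less_irrefl mult_eq_0_iff)
  then show ?thesis by (simp add: d_def)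
qed

section \<open>Renewal structure of the visits and averages over customers\<close>

context
  fixes v :: "nat \<Rightarrow> nat \<Rightarrow> real"
  assumes v_rec: "\<And>i w. v i w = of_bool (i = 0 \<and> w = 0) +
    (\<Sum>k\<in>{k. max k 1 \<le> i}. v (i - max k 1) k * pmf (K k) w)"
begin

lemma renewal_decomposition_step:
  assumes "\<And>j k. j < i \<Longrightarrow> v j k = (\<Sum>m\<le>j. v (j - m) 0 * taboo m k)"
  shows "(\<Sum>k\<in>{k. max k 1 \<le> i}. v (i - max k 1) k * pmf (K k) w) = (\<Sum>m\<le>i. v (i - m) 0 * next_taboo m w)"
proof -
  have "(\<Sum>m\<le>i. v (i - m) 0 * next_taboo m w) =
      (\<Sum>m\<le>i. \<Sum>k\<in>{k\<in>{k. max k 1 \<le> i}. max k 1 \<le> m}. v (i - m) 0 * (taboo (m - max k 1) k * pmf (K k) w))"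
    unfolding next_taboo_def sum_distrib_left by (intro sum.cong refl) auto
  also have "\<dots> = (\<Sum>k\<in>{k. max k 1 \<le> i}. \<Sum>m\<in>{m\<in>{..i}. max k 1 \<le> m}. v (i - m) 0 * (taboo (m - max k 1) k * pmf (K k) w))"
    by (rule sum.swap_restrict) auto
  also have "\<dots> = (\<Sum>k\<in>{k. max k 1 \<le> i}. v (i - max k 1) k * pmf (K k) w)"
  proof (rule sum.cong[OF refl])
    fix k assume k: "k \<in> {k. max k 1 \<le> i}"
    have "(\<Sum>m\<in>{m\<in>{..i}. max k 1 \<le> m}. v (i - m) 0 * (taboo (m - max k 1) k * pmf (K k) w)) =
        (\<Sum>m\<le>i - max k 1. v (i - max k 1 - m) 0 * taboo m k * pmf (K k) w)"
      by (rule sum.reindex_bij_witness[of _ "\<lambda>m. m + max k 1" "\<lambda>m. m - max k 1"])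
         (use k in \<open>auto simp: mult.assoc\<close>)
    also have "\<dots> = v (i - max k 1) k * pmf (K k) w"
      using k by (subst assms[of "i - max k 1"]) (auto simp: sum_distrib_right)
    finally show "(\<Sum>m\<in>{m\<in>{..i}. max k 1 \<le> m}. v (i - m) 0 * (taboo (m - max k 1) k * pmf (K k) w)) =
        v (i - max k 1) k * pmf (K k) w" .
  qed
  finally show ?thesis ..
qed

text \<open>With \<open>v i w\<close> read as the probability that a service starts with customer
  \<open>i\<close> while \<open>w\<close> wait, this splits at the last service up to that point
  which found nobody waiting: it started with customer \<open>i - m\<close>, and state 0 was avoided
  afterwards.\<close>

lemma renewal_decomposition: "v i w = (\<Sum>m\<le>i. v (i - m) 0 * taboo m w)"
proof (induction i arbitrary: w rule: less_induct)
  case (less i)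
  show ?case
  proof (cases "w = 0")
    case True
    have "(\<Sum>m\<le>i. v (i - m) 0 * taboo m 0) = (\<Sum>m\<le>i. if m = 0 then v i 0 else 0)"
      by (intro sum.cong) (auto simp: taboo_0 taboo_Suc_0)
    then show ?thesis using True by simp
  next
    case False
    then show ?thesis
      using renewal_decomposition_step[OF less.IH, of i w] by (subst v_rec) (simp add: taboo_next)
  qed
qed

text \<open>The renewal equation with the cycle length as its step; the index is shifted because a
  cycle contains at least one customer.\<close>

lemma first_return_renewal:
  "v (Suc n) 0 = (\<Sum>m\<le>n. next_taboo (Suc m) 0 * v (n - m) 0)"
proof -
  have "v (Suc n) 0 = (\<Sum>m\<le>Suc n. v (Suc n - m) 0 * next_taboo m 0)"
    using renewal_decomposition_step[of "Suc n" 0, OF renewal_decomposition] v_rec[of "Suc n" 0] by simp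
  also have "\<dots> = (\<Sum>m\<le>n. v (n - m) 0 * next_taboo (Suc m) 0)"
    by (simp only: sum.atMost_Suc_shift) (simp add: next_taboo_def)
  finally show ?thesis by (simp add: mult.commute)
qed

text \<open>Associativity of convolution: \<open>v\<close> is the sequence of visits to 0 convolved
  with \<open>taboo\<close>, so the weights \<open>g\<close> can be convolved with
  \<open>taboo\<close> first. A sum over services becomes a sum over cycles.\<close>

lemma convolution_decomposition:
  fixes g :: "nat \<Rightarrow> nat \<Rightarrow> real"
  assumes g: "\<And>k l. l < k \<Longrightarrow> g k l = 0"
  shows "(\<Sum>i\<le>j. \<Sum>w\<le>j. v i w * g w (j - i)) =
    (\<Sum>m\<le>j. (\<Sum>i\<le>m. \<Sum>k\<le>m. taboo i k * g k (m - i)) * v (j - m) 0)"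
proof -
  have "(\<Sum>i\<le>j. \<Sum>w\<le>j. v i w * g w (j - i)) =
      (\<Sum>i\<le>j. \<Sum>m\<in>{m\<in>{..j}. m \<le> i}. v (i - m) 0 * (\<Sum>w\<le>j. taboo m w * g w (j - i)))"
  proof (rule sum.cong[OF refl])
    fix i assume "i \<in> {..j}"
    then have [simp]: "{m\<in>{..j}. m \<le> i} = {..i}" by auto
    show "(\<Sum>w\<le>j. v i w * g w (j - i)) =
      (\<Sum>m\<in>{m\<in>{..j}. m \<le> i}. v (i - m) 0 * (\<Sum>w\<le>j. taboo m w * g w (j - i)))"
      unfolding renewal_decomposition[of i]
      unfolding \<open>{m\<in>{..j}. m \<le> i} = {..i}\<close> sum_distrib_left sum_distrib_right mult.assoc
      by (rule sum.swap)
  qed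
  also have "\<dots> = (\<Sum>(i, m)\<in>Sigma {..j} (\<lambda>i. {m\<in>{..j}. m \<le> i}). v (i - m) 0 * (\<Sum>w\<le>j. taboo m w * g w (j - i)))"
    by (rule sum.Sigma) auto
  also have "\<dots> = (\<Sum>(m, i)\<in>Sigma {..j} (\<lambda>m. {..m}). v (j - m) 0 * (\<Sum>w\<le>j. taboo i w * g w (m - i)))"
    by (rule sum.reindex_bij_witness[of _ "\<lambda>(m, i). (j - m + i, i)" "\<lambda>(i, m). (j - i + m, m)"]) auto
  also have "\<dots> = (\<Sum>m\<le>j. \<Sum>i\<le>m. v (j - m) 0 * (\<Sum>w\<le>j. taboo i w * g w (m - i)))"
    by (rule sum.Sigma[symmetric]) auto
  also have "\<dots> = (\<Sum>m\<le>j. (\<Sum>i\<le>m. \<Sum>k\<le>m. taboo i k * g k (m - i)) * v (j - m) 0)"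
  proof (rule sum.cong[OF refl])
    fix m assume m: "m \<in> {..j}"
    have "(\<Sum>w\<le>j. taboo i w * g w (m - i)) = (\<Sum>k\<le>m. taboo i k * g k (m - i))" if "i \<le> m" for i
      using m that by (intro sum.mono_neutral_right) (auto simp: g)
    then show "(\<Sum>i\<le>m. v (j - m) 0 * (\<Sum>w\<le>j. taboo i w * g w (m - i))) =
        (\<Sum>i\<le>m. \<Sum>k\<le>m. taboo i k * g k (m - i)) * v (j - m) 0"
      by (simp add: sum_distrib_left[symmetric] mult.commute)
  qed
  finally show ?thesis .
qed

text \<open>\<open>a k l\<close> is meant as the probability that a service started with
  \<open>k\<close> waiting is charged with the customer at offset \<open>l\<close>, and
  \<open>g\<close> as a weighted part of it. That the charges add up to 1 for each customer supplies
  the identity for \<open>r\<close> in the renewal theorem. Both sums over a cycle carry the factor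
  \<open>1 / pmf \<pi> 0\<close>, which cancels in the ratio.\<close>

theorem customer_average_limit:
  fixes a g :: "nat \<Rightarrow> nat \<Rightarrow> real"
  assumes v01: "\<And>i. 0 \<le> v i 0" "\<And>i. v i 0 \<le> 1"
    and a: "\<And>k l. l < k \<Longrightarrow> a k l = 0" "\<And>k. a k sums A k"
      "integrable (measure_pmf \<pi>) A"
      "\<And>j. (\<Sum>i\<le>j. \<Sum>w\<le>j. v i w * a w (j - i)) = 1"
    and g: "\<And>k l. 0 \<le> g k l" "\<And>k l. g k l \<le> a k l" "\<And>k. g k sums G k"
  shows "(\<lambda>j. \<Sum>i\<le>j. \<Sum>w\<le>j. v i w * g w (j - i))
    \<longlonglongrightarrow> measure_pmf.expectation \<pi> G / measure_pmf.expectation \<pi> A"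
proof -
  have a0: "0 \<le> a k l" for k l using g(1,2)[of k l] by linarith
  have A0: "0 \<le> A k" for k using a0 a(2)[of k] sums_le[of "\<lambda>_. 0" "a k" 0] by auto
  have G0: "0 \<le> G k" for k using g(1) g(3)[of k] sums_le[of "\<lambda>_. 0" "g k" 0] by auto
  have GA: "G k \<le> A k" for k using sums_le[OF g(2) g(3) a(2)] .
  have intG: "integrable (measure_pmf \<pi>) G"
    by (rule Bochner_Integration.integrable_bound[OF a(3)]) (use GA G0 A0 in auto)
  have g0: "g k l = 0" if "l < k" for k l using g(1,2)[of k l] a(1)[OF that] by simp
  have os: "(\<lambda>k. occupation k * F k) sums (measure_pmf.expectation \<pi> F / pmf \<pi> 0)"
    if "integrable (measure_pmf \<pi>) F" for F :: "nat \<Rightarrow> real"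
    using sums_divide[OF integral_pmf_nat_sums[OF that], of "pmf \<pi> 0"] by (simp add: occupation_eq)
  define r where "r m = (\<Sum>i\<le>m. \<Sum>k\<le>m. taboo i k * a k (m - i))" for m
  define c where "c m = (\<Sum>i\<le>m. \<Sum>k\<le>m. taboo i k * g k (m - i))" for m
  have r: "r sums (measure_pmf.expectation \<pi> A / pmf \<pi> 0)"
    unfolding r_def[abs_def] by (rule occupation_convolution_sums[OF a0 a(1,2) os[OF a(3)]])
  have c: "c sums (measure_pmf.expectation \<pi> G / pmf \<pi> 0)"
    unfolding c_def[abs_def] by (rule occupation_convolution_sums[OF g(1) g0 g(3) os[OF intG]])
  have abs: "\<bar>r m\<bar> = r m" "\<bar>c m\<bar> = c m" for m
    unfolding r_def c_def
    by (intro abs_of_nonneg sum_nonneg mult_nonneg_nonneg taboo_nonneg a0 g(1))+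
  have f: "(\<lambda>n. next_taboo (Suc n) 0) sums 1"
    using sums_Suc_iff[of "\<lambda>n. next_taboo n 0" 1] next_taboo_sums[OF occupation_stationary[of 0]]
    by (simp add: occupation_0 next_taboo_def)
  have "{k::nat. max k 1 \<le> 1} = {0, 1}" by auto
  \<comment> \<open>A cycle has length one when nobody arrives during its first service.\<close>
  then have f0: "0 < next_taboo (Suc 0) 0"
    using K_pos[of 0] by (simp add: next_taboo_def taboo_0)
  have u: "(\<lambda>n. v n 0) \<longlonglongrightarrow> 1 / (\<Sum>m. r m)"
  proof (rule renewal_theorem[OF _ f f0])
    show "0 \<le> next_taboo (Suc n) 0" for n
      unfolding next_taboo_def by (intro sum_nonneg mult_nonneg_nonneg taboo_nonneg) simp
    show "\<bar>v n 0\<bar> \<le> 1" for n using v01[of n] by simp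
    show "(\<Sum>m\<le>n. r m * v (n - m) 0) = 1" for n
      using convolution_decomposition[of a n, OF a(1)] a(4)[of n] by (simp add: r_def)
  qed (use r abs in \<open>simp_all add: first_return_renewal sums_iff\<close>)
  have "(\<lambda>n. \<Sum>m\<le>n. c m * v (n - m) 0) \<longlonglongrightarrow> (\<Sum>m. c m) * (1 / (\<Sum>m. r m))"
    by (rule convolution_tendsto[OF _ u]) (use c abs in \<open>simp add: sums_iff\<close>)
  moreover have "(\<Sum>m. c m) * (1 / (\<Sum>m. r m)) = measure_pmf.expectation \<pi> G / measure_pmf.expectation \<pi> A"
    using r c stationary_pos by (simp add: sums_iff)
  moreover have "(\<Sum>m\<le>n. c m * v (n - m) 0) = (\<Sum>i\<le>n. \<Sum>w\<le>n. v i w * g w (n - i))" for n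
    using convolution_decomposition[of g n, OF g0] by (simp add: c_def)
  ultimately show ?thesis by simp
qed

end

end

section \<open>Poisson arrivals\<close>

text \<open>An infinite set of arrivals would be counted as 0 by \<open>card\<close>. The predicate
  \<open>exactly\<close> below describes the sample points with a genuine finite count, and they
  have probability 1.\<close>

definition arrivals_upto :: "(nat \<Rightarrow> real) \<Rightarrow> real \<Rightarrow> nat" where
  "arrivals_upto X s = card {l. (\<Sum>i\<le>l. X i) \<le> s}"

text \<open>\<open>X w\<close> is the gap in progress at time \<open>s\<close> after
  \<open>w\<close> arrivals, and only its part after \<open>s\<close> remains.\<close>

definition residual :: "nat \<Rightarrow> (nat \<Rightarrow> real) \<Rightarrow> real \<Rightarrow> nat \<Rightarrow> real" where
  "residual w X s = case_nat ((\<Sum>i\<le>w. X i) - s) (\<lambda>i. X (Suc (w + i)))"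

text \<open>The interarrival times seen by the server at the start of the next service, if \<open>w\<close>
  customers arrive during a service of length \<open>s\<close>: for \<open>w = 0\<close> the next service starts
  only with the arrival of the next customer, who is then no longer among the arrivals to come.\<close>

definition next_arrivals :: "nat \<Rightarrow> (nat \<Rightarrow> real) \<Rightarrow> real \<Rightarrow> nat \<Rightarrow> real" where
  "next_arrivals w X s = (if w = 0 then \<lambda>i. X (Suc i) else residual w X s)"

definition poisson_weight :: "real \<Rightarrow> nat \<Rightarrow> real" where
  "poisson_weight r w = r ^ w / fact w * exp (- r)"

lemma poisson_weight_nonneg: "0 \<le> r \<Longrightarrow> 0 \<le> poisson_weight r w"
  by (simp add: poisson_weight_def)

lemma poisson_weight_gf_sums':
  fixes z :: "'b :: {real_normed_field, banach}"
  shows "(\<lambda>w. of_real (poisson_weight r w) * z ^ w) sums exp (- (of_real r * (1 - z)))"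
proof -
  have "(\<lambda>w. (of_real r * z) ^ w /\<^sub>R fact w * exp (- of_real r)) sums (exp (of_real r * z) * exp (- of_real r))"
    by (intro sums_mult2 exp_converges)
  moreover have "exp (of_real r * z) * exp (- of_real r) = exp (- (of_real r * (1 - z)))"
    by (simp add: exp_add_commuting[symmetric] algebra_simps)
  moreover have "(\<lambda>w. (of_real r * z) ^ w /\<^sub>R fact w * exp (- of_real r)) = (\<lambda>w. of_real (poisson_weight r w) * z ^ w)"
    by (auto simp: poisson_weight_def power_mult_distrib scaleR_conv_of_real exp_of_real[symmetric] field_simps)
  ultimately show ?thesis by simp
qed

lemma poisson_weight_gf_sums: "(\<lambda>w. poisson_weight r w * z ^ w) sums exp (- (r * (1 - z)))" for z :: real
  using poisson_weight_gf_sums'[of r z] by simp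

locale poisson_arrivals =
  fixes lam :: real
  assumes lam_pos: "0 < lam"
begin

definition interarrival_law :: "real measure" where
  "interarrival_law = density lborel (exponential_density lam)"

definition gaps_law :: "(nat \<Rightarrow> real) measure" where
  "gaps_law = (\<Pi>\<^sub>M i\<in>UNIV. interarrival_law)"

lemma sets_interarrival_law [measurable_cong, simp]: "sets interarrival_law = sets borel"
  by (simp add: interarrival_law_def)

lemma space_interarrival_law [simp]: "space interarrival_law = UNIV"
  by (simp add: interarrival_law_def)

lemma sets_gaps_law [measurable_cong]: "sets gaps_law = sets (\<Pi>\<^sub>M i\<in>UNIV. borel)"
  unfolding gaps_law_def by (rule sets_PiM_cong) auto

lemma space_gaps_law [simp]: "space gaps_law = UNIV"
  by (simp add: gaps_law_def space_PiM)

lemma component_gaps_law [measurable]: "(\<lambda>X. X i) \<in> borel_measurable gaps_law"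
  by (simp cong: measurable_cong_sets add: sets_gaps_law)

lemma measurable_gaps_law:
  "(\<And>i. (\<lambda>x. f x i) \<in> borel_measurable M) \<Longrightarrow> f \<in> measurable M gaps_law"
  by (simp cong: measurable_cong_sets add: sets_gaps_law)
     (auto intro: measurable_PiM_single' simp: space_PiM)

lemma prob_interarrival_law: "prob_space interarrival_law"
  unfolding interarrival_law_def by (rule prob_space_exponential_density[OF lam_pos])

sublocale A: sequence_space interarrival_law
proof -
  interpret E: prob_space interarrival_law by (rule prob_interarrival_law)
  show "sequence_space interarrival_law"
    by (simp add: sequence_space_def product_prob_space_def product_sigma_finite_def
        product_prob_space_axioms_def E.sigma_finite_measure_axioms E.prob_space_axioms)
qed

sublocale gaps_law: prob_space gaps_law
  unfolding gaps_law_def by (intro prob_space_PiM prob_interarrival_law)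

lemma case_nat_gaps_law [measurable]: "(\<lambda>(x, X). case_nat x X) \<in> measurable (borel \<Otimes>\<^sub>M gaps_law) gaps_law"
proof (rule measurable_gaps_law)
  fix i
  show "(\<lambda>p. (case p of (x, X) \<Rightarrow> case_nat x X) i) \<in> borel_measurable (borel \<Otimes>\<^sub>M gaps_law)"
    by (cases i) (simp_all add: case_prod_unfold)
qed

lemma shift_gaps_law:
  assumes f: "f \<in> measurable M gaps_law"
  shows "(\<lambda>x i. f x (Suc i)) \<in> measurable M gaps_law" "(\<lambda>x i. f x (Suc (l + i))) \<in> measurable M gaps_law"
  by (intro measurable_gaps_law measurable_compose[OF f component_gaps_law])+

lemma nn_integral_gaps_law_case_nat:
  assumes [measurable]: "F \<in> borel_measurable gaps_law"
  shows "(\<integral>\<^sup>+X. F X \<partial>gaps_law) =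
    (\<integral>\<^sup>+x. ennreal (erlang_density 0 lam x) * (\<integral>\<^sup>+X. F (case_nat x X) \<partial>gaps_law) \<partial>lborel)"
proof -
  have gaps_law: "gaps_law = distr (interarrival_law \<Otimes>\<^sub>M gaps_law) gaps_law (\<lambda>(x, X). case_nat x X)"
    using A.PiM_iter by (simp add: gaps_law_def)
  have [measurable]: "(\<lambda>(x, X). case_nat x X) \<in> measurable (interarrival_law \<Otimes>\<^sub>M gaps_law) gaps_law"
    using case_nat_gaps_law by (simp cong: measurable_cong_sets)
  have "(\<integral>\<^sup>+X. F X \<partial>gaps_law) = (\<integral>\<^sup>+(x, X). F (case_nat x X) \<partial>(interarrival_law \<Otimes>\<^sub>M gaps_law))"
    by (subst gaps_law, subst nn_integral_distr) (simp_all add: case_prod_unfold)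
  also have "\<dots> = (\<integral>\<^sup>+x. (\<integral>\<^sup>+X. F (case_nat x X) \<partial>gaps_law) \<partial>interarrival_law)"
    by (subst gaps_law.nn_integral_fst[symmetric]) (simp_all add: case_prod_unfold)
  also have "\<dots> = (\<integral>\<^sup>+x. ennreal (erlang_density 0 lam x) * (\<integral>\<^sup>+X. F (case_nat x X) \<partial>gaps_law) \<partial>lborel)"
    unfolding interarrival_law_def by (subst nn_integral_density) (auto simp: exponential_density_def)
  finally show ?thesis .
qed

lemma nn_integral_gaps_law_shift:
  assumes [measurable]: "F \<in> borel_measurable gaps_law"
  shows "(\<integral>\<^sup>+X. F (\<lambda>i. X (Suc i)) \<partial>gaps_law) = (\<integral>\<^sup>+X. F X \<partial>gaps_law)"
proof -
  have [measurable]: "(\<lambda>X. F (\<lambda>i. X (Suc i))) \<in> borel_measurable gaps_law"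
    by (rule measurable_compose[OF shift_gaps_law(1)]) simp_all
  have "(\<integral>\<^sup>+x. ennreal (erlang_density 0 lam x) \<partial>lborel) = 1"
    using prob_space.emeasure_space_1[OF prob_interarrival_law] lam_pos
    by (simp add: interarrival_law_def emeasure_density)
  then show ?thesis
    by (subst nn_integral_gaps_law_case_nat) (simp_all add: nn_integral_multc)
qed

text \<open>Induction by splitting off the first gap: the arrival epoch is a sum of
  \<open>l + 1\<close> independent exponential gaps, independent of all later gaps, and Erlang
  densities are closed under convolution with the exponential one.\<close>

lemma nn_integral_arrival_time:
  assumes "(\<lambda>(t, X). G t X) \<in> borel_measurable (borel \<Otimes>\<^sub>M gaps_law)"
  shows "(\<integral>\<^sup>+X. G (\<Sum>i\<le>l. X i) (\<lambda>i. X (Suc (l + i))) \<partial>gaps_law) =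
    (\<integral>\<^sup>+t. ennreal (erlang_density l lam t) * (\<integral>\<^sup>+X. G t X \<partial>gaps_law) \<partial>lborel)"
  using assms
proof (induction l arbitrary: G)
  case 0
  have "(\<lambda>X. (X 0, \<lambda>i. X (Suc i))) \<in> measurable gaps_law (borel \<Otimes>\<^sub>M gaps_law)"
    by (intro measurable_Pair component_gaps_law shift_gaps_law(1)) simp
  from measurable_compose[OF this 0]
  have [measurable]: "(\<lambda>X. G (X 0) (\<lambda>i. X (Suc i))) \<in> borel_measurable gaps_law" by simp
  show ?case by (subst nn_integral_gaps_law_case_nat) simp_all
next
  case (Suc l)
  note [measurable] = Suc.prems
  have "(\<lambda>X. (\<Sum>i\<le>Suc l. X i, \<lambda>i. X (Suc (Suc l + i)))) \<in> measurable gaps_law (borel \<Otimes>\<^sub>M gaps_law)"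
    by (intro measurable_Pair borel_measurable_sum component_gaps_law shift_gaps_law(2)) simp
  from measurable_compose[OF this Suc.prems]
  have [measurable]: "(\<lambda>X. G (X 0 + (\<Sum>i\<le>l. X (Suc i))) (\<lambda>i. X (Suc (Suc (l + i))))) \<in> borel_measurable gaps_law"
    by (simp add: sum.atMost_Suc_shift del: sum.atMost_Suc)
  define g where "g t = (\<integral>\<^sup>+X. G t X \<partial>gaps_law)" for t
  have [measurable]: "g \<in> borel_measurable borel"
    unfolding g_def[abs_def] by measurable
  have "(\<integral>\<^sup>+X. G (\<Sum>i\<le>Suc l. X i) (\<lambda>i. X (Suc (Suc l + i))) \<partial>gaps_law) =
      (\<integral>\<^sup>+x. ennreal (erlang_density 0 lam x) *
        (\<integral>\<^sup>+X. G (x + (\<Sum>i\<le>l. X i)) (\<lambda>i. X (Suc (l + i))) \<partial>gaps_law) \<partial>lborel)"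
    by (subst nn_integral_gaps_law_case_nat) (simp_all add: sum.atMost_Suc_shift del: sum.atMost_Suc)
  also have "\<dots> = (\<integral>\<^sup>+x. ennreal (erlang_density 0 lam x) *
        (\<integral>\<^sup>+t. ennreal (erlang_density l lam t) * g (x + t) \<partial>lborel) \<partial>lborel)"
  proof (rule nn_integral_cong)
    fix x :: real
    show "ennreal (erlang_density 0 lam x) * (\<integral>\<^sup>+X. G (x + (\<Sum>i\<le>l. X i)) (\<lambda>i. X (Suc (l + i))) \<partial>gaps_law) =
        ennreal (erlang_density 0 lam x) * (\<integral>\<^sup>+t. ennreal (erlang_density l lam t) * g (x + t) \<partial>lborel)"
      using Suc.IH[of "\<lambda>t. G (x + t)"] by (simp add: g_def)
  qed
  also have "\<dots> = (\<integral>\<^sup>+x. (\<integral>\<^sup>+t. ennreal (erlang_density 0 lam x) * ennreal (erlang_density l lam (t - x)) * g t \<partial>lborel) \<partial>lborel)"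
  proof (rule nn_integral_cong)
    fix x :: real
    have "(\<integral>\<^sup>+t. ennreal (erlang_density l lam t) * g (x + t) \<partial>lborel) =
        (\<integral>\<^sup>+t. ennreal (erlang_density l lam (t - x)) * g t \<partial>lborel)"
      by (subst nn_integral_real_affine[where c = 1 and t = x]) simp_all
    then show "ennreal (erlang_density 0 lam x) * (\<integral>\<^sup>+t. ennreal (erlang_density l lam t) * g (x + t) \<partial>lborel) =
        (\<integral>\<^sup>+t. ennreal (erlang_density 0 lam x) * ennreal (erlang_density l lam (t - x)) * g t \<partial>lborel)"
      by (simp add: nn_integral_cmult[symmetric] mult.assoc)
  qed
  also have "\<dots> = (\<integral>\<^sup>+t. (\<integral>\<^sup>+x. ennreal (erlang_density 0 lam x) * ennreal (erlang_density l lam (t - x)) * g t \<partial>lborel) \<partial>lborel)"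
    by (rule lborel_pair.Fubini') simp
  also have "\<dots> = (\<integral>\<^sup>+t. ennreal (erlang_density (Suc l) lam t) * g t \<partial>lborel)"
  proof (rule nn_integral_cong)
    fix t :: real
    show "(\<integral>\<^sup>+x. ennreal (erlang_density 0 lam x) * ennreal (erlang_density l lam (t - x)) * g t \<partial>lborel) =
        ennreal (erlang_density (Suc l) lam t) * g t"
      using fun_cong[OF convolution_erlang_density[OF lam_pos, of l 0], of t]
      by (subst nn_integral_multc) (simp_all add: mult.commute)
  qed
  finally show ?case unfolding g_def .
qed

text \<open>A condition on at most two consecutive arrival epochs, so that it can be integrated with
  the law of a single epoch and the gap that follows. The case \<open>w = 0\<close> is separate
  because \<open>w - 1\<close> truncates.\<close>

definition exactly :: "nat \<Rightarrow> (nat \<Rightarrow> real) \<Rightarrow> real \<Rightarrow> bool" where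
  "exactly w X s \<longleftrightarrow> (w = 0 \<or> (\<Sum>i\<le>w - 1. X i) \<le> s) \<and> s < (\<Sum>i\<le>w. X i)"

lemma exactly_iff:
  assumes X: "\<And>i. 0 \<le> X i" and w: "exactly w X s"
  shows "(\<Sum>i\<le>l. X i) \<le> s \<longleftrightarrow> l < w"
proof
  assume "(\<Sum>i\<le>l. X i) \<le> s"
  moreover have "(\<Sum>i\<le>w. X i) \<le> (\<Sum>i\<le>l. X i)" if "w \<le> l"
    using that by (intro sum_mono2) (auto simp: X)
  ultimately show "l < w" using w by (force simp: exactly_def)
next
  assume "l < w"
  then have "(\<Sum>i\<le>l. X i) \<le> (\<Sum>i\<le>w - 1. X i)"
    by (intro sum_mono2) (auto simp: X)
  with w \<open>l < w\<close> show "(\<Sum>i\<le>l. X i) \<le> s" by (auto simp: exactly_def)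
qed

lemma arrivals_upto_exactly:
  assumes X: "\<And>i. 0 \<le> X i" and w: "exactly w X s"
  shows "arrivals_upto X s = w"
proof -
  have "{l. (\<Sum>i\<le>l. X i) \<le> s} = {..<w}"
    using exactly_iff[OF X w] by auto
  then show ?thesis by (simp add: arrivals_upto_def)
qed

lemma arrivals_upto_measurable [measurable]:
  assumes [measurable]: "f \<in> measurable M gaps_law" "g \<in> borel_measurable M"
  shows "(\<lambda>x. arrivals_upto (f x) (g x)) \<in> measurable M (count_space UNIV)"
  unfolding arrivals_upto_def by measurable

lemma exactly_measurable [measurable]:
  assumes [measurable]: "f \<in> measurable M gaps_law" "g \<in> borel_measurable M"
  shows "Measurable.pred M (\<lambda>x. exactly w (f x) (g x))"
  unfolding exactly_def by measurable

lemma residual_measurable [measurable (raw)]: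
  assumes [measurable]: "f \<in> measurable M gaps_law" "g \<in> borel_measurable M"
  shows "(\<lambda>x. residual w (f x) (g x)) \<in> measurable M gaps_law"
proof (rule measurable_gaps_law)
  fix i show "(\<lambda>x. residual w (f x) (g x) i) \<in> borel_measurable M"
    unfolding residual_def by (cases i) simp_all
qed

lemma next_arrivals_measurable [measurable (raw)]:
  assumes [measurable]: "f \<in> measurable M gaps_law" "g \<in> borel_measurable M"
  shows "(\<lambda>x. next_arrivals w (f x) (g x)) \<in> measurable M gaps_law"
  unfolding next_arrivals_def using shift_gaps_law(1)[OF assms(1)] by (cases "w = 0") simp_all

lemma AE_gaps_law_nonneg: "AE X in gaps_law. \<forall>i. 0 \<le> X i"
proof -
  have "AE x in interarrival_law. 0 \<le> x"
    unfolding interarrival_law_def by (subst AE_density) (auto simp: exponential_density_def)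
  then have "AE X in gaps_law. 0 \<le> X i" for i
    unfolding gaps_law_def using AE_PiM_component[of UNIV "\<lambda>_. interarrival_law" i "\<lambda>x. 0 \<le> x"]
      prob_interarrival_law by simp
  then show ?thesis by (simp add: AE_all_countable)
qed

text \<open>Memorylessness: the exponential density at \<open>s + x\<close> is
  \<open>exp (- lam * s)\<close> times the density at \<open>x\<close>.\<close>

lemma nn_integral_residual_0:
  assumes [measurable]: "F \<in> borel_measurable gaps_law" and s: "0 \<le> s"
  shows "(\<integral>\<^sup>+X. indicator {X. s < X 0} X * F (residual 0 X s) \<partial>gaps_law) =
    ennreal (exp (- lam * s)) * (\<integral>\<^sup>+X. F X \<partial>gaps_law)"
proof -
  define g where "g x = (\<integral>\<^sup>+X. F (case_nat x X) \<partial>gaps_law)" for x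
  have [measurable]: "(\<lambda>(x, X). F (case_nat x X)) \<in> borel_measurable (borel \<Otimes>\<^sub>M gaps_law)"
    using measurable_compose[OF case_nat_gaps_law assms(1)] by (simp add: case_prod_unfold)
  have [measurable]: "g \<in> borel_measurable borel"
    unfolding g_def[abs_def] by measurable
  have res: "residual 0 (case_nat x X) s = case_nat (x - s) X" for x and X :: "nat \<Rightarrow> real"
    by (auto simp: residual_def split: nat.split)
  have "(\<integral>\<^sup>+X. indicator {X. s < X 0} X * F (residual 0 X s) \<partial>gaps_law) =
      (\<integral>\<^sup>+x. ennreal (erlang_density 0 lam x) * (indicator {s<..} x * g (x - s)) \<partial>lborel)"
    by (subst nn_integral_gaps_law_case_nat)
       (auto simp: res g_def nn_integral_cmult[symmetric] indicator_def intro!: nn_integral_cong)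
  also have "\<dots> = (\<integral>\<^sup>+x. ennreal (erlang_density 0 lam (s + x)) * (indicator {s<..} (s + x) * g x) \<partial>lborel)"
    by (subst nn_integral_real_affine[where c = 1 and t = s]) simp_all
  also have "\<dots> = (\<integral>\<^sup>+x. ennreal (exp (- lam * s)) * (ennreal (erlang_density 0 lam x) * g x) \<partial>lborel)"
  proof (rule nn_integral_cong_AE)
    have "AE x in lborel. x \<noteq> (0::real)" by (rule AE_lborel_singleton)
    then show "AE x in lborel. ennreal (erlang_density 0 lam (s + x)) * (indicator {s<..} (s + x) * g x) =
        ennreal (exp (- lam * s)) * (ennreal (erlang_density 0 lam x) * g x)"
    proof eventually_elim
      case (elim x)
      have "ennreal (exponential_density lam (s + x)) = ennreal (exp (- lam * s)) * ennreal (exponential_density lam x)" if "0 < x"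
        using that s by (simp add: exponential_density_def exp_add[symmetric] ennreal_mult'[symmetric] algebra_simps)
      then show ?case using elim s
        by (cases "0 < x") (auto simp: mult.assoc, auto simp: exponential_density_def)
    qed
  qed
  also have "\<dots> = ennreal (exp (- lam * s)) * (\<integral>\<^sup>+X. F X \<partial>gaps_law)"
    by (subst nn_integral_cmult) (simp_all add: g_def nn_integral_gaps_law_case_nat[OF assms(1)])
  finally show ?thesis .
qed

text \<open>Integrate over the last arrival epoch \<open>t \<le> s\<close> and apply memorylessness
  to the gap in progress. The exponential factors combine to \<open>exp (- lam * s)\<close>, which
  is free of \<open>t\<close>, and the remaining power \<open>t ^ l\<close> integrates to the
  Poisson weight.\<close>

lemma nn_integral_exactly:
  assumes [measurable]: "F \<in> borel_measurable gaps_law" and s: "0 \<le> s"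
  shows "(\<integral>\<^sup>+X. indicator {X. exactly w X s} X * F (residual w X s) \<partial>gaps_law) =
    ennreal (poisson_weight (lam * s) w) * (\<integral>\<^sup>+X. F X \<partial>gaps_law)"
proof (cases w)
  case 0
  then show ?thesis
    using nn_integral_residual_0[OF assms] by (simp add: exactly_def poisson_weight_def)
next
  case (Suc l)
  have res: "residual (Suc l) X s = residual 0 (\<lambda>i. X (Suc (l + i))) (s - (\<Sum>i\<le>l. X i))" for X :: "nat \<Rightarrow> real"
    by (auto simp: residual_def fun_eq_iff split: nat.split)
  have "(\<integral>\<^sup>+X. indicator {X. exactly w X s} X * F (residual w X s) \<partial>gaps_law) =
      (\<integral>\<^sup>+t. ennreal (erlang_density l lam t) *
        (\<integral>\<^sup>+X. indicator {..s} t * (indicator {X. s - t < X 0} X * F (residual 0 X (s - t))) \<partial>gaps_law) \<partial>lborel)"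
    by (subst nn_integral_arrival_time[symmetric])
       (auto simp: Suc res exactly_def indicator_def intro!: nn_integral_cong)
  also have "\<dots> = (\<integral>\<^sup>+t. (ennreal (erlang_density l lam t) * indicator {..s} t * ennreal (exp (- lam * (s - t)))) *
      (\<integral>\<^sup>+X. F X \<partial>gaps_law) \<partial>lborel)"
    by (intro nn_integral_cong)
       (auto simp: indicator_def nn_integral_residual_0[unfolded indicator_def, simplified] mult.assoc)
  also have "\<dots> = (\<integral>\<^sup>+t. ennreal (erlang_density l lam t) * indicator {..s} t * ennreal (exp (- lam * (s - t))) \<partial>lborel) *
      (\<integral>\<^sup>+X. F X \<partial>gaps_law)"
  proof (rule nn_integral_multc)
    note [measurable del] = component_gaps_law
    show "(\<lambda>t. ennreal (erlang_density l lam t) * indicator {..s} t * ennreal (exp (- lam * (s - t)))) \<in> borel_measurable lborel"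
      by measurable
  qed
  also have "(\<integral>\<^sup>+t. ennreal (erlang_density l lam t) * indicator {..s} t * ennreal (exp (- lam * (s - t))) \<partial>lborel) =
      (\<integral>\<^sup>+t. ennreal (lam ^ Suc l * t ^ l / fact l * exp (- (lam * s))) * indicator {0..s} t \<partial>lborel)"
  proof (intro nn_integral_cong)
    fix t :: real
    have "exp (- lam * t) * exp (- lam * (s - t)) = exp (- (lam * s))"
      by (simp add: exp_add[symmetric] algebra_simps)
    then have "lam ^ Suc l * t ^ l * exp (- lam * t) / fact l * exp (- lam * (s - t)) =
        lam ^ Suc l * t ^ l / fact l * exp (- (lam * s))"
      by (metis (no_types, opaque_lifting) mult.assoc mult.commute times_divide_eq_left)
    then show "ennreal (erlang_density l lam t) * indicator {..s} t * ennreal (exp (- lam * (s - t))) =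
        ennreal (lam ^ Suc l * t ^ l / fact l * exp (- (lam * s))) * indicator {0..s} t"
      using lam_pos by (auto simp: erlang_density_def indicator_def ennreal_mult'[symmetric] simp del: power_Suc)
  qed
  also have "\<dots> = ennreal (lam ^ Suc l * s ^ Suc l / fact (Suc l) * exp (- (lam * s)) - lam ^ Suc l * 0 ^ Suc l / fact (Suc l) * exp (- (lam * s)))"
  proof (rule nn_integral_FTC_Icc)
    show "DERIV (\<lambda>t. lam ^ Suc l * t ^ Suc l / fact (Suc l) * exp (- (lam * s))) t :> lam ^ Suc l * t ^ l / fact l * exp (- (lam * s))" for t
    proof -
      have "DERIV (\<lambda>t. lam ^ Suc l * t ^ Suc l / fact (Suc l) * exp (- (lam * s))) t :> lam ^ Suc l * (real (Suc l) * t ^ l) / fact (Suc l) * exp (- (lam * s))"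
        by (auto intro!: derivative_eq_intros simp del: fact_Suc power_Suc of_nat_Suc)
      moreover have "real (Suc l) * t ^ l / fact (Suc l) = t ^ l / fact l"
        by (simp add: fact_Suc del: of_nat_Suc)
      ultimately show ?thesis by (metis times_divide_eq_right)
    qed
  qed (use lam_pos s in auto)
  also have "\<dots> = ennreal (poisson_weight (lam * s) w)"
    by (simp add: poisson_weight_def Suc power_mult_distrib mult_ac del: fact_Suc)
  finally show ?thesis .
qed

text \<open>On nonnegative gaps these events are disjoint, and their probabilities are the Poisson
  weights, which sum to 1.\<close>

lemma AE_exactly:
  assumes s: "0 \<le> s"
  shows "AE X in gaps_law. \<exists>w. exactly w X s"
proof -
  define B where "B w = {X \<in> space gaps_law. exactly w X s \<and> (\<forall>i. 0 \<le> X i)}" for w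
  have [measurable]: "B w \<in> sets gaps_law" for w
    unfolding B_def by measurable
  have "disjoint_family B"
    unfolding disjoint_family_on_def B_def
    using arrivals_upto_exactly by (auto dest!: arrivals_upto_exactly[rotated])
  then have "(\<Sum>w. emeasure gaps_law (B w)) = emeasure gaps_law (\<Union>w. B w)"
    by (intro suminf_emeasure) auto
  moreover have "emeasure gaps_law (B w) = ennreal (poisson_weight (lam * s) w)" for w
  proof -
    have "emeasure gaps_law (B w) = (\<integral>\<^sup>+X. indicator (B w) X \<partial>gaps_law)" by simp
    also have "\<dots> = (\<integral>\<^sup>+X. indicator {X. exactly w X s} X * 1 \<partial>gaps_law)"
      using AE_gaps_law_nonneg by (intro nn_integral_cong_AE) (auto simp: B_def indicator_def)
    also have "\<dots> = ennreal (poisson_weight (lam * s) w)"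
      using nn_integral_exactly[of "\<lambda>_. 1" s w] s gaps_law.emeasure_space_1 by simp
    finally show ?thesis .
  qed
  moreover have "(\<Sum>w. ennreal (poisson_weight (lam * s) w)) = 1"
  proof -
    have "poisson_weight (lam * s) sums 1"
      using poisson_weight_gf_sums[of "lam * s" 1] by simp
    then show ?thesis
      using s lam_pos poisson_weight_nonneg[of "lam * s"] by (subst suminf_ennreal2) (auto simp: sums_iff)
  qed
  ultimately have "emeasure gaps_law (\<Union>w. B w) = 1" by simp
  then have "AE X in gaps_law. X \<in> (\<Union>w. B w)"
    by (subst gaps_law.AE_in_set_eq_1) (auto simp: gaps_law.emeasure_eq_measure)
  then show ?thesis by eventually_elim (auto simp: B_def)
qed

text \<open>Given the number of arrivals, the residual gaps have the original law, so the count and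
  the future are independent. For \<open>w = 0\<close> the residual sequence is shifted once more,
  which preserves its law.\<close>

theorem nn_integral_next_arrivals:
  assumes [measurable]: "\<And>w. \<Psi> w \<in> borel_measurable gaps_law" and s: "0 \<le> s"
  shows "(\<integral>\<^sup>+X. \<Psi> (arrivals_upto X s) (next_arrivals (arrivals_upto X s) X s) \<partial>gaps_law) =
    (\<Sum>w. ennreal (poisson_weight (lam * s) w) * (\<integral>\<^sup>+X. \<Psi> w X \<partial>gaps_law))"
proof -
  have "AE X in gaps_law. \<Psi> (arrivals_upto X s) (next_arrivals (arrivals_upto X s) X s) =
      (\<Sum>w. indicator {X. exactly w X s} X * \<Psi> w (next_arrivals w X s))"
    using AE_gaps_law_nonneg AE_exactly[OF s]
  proof eventually_elim
    case (elim X)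
    then obtain w where w: "exactly w X s" by blast
    have "exactly w' X s \<longleftrightarrow> w' = w" for w'
      using arrivals_upto_exactly[of X w s] arrivals_upto_exactly[of X w' s] w elim by auto
    then have "(\<Sum>w'. indicator {X. exactly w' X s} X * \<Psi> w' (next_arrivals w' X s)) =
        (\<Sum>w'\<in>{w}. indicator {X. exactly w' X s} X * \<Psi> w' (next_arrivals w' X s))"
      by (intro suminf_finite) auto
    then show ?case using arrivals_upto_exactly[of X w s] w elim by simp
  qed
  then have "(\<integral>\<^sup>+X. \<Psi> (arrivals_upto X s) (next_arrivals (arrivals_upto X s) X s) \<partial>gaps_law) =
      (\<integral>\<^sup>+X. (\<Sum>w. indicator {X. exactly w X s} X * \<Psi> w (next_arrivals w X s)) \<partial>gaps_law)"
    by (rule nn_integral_cong_AE)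
  also have "\<dots> = (\<Sum>w. \<integral>\<^sup>+X. indicator {X. exactly w X s} X * \<Psi> w (next_arrivals w X s) \<partial>gaps_law)"
    by (rule nn_integral_suminf) simp
  also have "\<dots> = (\<Sum>w. ennreal (poisson_weight (lam * s) w) * (\<integral>\<^sup>+X. \<Psi> w X \<partial>gaps_law))"
  proof (intro suminf_cong)
    fix w
    show "(\<integral>\<^sup>+X. indicator {X. exactly w X s} X * \<Psi> w (next_arrivals w X s) \<partial>gaps_law) =
        ennreal (poisson_weight (lam * s) w) * (\<integral>\<^sup>+X. \<Psi> w X \<partial>gaps_law)"
    proof (cases "w = 0")
      case True
      have [measurable]: "(\<lambda>X. \<Psi> 0 (\<lambda>i. X (Suc i))) \<in> borel_measurable gaps_law"
        by (rule measurable_compose[OF shift_gaps_law(1)]) simp_all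
      have "next_arrivals 0 X s = (\<lambda>i. residual 0 X s (Suc i))" for X :: "nat \<Rightarrow> real"
        by (simp add: next_arrivals_def residual_def)
      then show ?thesis
        using nn_integral_exactly[of "\<lambda>X. \<Psi> 0 (\<lambda>i. X (Suc i))" s 0] s True
        by (simp add: nn_integral_gaps_law_shift[of "\<Psi> 0"])
    next
      case False
      then show ?thesis using nn_integral_exactly[of "\<Psi> w" s w] s by (simp add: next_arrivals_def)
    qed
  qed
  finally show ?thesis .
qed

lemma nn_integral_arrivals_gf:
  assumes s: "0 \<le> s" and h: "0 \<le> h"
  shows "(\<integral>\<^sup>+X. ennreal (h ^ arrivals_upto X s) \<partial>gaps_law) = ennreal (exp (- (lam * s * (1 - h))))"
proof -
  have "(\<integral>\<^sup>+X. ennreal (h ^ arrivals_upto X s) \<partial>gaps_law) = (\<Sum>w. ennreal (poisson_weight (lam * s) w) * ennreal (h ^ w))"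
    using nn_integral_next_arrivals[of "\<lambda>w _. ennreal (h ^ w)" s] s gaps_law.emeasure_space_1 by simp
  also have "\<dots> = (\<Sum>w. ennreal (poisson_weight (lam * s) w * h ^ w))"
    using s h lam_pos by (simp add: ennreal_mult poisson_weight_nonneg)
  also have "\<dots> = ennreal (exp (- (lam * s * (1 - h))))"
    using s h lam_pos poisson_weight_gf_sums[of "lam * s" h]
    by (subst suminf_ennreal2) (auto simp: sums_iff poisson_weight_nonneg)
  finally show ?thesis .
qed

text \<open>Given that an arrival occurs at time \<open>t\<close>, the arrivals in \<open>{t..s}\<close> are again Poisson, and
  the arrival density is \<open>lam\<close> at each \<open>t\<close>.\<close>

theorem nn_integral_arrivals_sum:
  assumes [measurable]: "\<phi> \<in> borel_measurable borel" and s: "0 \<le> s" and h: "0 \<le> h"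
  shows "(\<integral>\<^sup>+X. (\<Sum>l. indicator {..s} (\<Sum>i\<le>l. X i) * \<phi> (s - (\<Sum>i\<le>l. X i)) * ennreal (h ^ arrivals_upto X s)) \<partial>gaps_law) =
    ennreal (lam * h * exp (- (lam * s * (1 - h)))) * (\<integral>\<^sup>+t. indicator {0..s} t * \<phi> (s - t) \<partial>lborel)"
proof -
  \<comment> \<open>Weight of an arrival at \<open>t\<close> with \<open>l\<close> arrivals before
    it, each arrival up to \<open>s\<close> carrying a factor \<open>h\<close>. Summed over
    \<open>l\<close>, the dependence on \<open>t\<close> cancels.\<close>
  define D where "D l t = lam * h * exp (- (lam * s * (1 - h))) * (poisson_weight (lam * t) l * h ^ l * exp (lam * t * (1 - h)))" for l t
  have summand: "(\<integral>\<^sup>+X. indicator {..s} (\<Sum>i\<le>l. X i) * \<phi> (s - (\<Sum>i\<le>l. X i)) * ennreal (h ^ arrivals_upto X s) \<partial>gaps_law) =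
      (\<integral>\<^sup>+t. ennreal (D l t) *
        (indicator {0..s} t * \<phi> (s - t)) \<partial>lborel)" for l
  proof -
    define G where "G t X = indicator {..s} t * \<phi> (s - t) * (ennreal (h ^ Suc l) * ennreal (h ^ arrivals_upto X (s - t)))" for t and X :: "nat \<Rightarrow> real"
    have [measurable]: "(\<lambda>(t, X). G t X) \<in> borel_measurable (borel \<Otimes>\<^sub>M gaps_law)"
      unfolding G_def by measurable
    have "AE X in gaps_law. indicator {..s} (\<Sum>i\<le>l. X i) * \<phi> (s - (\<Sum>i\<le>l. X i)) * ennreal (h ^ arrivals_upto X s) =
       G (\<Sum>i\<le>l. X i) (\<lambda>i. X (Suc (l + i)))"
      using AE_gaps_law_nonneg AE_exactly[OF s]
    proof eventually_elim
      case (elim X)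
      then obtain w where w: "exactly w X s" by blast
      show ?case
      proof (cases "(\<Sum>i\<le>l. X i) \<le> s")
        case True
        then have lw: "l < w" using exactly_iff[OF _ w] elim by auto
        have S: "(\<Sum>i\<le>l. X i) + (\<Sum>i\<le>n. X (Suc (l + i))) = (\<Sum>i\<le>Suc l + n. X i)" for n
          by (induction n) auto
        obtain n where n: "w = Suc l + n" using lw less_iff_Suc_add by auto
        have "exactly (w - Suc l) (\<lambda>i. X (Suc (l + i))) (s - (\<Sum>i\<le>l. X i))"
          using w S[of n] S[of "n - 1"] unfolding n
          by (cases n) (auto simp: exactly_def)
        then have "arrivals_upto X s = Suc l + arrivals_upto (\<lambda>i. X (Suc (l + i))) (s - (\<Sum>i\<le>l. X i))"
          using arrivals_upto_exactly[OF _ w] arrivals_upto_exactly[of "\<lambda>i. X (Suc (l + i))"] elim lw by auto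
        then show ?thesis using h by (simp only: G_def power_add ennreal_mult' zero_le_power)
      qed (simp add: G_def)
    qed
    then have "(\<integral>\<^sup>+X. indicator {..s} (\<Sum>i\<le>l. X i) * \<phi> (s - (\<Sum>i\<le>l. X i)) * ennreal (h ^ arrivals_upto X s) \<partial>gaps_law) =
        (\<integral>\<^sup>+X. G (\<Sum>i\<le>l. X i) (\<lambda>i. X (Suc (l + i))) \<partial>gaps_law)"
      by (rule nn_integral_cong_AE)
    also have "\<dots> = (\<integral>\<^sup>+t. ennreal (erlang_density l lam t) * (\<integral>\<^sup>+X. G t X \<partial>gaps_law) \<partial>lborel)"
      by (rule nn_integral_arrival_time) measurable
    also have "\<dots> = (\<integral>\<^sup>+t. ennreal (D l t) *
        (indicator {0..s} t * \<phi> (s - t)) \<partial>lborel)"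
    proof (rule nn_integral_cong)
      fix t :: real
      show "ennreal (erlang_density l lam t) * (\<integral>\<^sup>+X. G t X \<partial>gaps_law) =
        ennreal (D l t) *
        (indicator {0..s} t * \<phi> (s - t))"
      proof (cases "0 \<le> t \<and> t \<le> s")
        case True
        have "(\<integral>\<^sup>+X. G t X \<partial>gaps_law) = \<phi> (s - t) * ennreal (h ^ Suc l * exp (- (lam * (s - t) * (1 - h))))"
          using True h nn_integral_arrivals_gf[of "s - t" h]
          by (simp add: G_def nn_integral_cmult ennreal_mult del: power_Suc)
        moreover have "erlang_density l lam t * (h ^ Suc l * exp (- (lam * (s - t) * (1 - h)))) =
            D l t"
        proof -
          have "exp (- (lam * (s - t) * (1 - h))) = exp (- (lam * s * (1 - h))) * exp (lam * t * (1 - h))"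
            by (simp add: exp_add[symmetric] algebra_simps)
          then show ?thesis
            using True by (simp add: D_def erlang_density_def poisson_weight_def power_mult_distrib)
        qed
        ultimately show ?thesis
          using True h lam_pos by (simp add: mult.commute mult.left_commute ennreal_mult[symmetric] del: power_Suc)
      qed (auto simp: G_def erlang_density_def)
    qed
    finally show ?thesis .
  qed
  have "(\<integral>\<^sup>+X. (\<Sum>l. indicator {..s} (\<Sum>i\<le>l. X i) * \<phi> (s - (\<Sum>i\<le>l. X i)) * ennreal (h ^ arrivals_upto X s)) \<partial>gaps_law) =
     (\<Sum>l. \<integral>\<^sup>+t. ennreal (D l t) *
        (indicator {0..s} t * \<phi> (s - t)) \<partial>lborel)"
    by (subst nn_integral_suminf) (simp_all add: summand)
  also have "\<dots> = (\<integral>\<^sup>+t. (\<Sum>l. ennreal (D l t) *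
        (indicator {0..s} t * \<phi> (s - t))) \<partial>lborel)"
    by (rule nn_integral_suminf[symmetric]) (simp add: D_def poisson_weight_def)
  also have "\<dots> = (\<integral>\<^sup>+t. ennreal (lam * h * exp (- (lam * s * (1 - h)))) * (indicator {0..s} t * \<phi> (s - t)) \<partial>lborel)"
  proof (rule nn_integral_cong)
    fix t :: real
    show "(\<Sum>l. ennreal (D l t) *
        (indicator {0..s} t * \<phi> (s - t))) =
        ennreal (lam * h * exp (- (lam * s * (1 - h)))) * (indicator {0..s} t * \<phi> (s - t))"
    proof (cases "0 \<le> t \<and> t \<le> s")
      case True
      have "(\<lambda>l. D l t) sums
        (lam * h * exp (- (lam * s * (1 - h))) * (exp (- (lam * t * (1 - h))) * exp (lam * t * (1 - h))))"
        unfolding D_def by (intro sums_mult sums_mult2 poisson_weight_gf_sums)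
      also have "exp (- (lam * t * (1 - h))) * exp (lam * t * (1 - h)) = 1"
        by (simp add: exp_add[symmetric])
      finally show ?thesis
        using True h lam_pos
        by (subst ennreal_suminf_multc, subst suminf_ennreal2)
           (auto simp: sums_iff D_def poisson_weight_nonneg)
    qed auto
  qed
  also have "\<dots> = ennreal (lam * h * exp (- (lam * s * (1 - h)))) * (\<integral>\<^sup>+t. indicator {0..s} t * \<phi> (s - t) \<partial>lborel)"
  proof (rule nn_integral_cmult)
    note [measurable del] = component_gaps_law
    show "(\<lambda>t. indicator {0..s} t * \<phi> (s - t)) \<in> borel_measurable lborel"
      by measurable
  qed
  finally show ?thesis .
qed

declare component_gaps_law [measurable del]

end

section \<open>Transforms and the stationary queue length\<close>

lemma poisson_weight_sums: "poisson_weight r sums 1"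
  using poisson_weight_gf_sums[of r 1] by simp

lemma poisson_weight_le_1: "0 \<le> r \<Longrightarrow> poisson_weight r w \<le> 1"
  using sum_le_suminf[of "poisson_weight r" "{w}"] poisson_weight_sums[of r] poisson_weight_nonneg[of r]
  by (auto simp: sums_iff)

lemma poisson_weight_mean_sums: "(\<lambda>w. poisson_weight r w * real w) sums r"
proof -
  have "(\<lambda>w. poisson_weight r (Suc w) * real (Suc w)) = (\<lambda>w. r * poisson_weight r w)"
    by (auto simp: poisson_weight_def field_simps simp del: of_nat_Suc)
  then have "(\<lambda>w. poisson_weight r (Suc w) * real (Suc w)) sums (r * 1)"
    using sums_mult[OF poisson_weight_sums, of r r] by simp
  then show ?thesis by (subst (asm) sums_Suc_iff) simp
qed

lemma poisson_weight_measurable [measurable]: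
  "f \<in> borel_measurable M \<Longrightarrow> (\<lambda>x. poisson_weight (f x) w) \<in> borel_measurable M"
  unfolding poisson_weight_def by simp

text \<open>The derivative of \<open>r \<mapsto> E f(N_r)\<close>, \<open>N_r\<close> Poisson with mean \<open>r\<close>, is \<open>E f(N_r + 1) - E f(N_r)\<close>.\<close>

lemma poisson_average_lipschitz:
  fixes f :: "nat \<Rightarrow> real"
  assumes f: "\<And>k. \<bar>f k\<bar> \<le> B" "\<And>k. \<bar>f (Suc k) - f k\<bar> \<le> L" and r: "0 \<le> r" "0 \<le> t"
  shows "\<bar>(\<Sum>w. poisson_weight (r + t) w * f w) - (\<Sum>w. poisson_weight r w * f w)\<bar> \<le> L * t"
proof -
  define c where "c w = f w / fact w" for w
  have e: "(\<lambda>w. x ^ w / fact w) sums exp x" for x :: real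
    using exp_converges[of x] by (simp add: field_simps)
  have sm: "summable (\<lambda>w. g w / fact w * x ^ w)" if "\<And>k. \<bar>g k\<bar> \<le> B" for g and x :: real
  proof (rule summable_comparison_test'[of "\<lambda>w. B * (\<bar>x\<bar> ^ w / fact w)" 0])
    show "summable (\<lambda>w. B * (\<bar>x\<bar> ^ w / fact w))"
      using e[of "\<bar>x\<bar>"] by (intro summable_mult) (simp add: sums_iff)
    show "norm (g w / fact w * x ^ w) \<le> B * (\<bar>x\<bar> ^ w / fact w)" for w
      using mult_right_mono[OF that[of w], of "\<bar>x\<bar> ^ w / fact w"] by (simp add: abs_mult power_abs)
  qed
  \<comment> \<open>The average is \<open>exp (- x)\<close> times an everywhere convergent power
    series, so termwise differentiation gives its derivative.\<close>
  define G where "G x = (\<Sum>w. c w * x ^ w)" for x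
  define G' where "G' x = (\<Sum>w. f (Suc w) / fact w * x ^ w)" for x
  have avg: "(\<Sum>w. poisson_weight x w * f w) = exp (- x) * G x" for x
    using suminf_mult[OF sm[of f, OF f(1)], of "exp (- x)" x]
    by (simp add: G_def c_def poisson_weight_def field_simps)
  have dc: "diffs c = (\<lambda>w. f (Suc w) / fact w)"
    by (auto simp: diffs_def c_def simp del: of_nat_Suc)
  have "(G has_real_derivative G' x) (at x)" for x
    using termdiffs_strong_converges_everywhere[of c x] sm[OF f(1)]
    unfolding G_def[abs_def] G'_def dc by (simp add: c_def)
  then have D: "((\<lambda>x. exp (- x) * G x) has_real_derivative exp (- x) * (G' x - G x)) (at x)" for x
    by (auto intro!: derivative_eq_intros simp: algebra_simps)
  have bound: "\<bar>exp (- x) * (G' x - G x)\<bar> \<le> L" if "0 \<le> x" for x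
  proof -
    have "G' x - G x = (\<Sum>w. f (Suc w) / fact w * x ^ w - c w * x ^ w)"
      unfolding G_def G'_def c_def by (rule suminf_diff) (intro sm f)+
    also have "\<dots> = (\<Sum>w. (f (Suc w) - f w) * (x ^ w / fact w))"
      by (simp add: c_def algebra_simps diff_divide_distrib)
    finally have eq: "G' x - G x = (\<Sum>w. (f (Suc w) - f w) * (x ^ w / fact w))" .
    have "norm (\<Sum>w. (f (Suc w) - f w) * (x ^ w / fact w)) \<le> (\<Sum>w. L * (x ^ w / fact w))"
    proof (rule norm_suminf_le)
      show "norm ((f (Suc w) - f w) * (x ^ w / fact w)) \<le> L * (x ^ w / fact w)" for w
        using mult_right_mono[OF f(2)[of w], of "x ^ w / fact w"] that by (simp add: abs_mult)
      show "summable (\<lambda>w. L * (x ^ w / fact w))"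
        using e[of x] by (intro summable_mult) (simp add: sums_iff)
    qed
    also have "\<dots> = L * exp x"
      using e[of x] sums_mult[OF e[of x], of L] by (simp add: sums_iff)
    finally have "\<bar>G' x - G x\<bar> \<le> L * exp x" unfolding eq by simp
    then have "exp (- x) * \<bar>G' x - G x\<bar> \<le> exp (- x) * (L * exp x)"
      by (intro mult_left_mono) auto
    also have "\<dots> = L" by (simp add: exp_minus field_simps)
    finally show ?thesis by (simp add: abs_mult)
  qed
  have "norm (exp (- (r + t)) * G (r + t) - exp (- r) * G r) \<le> L * norm (r + t - r)"
    by (rule field_differentiable_bound[of "{0..}"])
       (use D bound r in \<open>auto intro: has_field_derivative_at_within\<close>)
  then show ?thesis using r by (simp add: avg)
qed

section \<open>Bounds for transforms, and expectations over discrete laws\<close>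

lemma norm_one_minus_exp_le:
  assumes "0 \<le> Re s"
  shows "norm (1 - exp (- s)) \<le> norm s"
proof -
  \<comment> \<open>Mean value bound: the derivative of \<open>exp\<close> has norm at most 1 on the
    closed left half-plane, which is convex.\<close>
  have "norm (exp 0 - exp (- s)) \<le> 1 * norm (0 - (- s))"
  proof (rule field_differentiable_bound[of "{w. Re w \<le> 0}"])
    show "convex {w. Re w \<le> 0}" by (rule convex_halfspace_Re_le)
  qed (use assms in \<open>auto intro!: derivative_eq_intros\<close>)
  then show ?thesis by simp
qed

lemma lst_integrable:
  assumes "prob_space F" "sets F = sets borel" "AE y in F. 0 \<le> y" "0 \<le> Re s"
  shows "integrable F (\<lambda>y. exp (- s * of_real y))"
proof -
  interpret prob_space F by fact
  note [measurable_cong] = assms(2)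
  show ?thesis
  proof (rule integrable_const_bound[where B = 1])
    show "AE y in F. norm (exp (- s * complex_of_real y)) \<le> 1"
      using assms(3) by eventually_elim (use assms(4) in simp)
  qed measurable
qed

lemma norm_lst_le_1:
  assumes "prob_space F" "sets F = sets borel" "AE y in F. 0 \<le> y" "0 \<le> Re s"
  shows "norm (lst F s) \<le> 1"
proof -
  interpret prob_space F by fact
  have "norm (lst F s) \<le> (\<integral>y. norm (exp (- s * complex_of_real y)) \<partial>F)"
    unfolding lst_def by (rule integral_norm_bound)
  also have "\<dots> \<le> (\<integral>y. 1 \<partial>F)"
  proof (rule integral_mono_AE)
    show "AE y in F. norm (exp (- s * complex_of_real y)) \<le> 1"
      using assms(3) by eventually_elim (use assms(4) in simp)
  qed (rule integrable_norm[OF lst_integrable[OF assms]], simp)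
  finally show ?thesis by (simp add: prob_space)
qed

lemma norm_one_minus_lst_le:
  assumes "prob_space F" "sets F = sets borel" "AE y in F. 0 \<le> y" "0 \<le> Re s" "integrable F (\<lambda>y. y)"
  shows "norm (1 - lst F s) \<le> norm s * mean F"
proof -
  interpret prob_space F by fact
  have "1 - lst F s = (\<integral>y. 1 - exp (- s * complex_of_real y) \<partial>F)"
    unfolding lst_def using lst_integrable[OF assms(1-4)] by (simp add: prob_space)
  also have "norm \<dots> \<le> (\<integral>y. norm (1 - exp (- s * complex_of_real y)) \<partial>F)"
    by (rule integral_norm_bound)
  also have "\<dots> \<le> (\<integral>y. norm s * y \<partial>F)"
  proof (rule integral_mono_AE)
    show "AE y in F. norm (1 - exp (- s * complex_of_real y)) \<le> norm s * y"
      using assms(3)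
    proof eventually_elim
      case (elim y)
      then show ?case using norm_one_minus_exp_le[of "s * complex_of_real y"] assms(4) by (simp add: norm_mult)
    qed
  qed (use lst_integrable[OF assms(1-4)] assms(5) in auto)
  finally show ?thesis by (simp add: mean_def)
qed

lemma lst_of_real: "lst F (of_real x) = of_real (\<integral>y. exp (- x * y) \<partial>F)"
proof -
  have "exp (- complex_of_real x * complex_of_real y) = complex_of_real (exp (- x * y))" for y
    by (simp add: exp_of_real[symmetric])
  then show ?thesis unfolding lst_def by (simp only: integral_complex_of_real)
qed

lemma norm_arrivals_gf_arg:
  assumes "0 \<le> lam" "norm z \<le> 1"
  shows "0 \<le> Re (of_real lam - of_real lam * z)" "norm (of_real lam - of_real lam * z) = lam * norm (1 - z)"
proof -
  have "Re z \<le> 1" using complex_Re_le_cmod[of z] assms by linarith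
  then show "0 \<le> Re (of_real lam - of_real lam * z)" using assms mult_left_mono[of "Re z" 1 lam] by simp
  have "of_real lam - of_real lam * z = of_real lam * (1 - z)" by (simp add: algebra_simps)
  then show "norm (of_real lam - of_real lam * z) = lam * norm (1 - z)" using assms by (simp add: norm_mult)
qed

lemma integral_bind_pmf_bounded:
  fixes f :: "'b \<Rightarrow> real"
  assumes "\<And>x. \<bar>f x\<bar> \<le> B"
  shows "measure_pmf.expectation (bind_pmf p K) f = measure_pmf.expectation p (\<lambda>x. measure_pmf.expectation (K x) f)"
  unfolding measure_pmf_bind
  by (rule integral_bind[where K = "count_space UNIV" and B = B and B' = 1])
     (use assms measurable_measure_pmf[of K] in \<open>auto simp: measure_pmf.emeasure_space_1 intro: measure_pmf.finite_measure_axioms\<close>)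

text \<open>The exchange rule above is for real functions, so real and imaginary parts are treated
  separately.\<close>

lemma pgf_bind:
  assumes "norm z \<le> 1"
  shows "pgf (bind_pmf p K) z = measure_pmf.expectation p (\<lambda>x. pgf (K x) z)"
proof -
  have b: "norm (z ^ k) \<le> 1" for k using assms by (simp add: norm_power power_le_one)
  have int: "integrable (measure_pmf q) (\<lambda>k. z ^ k)" for q :: "nat pmf"
    by (rule integrable_pmf_bounded[OF b])
  have pb: "norm (pgf q z) \<le> 1" for q
  proof -
    have "norm (pgf q z) \<le> measure_pmf.expectation q (\<lambda>k. norm (z ^ k))"
      unfolding pgf_def by (rule integral_norm_bound)
    also have "\<dots> \<le> measure_pmf.expectation q (\<lambda>k. 1)"
      by (rule integral_mono) (simp_all only: integrable_norm[OF int] b measure_pmf.integrable_const)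
    finally show ?thesis by simp
  qed
  have intp: "integrable (measure_pmf p) (\<lambda>x. pgf (K x) z)"
    by (rule integrable_pmf_bounded[OF pb])
  have bR: "\<bar>Re (z ^ k)\<bar> \<le> 1" "\<bar>Im (z ^ k)\<bar> \<le> 1" for k
    using abs_Re_le_cmod[of "z ^ k"] abs_Im_le_cmod[of "z ^ k"] b[of k] by linarith+
  show ?thesis
  proof (rule complex_eqI)
    show "Re (pgf (bind_pmf p K) z) = Re (measure_pmf.expectation p (\<lambda>x. pgf (K x) z))"
      using integral_bind_pmf_bounded[of "\<lambda>k. Re (z ^ k)" 1 p K, OF bR(1)]
      by (simp only: pgf_def integral_Re[OF int] integral_Re[OF intp[unfolded pgf_def]])
    show "Im (pgf (bind_pmf p K) z) = Im (measure_pmf.expectation p (\<lambda>x. pgf (K x) z))"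
      using integral_bind_pmf_bounded[of "\<lambda>k. Im (z ^ k)" 1 p K, OF bR(2)]
      by (simp only: pgf_def integral_Im[OF int] integral_Im[OF intp[unfolded pgf_def]])
  qed
qed

text \<open>Scheffe: if probability mass functions converge pointwise to a probability mass
  function, they converge in the l1 norm, hence against every bounded function.\<close>

lemma pmf_limit_expectation:
  fixes p :: "nat \<Rightarrow> nat pmf" and f :: "nat \<Rightarrow> real"
  assumes lim: "\<And>k. (\<lambda>n. pmf (p n) k) \<longlonglongrightarrow> pmf q k" and f: "\<And>k. \<bar>f k\<bar> \<le> B"
  shows "(\<lambda>n. measure_pmf.expectation (p n) f) \<longlonglongrightarrow> measure_pmf.expectation q f"
proof -
  have B: "0 \<le> B" using f[of 0] by linarith
  have ip: "integrable (count_space UNIV) (pmf r)" for r :: "nat pmf"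
    using pmf_nat_sums[of r] by (simp add: integrable_count_space_nat_iff sums_iff)
  have "(\<lambda>n. \<integral>\<^sup>+k. norm (pmf (p n) k - pmf q k) \<partial>count_space UNIV) \<longlonglongrightarrow> 0"
    by (rule Scheffe_lemma2) (use ip lim in \<open>auto simp: nn_integral_pmf measure_pmf.emeasure_space_1\<close>)
  moreover have "(\<integral>\<^sup>+k. norm (pmf (p n) k - pmf q k) \<partial>count_space UNIV) =
      ennreal (\<integral>k. norm (pmf (p n) k - pmf q k) \<partial>count_space UNIV)" for n
    by (rule nn_integral_eq_integral) (use ip in auto)
  ultimately have T: "(\<lambda>n. \<integral>k. \<bar>pmf (p n) k - pmf q k\<bar> \<partial>count_space UNIV) \<longlonglongrightarrow> 0"
    by (simp add: ennreal_tendsto_0_iff)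
  have if': "integrable (count_space UNIV) (\<lambda>k. pmf r k * f k)" for r
    by (rule Bochner_Integration.integrable_bound[of _ "\<lambda>k. B * pmf r k"])
       (use ip f B in \<open>auto simp: abs_mult mult.commute[of B] intro!: mult_left_mono\<close>)
  have e: "measure_pmf.expectation r f = (\<integral>k. pmf r k * f k \<partial>count_space UNIV)" for r
    by (simp add: measure_pmf_eq_density integral_density)
  have "\<bar>measure_pmf.expectation (p n) f - measure_pmf.expectation q f\<bar> \<le> B * (\<integral>k. \<bar>pmf (p n) k - pmf q k\<bar> \<partial>count_space UNIV)" for n
  proof -
    have "measure_pmf.expectation (p n) f - measure_pmf.expectation q f = (\<integral>k. (pmf (p n) k - pmf q k) * f k \<partial>count_space UNIV)"
      unfolding e using if' by (simp add: left_diff_distrib)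
    also have "\<bar>\<dots>\<bar> \<le> (\<integral>k. B * \<bar>pmf (p n) k - pmf q k\<bar> \<partial>count_space UNIV)"
    proof (rule order_trans[OF integral_abs_bound], rule integral_mono)
      show "integrable (count_space UNIV) (\<lambda>k. \<bar>(pmf (p n) k - pmf q k) * f k\<bar>)"
        using if' by (simp add: left_diff_distrib)
    qed (use ip f in \<open>auto simp: abs_mult mult.commute[of B] intro!: mult_left_mono\<close>)
    finally show ?thesis by simp
  qed
  then have "(\<lambda>n. measure_pmf.expectation (p n) f - measure_pmf.expectation q f) \<longlonglongrightarrow> 0"
    by (intro Lim_null_comparison[OF always_eventually tendsto_mult_right_zero[OF T, of B]]) simp
  then show ?thesis by (simp add: LIM_zero_iff)
qed

lemma indep_vars_PiM_coordinates:
  fixes N :: "'i \<Rightarrow> 'b measure"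
  assumes N: "\<And>i. prob_space (N i)"
  shows "prob_space.indep_vars (Pi\<^sub>M UNIV N) N (\<lambda>i x. x i) UNIV"
proof -
  interpret prob_space "Pi\<^sub>M UNIV N" by (rule prob_space_PiM) (rule N)
  have "distr (Pi\<^sub>M UNIV N) (Pi\<^sub>M UNIV N) (\<lambda>x. \<lambda>i\<in>UNIV. x i) = Pi\<^sub>M UNIV N"
    by (simp add: restrict_UNIV distr_id[unfolded id_def])
  also have "\<dots> = (\<Pi>\<^sub>M i\<in>UNIV. distr (Pi\<^sub>M UNIV N) (N i) (\<lambda>x. x i))"
    by (rule PiM_cong) (use distr_PiM_component[of UNIV N, OF N] in auto)
  finally show ?thesis by (subst indep_vars_iff_distr_eq_PiM) auto
qed

section \<open>Service times and the number of arrivals during a service\<close>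

locale service_laws = poisson_arrivals lam + FH: real_distribution FH + FV: real_distribution FV
  for lam :: real and FH FV :: "real measure" +
  assumes H_nonneg: "AE h in FH. 0 \<le> h" and V_nonneg: "AE v in FV. 0 \<le> v"
    and H_int: "integrable FH (\<lambda>h. h)" and V_int: "integrable FV (\<lambda>v. v)"
    and mean_pos: "0 < mean FH + mean FV" and rho_less_1: "lam * mean FH < 1"
begin

text \<open>Component \<open>0\<close> of a block is the common component of a service time, component \<open>Suc i\<close> is
  the contribution of the customer with index \<open>i\<close> in the batch.\<close>

definition component_law :: "nat \<Rightarrow> real measure" where
  "component_law = case_nat FV (\<lambda>_. FH)"

definition block_law :: "(nat \<Rightarrow> real) measure" where
  "block_law = Pi\<^sub>M UNIV component_law"

text \<open>The summand with index 0 is the common component, so these \<open>m + 1\<close> terms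
  make up the service time of a batch of \<open>m\<close> customers.\<close>

definition service :: "nat \<Rightarrow> (nat \<Rightarrow> real) \<Rightarrow> real" where
  "service m r = (\<Sum>i\<le>m. r i)"

lemma mean_nonneg: "0 \<le> mean FH" "0 \<le> mean FV"
  unfolding mean_def using H_nonneg V_nonneg by (auto intro: integral_nonneg_AE)

lemma component_law_cases:
  "P FV \<Longrightarrow> P FH \<Longrightarrow> P (component_law i)"
  by (cases i) (auto simp: component_law_def)

lemma sets_component_law [simp, measurable_cong]: "sets (component_law i) = sets borel"
  by (rule component_law_cases) simp_all

lemma prob_component_law: "prob_space (component_law i)"
  by (rule component_law_cases) unfold_locales

lemma sets_block_law [measurable_cong]: "sets block_law = sets (\<Pi>\<^sub>M i\<in>UNIV. borel)"
  unfolding block_law_def by (rule sets_PiM_cong) auto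

lemma space_block_law [simp]: "space block_law = UNIV"
  using sets_eq_imp_space_eq[OF sets_block_law] by (simp add: space_PiM)

sublocale B: prob_space block_law
  unfolding block_law_def by (rule prob_space_PiM) (rule prob_component_law)

lemma emeasure_block_law [simp]: "emeasure block_law UNIV = 1"
  using B.emeasure_space_1 by simp

lemma service_measurable [measurable]: "service m \<in> borel_measurable block_law"
  unfolding service_def[abs_def] by measurable

lemma distr_component: "distr block_law borel (\<lambda>r. r i) = component_law i"
proof -
  have "distr block_law borel (\<lambda>r. r i) = distr block_law (component_law i) (\<lambda>r. r i)"
    by (rule distr_cong) simp_all
  then show ?thesis
    unfolding block_law_def using distr_PiM_component[of UNIV component_law i] prob_component_law by simp
qed

lemma AE_block_nonneg: "AE r in block_law. \<forall>i. 0 \<le> r i"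
proof -
  have "AE r in block_law. 0 \<le> r i" for i
    unfolding block_law_def
    by (rule AE_PiM_component) (use prob_component_law component_law_cases[of "\<lambda>F. AE y in F. 0 \<le> y"] H_nonneg V_nonneg in auto)
  then show ?thesis by (simp add: AE_all_countable)
qed

lemma AE_service_nonneg: "AE r in block_law. 0 \<le> service m r"
  using AE_block_nonneg by eventually_elim (auto simp: service_def intro: sum_nonneg)

lemma component_integral:
  "integrable block_law (\<lambda>r. r i)" "(\<integral>r. r i \<partial>block_law) = mean (component_law i)"
proof -
  have "integrable (component_law i) (\<lambda>x. x)"
    by (rule component_law_cases[of "\<lambda>F. integrable F (\<lambda>x. x)"]) (rule V_int H_int)+
  then have "integrable (distr block_law borel (\<lambda>r. r i)) (\<lambda>x. x)"
    by (simp add: distr_component)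
  then show "integrable block_law (\<lambda>r. r i)" by (subst (asm) integrable_distr_eq) simp_all
  show "(\<integral>r. r i \<partial>block_law) = mean (component_law i)"
    unfolding mean_def distr_component[symmetric] by (subst integral_distr) simp_all
qed

lemma service_integral:
  "integrable block_law (service m)" "(\<integral>r. service m r \<partial>block_law) = real m * mean FH + mean FV"
proof -
  show "integrable block_law (service m)"
    unfolding service_def[abs_def] by (intro Bochner_Integration.integrable_sum component_integral)
  have "(\<integral>r. service m r \<partial>block_law) = (\<Sum>i\<le>m. mean (component_law i))"
    unfolding service_def by (simp add: Bochner_Integration.integral_sum component_integral)
  also have "\<dots> = mean FV + (\<Sum>i<m. mean FH)"
    by (subst sum.atMost_shift) (simp add: component_law_def)
  finally show "(\<integral>r. service m r \<partial>block_law) = real m * mean FH + mean FV" by simp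
qed

lemma lst_service:
  assumes s: "0 \<le> Re s"
  shows "(\<integral>r. exp (- s * of_real (service m r)) \<partial>block_law) = lst FH s ^ m * lst FV s"
proof -
  have c: "integrable (component_law i) (\<lambda>y. exp (- s * complex_of_real y))" for i
    by (rule component_law_cases[of "\<lambda>F. integrable F (\<lambda>y. exp (- s * complex_of_real y))"])
       (intro lst_integrable FV.prob_space_axioms FH.prob_space_axioms H_nonneg V_nonneg s; simp)+
  have int: "integrable block_law (\<lambda>r. exp (- s * complex_of_real (r i)))" for i
    using c[of i] unfolding distr_component[symmetric] by (subst (asm) integrable_distr_eq) simp_all
  have comp: "(\<integral>r. exp (- s * complex_of_real (r i)) \<partial>block_law) = lst (component_law i) s" for i
    unfolding lst_def distr_component[symmetric] by (subst integral_distr) simp_all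
  have "B.indep_vars component_law (\<lambda>i r. r i) UNIV"
    unfolding block_law_def by (rule indep_vars_PiM_coordinates) (rule prob_component_law)
  then have "B.indep_vars (\<lambda>_. borel) (\<lambda>i r. exp (- s * complex_of_real (r i))) UNIV"
    by (rule B.indep_vars_compose2) (subst measurable_cong_sets[OF sets_component_law refl], simp)
  then have ind: "B.indep_vars (\<lambda>_. borel) (\<lambda>i r. exp (- s * complex_of_real (r i))) {..m}"
    by (rule B.indep_vars_subset) simp
  have "exp (- s * of_real (service m r)) = (\<Prod>i\<le>m. exp (- s * complex_of_real (r i)))" for r
    by (simp add: service_def sum_distrib_left exp_sum[symmetric] sum_negf)
  then have "(\<integral>r. exp (- s * of_real (service m r)) \<partial>block_law) = (\<Prod>i\<le>m. lst (component_law i) s)"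
    using B.indep_vars_lebesgue_integral[OF _ ind] int by (simp only: comp) simp
  also have "\<dots> = lst FV s * (\<Prod>i<m. lst FH s)"
    by (subst prod.atMost_shift) (simp add: component_law_def)
  finally show ?thesis by simp
qed

lemma poisson_service_integrable: "integrable block_law (\<lambda>r. poisson_weight (lam * service m r) w)"
proof (rule B.integrable_const_bound[where B = 1])
  show "AE r in block_law. norm (poisson_weight (lam * service m r) w) \<le> 1"
    using AE_service_nonneg[of m]
    by eventually_elim (use lam_pos in \<open>simp add: poisson_weight_le_1 poisson_weight_nonneg\<close>)
qed simp

text \<open>A mixed Poisson law: given the service data, the count is Poisson with mean
  \<open>lam\<close> times the service time.\<close>

definition arrivals_law :: "nat \<Rightarrow> nat pmf" where
  "arrivals_law m = embed_pmf (\<lambda>w. \<integral>r. poisson_weight (lam * service m r) w \<partial>block_law)"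

lemma pmf_arrivals_law: "pmf (arrivals_law m) w = (\<integral>r. poisson_weight (lam * service m r) w \<partial>block_law)"
  unfolding arrivals_law_def
proof (rule pmf_embed_pmf)
  have nn: "AE r in block_law. 0 \<le> poisson_weight (lam * service m r) w" for w
    using AE_service_nonneg[of m] by eventually_elim (use lam_pos in \<open>simp add: poisson_weight_nonneg\<close>)
  then show "0 \<le> (\<integral>r. poisson_weight (lam * service m r) w \<partial>block_law)" for w
    by (rule integral_nonneg_AE)
  have "(\<integral>\<^sup>+w. ennreal (\<integral>r. poisson_weight (lam * service m r) w \<partial>block_law) \<partial>count_space UNIV) =
      (\<Sum>w. \<integral>\<^sup>+r. ennreal (poisson_weight (lam * service m r) w) \<partial>block_law)"
    by (simp add: nn_integral_count_space_nat nn_integral_eq_integral[OF poisson_service_integrable nn])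
  also have "\<dots> = (\<integral>\<^sup>+r. (\<Sum>w. ennreal (poisson_weight (lam * service m r) w)) \<partial>block_law)"
    by (rule nn_integral_suminf[symmetric]) simp
  also have "\<dots> = (\<integral>\<^sup>+r. 1 \<partial>block_law)"
  proof (rule nn_integral_cong_AE)
    show "AE r in block_law. (\<Sum>w. ennreal (poisson_weight (lam * service m r) w)) = 1"
      using AE_service_nonneg[of m]
    proof eventually_elim
      case (elim r)
      then show ?case
        using poisson_weight_sums[of "lam * service m r"] lam_pos
        by (subst suminf_ennreal2) (auto simp: poisson_weight_nonneg sums_iff)
    qed
  qed
  finally show "(\<integral>\<^sup>+w. ennreal (\<integral>r. poisson_weight (lam * service m r) w \<partial>block_law) \<partial>count_space UNIV) = 1"
    by simp
qed

lemma nn_integral_arrivals_law: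
  "(\<integral>\<^sup>+w. f w \<partial>arrivals_law m) = (\<integral>\<^sup>+r. (\<Sum>w. ennreal (poisson_weight (lam * service m r) w) * f w) \<partial>block_law)"
proof -
  have nn: "AE r in block_law. 0 \<le> poisson_weight (lam * service m r) w" for w
    using AE_service_nonneg[of m] by eventually_elim (use lam_pos in \<open>simp add: poisson_weight_nonneg\<close>)
  have "(\<integral>\<^sup>+w. f w \<partial>arrivals_law m) = (\<Sum>w. (\<integral>\<^sup>+r. ennreal (poisson_weight (lam * service m r) w) \<partial>block_law) * f w)"
    by (simp add: nn_integral_measure_pmf nn_integral_count_space_nat pmf_arrivals_law
        nn_integral_eq_integral[OF poisson_service_integrable nn])
  also have "\<dots> = (\<Sum>w. \<integral>\<^sup>+r. ennreal (poisson_weight (lam * service m r) w) * f w \<partial>block_law)"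
    by (simp add: nn_integral_multc)
  also have "\<dots> = (\<integral>\<^sup>+r. (\<Sum>w. ennreal (poisson_weight (lam * service m r) w) * f w) \<partial>block_law)"
    by (rule nn_integral_suminf[symmetric]) simp
  finally show ?thesis .
qed

lemma arrivals_law_mean:
  "(\<integral>\<^sup>+w. ennreal (real w) \<partial>arrivals_law m) = ennreal (lam * (real m * mean FH + mean FV))"
proof -
  have "(\<integral>\<^sup>+w. ennreal (real w) \<partial>arrivals_law m) = (\<integral>\<^sup>+r. ennreal (lam * service m r) \<partial>block_law)"
    unfolding nn_integral_arrivals_law
  proof (rule nn_integral_cong_AE)
    show "AE r in block_law. (\<Sum>w. ennreal (poisson_weight (lam * service m r) w) * ennreal (real w)) = ennreal (lam * service m r)"
      using AE_service_nonneg[of m]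
    proof eventually_elim
      case (elim r)
      then have "0 \<le> lam * service m r" using lam_pos by simp
      then show ?case
        using poisson_weight_mean_sums[of "lam * service m r"]
        by (simp add: ennreal_mult[symmetric] poisson_weight_nonneg suminf_ennreal2 sums_iff)
    qed
  qed
  also have "\<dots> = ennreal (\<integral>r. lam * service m r \<partial>block_law)"
    by (rule nn_integral_eq_integral)
       (use service_integral AE_service_nonneg[of m] lam_pos in \<open>auto elim: eventually_mono\<close>)
  finally show ?thesis by (simp add: service_integral)
qed

lemma arrivals_law_integral:
  fixes f :: "nat \<Rightarrow> 'b :: {banach, second_countable_topology}"
  assumes f: "\<And>k. norm (f k) \<le> C"
  shows "measure_pmf.expectation (arrivals_law m) f =
    (\<integral>r. (\<Sum>w. poisson_weight (lam * service m r) w *\<^sub>R f w) \<partial>block_law)"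
    and "integrable block_law (\<lambda>r. \<Sum>w. poisson_weight (lam * service m r) w *\<^sub>R f w)"
proof -
  have C: "0 \<le> C" using f[of 0] norm_ge_zero order_trans by blast
  define g where "g w r = poisson_weight (lam * service m r) w *\<^sub>R f w" for w r
  have 1: "integrable block_law (g w)" for w
    unfolding g_def[abs_def] by (intro integrable_scaleR_left poisson_service_integrable)
  have 2: "AE r in block_law. summable (\<lambda>w. norm (g w r))"
    using AE_service_nonneg[of m]
  proof eventually_elim
    case (elim r)
    then have r: "0 \<le> lam * service m r" using lam_pos by simp
    show ?case
    proof (rule summable_comparison_test'[of "\<lambda>w. poisson_weight (lam * service m r) w * C" 0])
      show "summable (\<lambda>w. poisson_weight (lam * service m r) w * C)"
        using poisson_weight_sums by (intro summable_mult2) (simp add: sums_iff)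
    qed (use poisson_weight_nonneg[OF r] f in \<open>auto simp: g_def intro!: mult_left_mono\<close>)
  qed
  have le: "(\<integral>r. norm (g w r) \<partial>block_law) \<le> pmf (arrivals_law m) w * C" for w
  proof -
    have "(\<integral>r. norm (g w r) \<partial>block_law) \<le> (\<integral>r. poisson_weight (lam * service m r) w * C \<partial>block_law)"
    proof (rule integral_mono_AE)
      show "AE r in block_law. norm (g w r) \<le> poisson_weight (lam * service m r) w * C"
        using AE_service_nonneg[of m]
        by eventually_elim (use lam_pos f in \<open>auto simp: g_def poisson_weight_nonneg intro!: mult_left_mono\<close>)
    qed (use 1 poisson_service_integrable in auto)
    then show ?thesis by (simp add: pmf_arrivals_law)
  qed
  have 3: "summable (\<lambda>w. \<integral>r. norm (g w r) \<partial>block_law)"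
  proof (rule summable_comparison_test'[of "\<lambda>w. pmf (arrivals_law m) w * C" 0])
    show "summable (\<lambda>w. pmf (arrivals_law m) w * C)"
      using pmf_nat_sums[of "arrivals_law m"] by (intro summable_mult2) (rule sums_summable)
    show "norm (\<integral>r. norm (g w r) \<partial>block_law) \<le> pmf (arrivals_law m) w * C" for w
      using le[of w] integral_nonneg_AE[of "\<lambda>r. norm (g w r)" block_law] by simp
  qed
  show "integrable block_law (\<lambda>r. \<Sum>w. poisson_weight (lam * service m r) w *\<^sub>R f w)"
    using integrable_suminf[OF 1 2 3] by (simp add: g_def)
  have "(\<lambda>w. pmf (arrivals_law m) w *\<^sub>R f w) sums (\<integral>r. (\<Sum>w. g w r) \<partial>block_law)"
    using sums_integral[OF 1 2 3] by (simp add: g_def pmf_arrivals_law poisson_service_integrable)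
  moreover have "(\<lambda>w. pmf (arrivals_law m) w *\<^sub>R f w) sums measure_pmf.expectation (arrivals_law m) f"
    by (intro integral_pmf_nat_sums integrable_pmf_bounded[of f C] f)
  ultimately show "measure_pmf.expectation (arrivals_law m) f =
    (\<integral>r. (\<Sum>w. poisson_weight (lam * service m r) w *\<^sub>R f w) \<partial>block_law)"
    by (simp add: g_def sums_unique2)
qed

lemma pgf_arrivals_law:
  assumes z: "norm z \<le> 1"
  shows "pgf (arrivals_law m) z = arrivals_gf lam FH z ^ m * arrivals_gf lam FV z"
proof -
  have b: "norm (z ^ k) \<le> 1" for k using z by (simp add: norm_power power_le_one)
  have "(\<Sum>w. poisson_weight (lam * service m r) w *\<^sub>R z ^ w) = exp (- (of_real lam - of_real lam * z) * of_real (service m r))" for r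
  proof -
    have "- (complex_of_real (lam * service m r) * (1 - z)) = - (of_real lam - of_real lam * z) * of_real (service m r)"
      by (simp add: algebra_simps)
    then have "(\<lambda>w. poisson_weight (lam * service m r) w *\<^sub>R z ^ w) sums exp (- (of_real lam - of_real lam * z) * of_real (service m r))"
      using poisson_weight_gf_sums'[of "lam * service m r" z] by (simp only: scaleR_conv_of_real)
    then show ?thesis by (rule sums_unique[symmetric])
  qed
  then show ?thesis
    using lst_service[OF norm_arrivals_gf_arg(1)[OF _ z], of lam m] lam_pos
    unfolding pgf_def arrivals_law_integral(1)[OF b] arrivals_gf_def by simp
qed

text \<open>Both expectations are taken over the same block. In this coupling the services of
  \<open>m\<close> and of \<open>m + 1\<close> customers differ by the one component
  \<open>r (Suc m)\<close>, whose mean is \<open>mean FH\<close>, and Poisson averages are Lipschitz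
  in their parameter.\<close>

lemma arrivals_law_lipschitz:
  assumes f: "\<And>k. \<bar>f k\<bar> \<le> C" "\<And>k. \<bar>f (Suc k) - f k\<bar> \<le> L"
  shows "\<bar>measure_pmf.expectation (arrivals_law (Suc m)) f - measure_pmf.expectation (arrivals_law m) f\<bar> \<le> L * (lam * mean FH)"
proof -
  have nf: "norm (f k) \<le> C" for k using f(1) by simp
  define g where "g x = (\<Sum>w. poisson_weight x w * f w)" for x
  have e: "measure_pmf.expectation (arrivals_law m) f = (\<integral>r. g (lam * service m r) \<partial>block_law)" for m
    using arrivals_law_integral(1)[of f C m, OF nf] by (simp add: g_def)
  have i: "integrable block_law (\<lambda>r. g (lam * service m r))" for m
    using arrivals_law_integral(2)[of f C m, OF nf] by (simp add: g_def)
  have "\<bar>(\<integral>r. g (lam * service (Suc m) r) - g (lam * service m r) \<partial>block_law)\<bar> \<le> (\<integral>r. \<bar>g (lam * service (Suc m) r) - g (lam * service m r)\<bar> \<partial>block_law)"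
    by (rule integral_abs_bound)
  also have "\<dots> \<le> (\<integral>r. L * (lam * r (Suc m)) \<partial>block_law)"
  proof (rule integral_mono_AE)
    show "AE r in block_law. \<bar>g (lam * service (Suc m) r) - g (lam * service m r)\<bar> \<le> L * (lam * r (Suc m))"
      using AE_service_nonneg[of m] AE_block_nonneg
    proof eventually_elim
      case (elim r)
      then show ?case
        using poisson_average_lipschitz[of f C L "lam * service m r" "lam * r (Suc m)"] f lam_pos
        by (simp add: g_def service_def distrib_left)
    qed
  qed (use i component_integral in auto)
  also have "\<dots> = L * (lam * mean FH)"
    using component_integral(2)[of "Suc m"] by (simp add: component_law_def)
  finally show ?thesis using i by (simp add: e)
qed

lemma arrivals_law_pos: "0 < pmf (arrivals_law m) 0"
proof -
  have "integrable block_law (\<lambda>r. exp (- (lam * service m r)))"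
    using poisson_service_integrable[of m 0] by (simp add: poisson_weight_def)
  then have "(\<integral>r. exp (- (lam * service m r)) \<partial>block_law) \<noteq> 0"
    by (subst integral_nonneg_eq_0_iff_AE) auto
  moreover have "0 \<le> pmf (arrivals_law m) 0" by simp
  ultimately show ?thesis by (simp add: pmf_arrivals_law poisson_weight_def less_le)
qed

section \<open>The queue length chain and its stationary law\<close>

definition kernel :: "nat \<Rightarrow> nat pmf" where
  "kernel w = arrivals_law (max w 1)"

primrec waiting_law :: "nat \<Rightarrow> nat pmf" where
  "waiting_law 0 = return_pmf 0"
| "waiting_law (Suc n) = bind_pmf (waiting_law n) kernel"

text \<open>The induction moves the test function instead of the law: averaging over
  \<open>kernel\<close> multiplies the Lipschitz constant by \<open>lam * mean FH\<close> and
  preserves the bound \<open>C\<close>. The last factor is the mean of the first step out of state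
  0.\<close>

lemma waiting_law_contraction:
  assumes f: "\<And>k. \<bar>f k\<bar> \<le> C" "\<And>k. \<bar>f (Suc k) - f k\<bar> \<le> L"
  shows "\<bar>measure_pmf.expectation (waiting_law (Suc n)) f - measure_pmf.expectation (waiting_law n) f\<bar>
    \<le> (lam * mean FH) ^ n * L * (lam * (mean FH + mean FV))"
  using assms
proof (induction n arbitrary: f L)
  case 0
  have int: "integrable (measure_pmf (kernel 0)) f"
    by (rule integrable_pmf_bounded[of f C]) (use 0 in auto)
  have nn: "(\<integral>\<^sup>+w. ennreal (real w) \<partial>kernel 0) = ennreal (lam * (mean FH + mean FV))"
    using arrivals_law_mean[of 1] by (simp add: kernel_def)
  then have int': "integrable (measure_pmf (kernel 0)) real"
    by (intro integrableI_nonneg) (auto simp: less_top[symmetric])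
  have lip: "\<bar>f k - f 0\<bar> \<le> L * real k" for k
  proof (induction k)
    case (Suc k)
    then show ?case using 0(2)[of k] by (simp add: algebra_simps)
  qed simp
  have "measure_pmf.expectation (waiting_law 1) f - measure_pmf.expectation (waiting_law 0) f =
      measure_pmf.expectation (kernel 0) (\<lambda>k. f k - f 0)"
    using int by (simp add: bind_return_pmf)
  also have "\<bar>\<dots>\<bar> \<le> measure_pmf.expectation (kernel 0) (\<lambda>k. \<bar>f k - f 0\<bar>)"
    by (rule integral_abs_bound)
  also have "\<dots> \<le> measure_pmf.expectation (kernel 0) (\<lambda>k. L * real k)"
    by (rule integral_mono) (use int int' lip in auto)
  also have "\<dots> = L * (lam * (mean FH + mean FV))"
    using nn int' mean_nonneg lam_pos
    by (simp add: nn_integral_eq_integral integral_nonneg_AE)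
  finally show ?case by simp
next
  case (Suc n)
  define g where "g k = measure_pmf.expectation (kernel k) f" for k
  have intf: "integrable (measure_pmf p) f" for p
    by (rule integrable_pmf_bounded[of f C]) (use Suc.prems in auto)
  have g1: "\<bar>g k\<bar> \<le> C" for k
  proof -
    have "\<bar>g k\<bar> \<le> measure_pmf.expectation (kernel k) (\<lambda>k. \<bar>f k\<bar>)"
      unfolding g_def by (rule integral_abs_bound)
    also have "\<dots> \<le> measure_pmf.expectation (kernel k) (\<lambda>_. C)"
      by (rule integral_mono) (use intf Suc.prems in auto)
    finally show ?thesis by simp
  qed
  have L: "0 \<le> L" using Suc.prems(2)[of 0] by linarith
  have g2: "\<bar>g (Suc k) - g k\<bar> \<le> L * (lam * mean FH)" for k
  proof (cases "k = 0")
    case True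
    \<comment> \<open>From 0 as from 1 the batch consists of one customer, so the two kernels
      agree.\<close>
    then show ?thesis using L lam_pos mean_nonneg by (simp add: g_def kernel_def)
  next
    case False
    then show ?thesis using arrivals_law_lipschitz[of f C L k, OF Suc.prems] by (simp add: g_def kernel_def max_absorb1)
  qed
  have bind: "measure_pmf.expectation (waiting_law (Suc n)) f = measure_pmf.expectation (waiting_law n) g" for n
    using integral_bind_pmf_bounded[of f C] Suc.prems by (simp add: g_def[abs_def])
  show ?case
    using Suc.IH[of g "L * (lam * mean FH)", OF g1 g2] unfolding bind[symmetric] by (simp add: mult_ac)
qed

text \<open>The bound is the fixed point of
  \<open>b = lam * mean FH * (b + 1) + lam * mean FV\<close>. This recursion comes from
  \<open>max k 1 \<le> k + 1\<close>, so the bound reproduces itself in every step.\<close>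

lemma waiting_law_mean_le:
  "(\<integral>\<^sup>+k. ennreal (real k) \<partial>waiting_law n) \<le> ennreal ((lam * mean FH + lam * mean FV) / (1 - lam * mean FH))"
proof (induction n)
  case 0
  show ?case by simp
next
  case (Suc n)
  define b where "b = (lam * mean FH + lam * mean FV) / (1 - lam * mean FH)"
  have b0: "0 \<le> b" unfolding b_def using rho_less_1 lam_pos mean_nonneg by (intro divide_nonneg_nonneg) auto
  have br: "lam * mean FH * (b + 1) + lam * mean FV = b"
    using rho_less_1 by (simp add: b_def field_simps)
  have "(\<integral>\<^sup>+k. ennreal (real k) \<partial>waiting_law (Suc n)) =
      (\<integral>\<^sup>+k. ennreal (lam * (real (max k 1) * mean FH + mean FV)) \<partial>waiting_law n)"
    by (simp add: kernel_def arrivals_law_mean)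
  also have "\<dots> \<le> (\<integral>\<^sup>+k. ennreal (lam * mean FH) * ennreal (real k) + ennreal (lam * mean FH + lam * mean FV) \<partial>waiting_law n)"
  proof (rule nn_integral_mono)
    fix k
    have "lam * (real (max k 1) * mean FH + mean FV) \<le> lam * mean FH * real k + (lam * mean FH + lam * mean FV)"
      using lam_pos mean_nonneg mult_nonneg_nonneg[of lam "mean FH"]
      by (auto simp: algebra_simps max_def split: if_splits)
    then show "ennreal (lam * (real (max k 1) * mean FH + mean FV)) \<le> ennreal (lam * mean FH) * ennreal (real k) + ennreal (lam * mean FH + lam * mean FV)"
      using lam_pos mean_nonneg by (subst ennreal_mult[symmetric]) (auto simp flip: ennreal_plus intro!: ennreal_leI)
  qed
  also have "\<dots> = ennreal (lam * mean FH) * (\<integral>\<^sup>+k. ennreal (real k) \<partial>waiting_law n) + ennreal (lam * mean FH + lam * mean FV)"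
    by (simp add: nn_integral_add nn_integral_cmult measure_pmf.emeasure_space_1)
  also have "\<dots> \<le> ennreal (lam * mean FH) * ennreal b + ennreal (lam * mean FH + lam * mean FV)"
    using Suc.IH by (intro add_mono mult_left_mono) (auto simp: b_def)
  also have "\<dots> = ennreal b"
    using lam_pos mean_nonneg b0 br by (simp add: ennreal_mult[symmetric] ennreal_plus[symmetric] distrib_left del: ennreal_plus)
  finally show ?case unfolding b_def .
qed

text \<open>The indicator of \<open>{k}\<close> is Lipschitz with constant 1 on the naturals, so the
  increments are dominated by a geometric series.\<close>

lemma waiting_law_convergent: "convergent (\<lambda>n. pmf (waiting_law n) k)"
proof -
  define f :: "nat \<Rightarrow> real" where "f = indicator {k}"
  have x: "pmf (waiting_law n) k = measure_pmf.expectation (waiting_law n) f" for n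
    by (simp add: f_def measure_pmf_single)
  have le: "\<bar>measure_pmf.expectation (waiting_law (Suc n)) f - measure_pmf.expectation (waiting_law n) f\<bar>
      \<le> (lam * mean FH) ^ n * 1 * (lam * (mean FH + mean FV))" for n
    by (rule waiting_law_contraction[of f 1]) (auto simp: f_def indicator_def)
  have sm: "summable (\<lambda>n. (lam * mean FH) ^ n * 1 * (lam * (mean FH + mean FV)))"
    using rho_less_1 lam_pos mean_nonneg by (intro summable_mult2 summable_geometric) simp
  have "summable (\<lambda>n. pmf (waiting_law (Suc n)) k - pmf (waiting_law n) k)"
    unfolding x by (rule summable_comparison_test'[OF sm]) (simp only: real_norm_def le)
  then have "convergent (\<lambda>n. \<Sum>i<n. pmf (waiting_law (Suc i)) k - pmf (waiting_law i) k)"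
    by (simp add: summable_iff_convergent)
  then have "convergent (\<lambda>n. pmf (waiting_law n) k - pmf (waiting_law 0) k)"
    by (simp only: sum_lessThan_telescope[of "\<lambda>n. pmf (waiting_law n) k"])
  from convergent_add[OF this convergent_const[of "pmf (waiting_law 0) k"]] show ?thesis
    by (simp del: waiting_law.simps)
qed

text \<open>The pointwise limits could lose mass at infinity. The uniform bound on the means
  excludes this: by Markov's inequality the mass above \<open>K\<close> is at most
  \<open>b / real (Suc K)\<close> for every \<open>n\<close>. The truncated means also pass to the
  limit.\<close>

lemma limit_law_exists:
  "\<exists>\<pi>. (\<forall>k. (\<lambda>n. pmf (waiting_law n) k) \<longlonglongrightarrow> pmf \<pi> k) \<and> integrable (measure_pmf \<pi>) real"
proof -
  define b where "b = (lam * mean FH + lam * mean FV) / (1 - lam * mean FH)"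
  have b0: "0 \<le> b" unfolding b_def using rho_less_1 lam_pos mean_nonneg by (intro divide_nonneg_nonneg) auto
  define p where "p k = lim (\<lambda>n. pmf (waiting_law n) k)" for k
  have p: "(\<lambda>n. pmf (waiting_law n) k) \<longlonglongrightarrow> p k" for k
    using waiting_law_convergent[of k] by (simp add: p_def convergent_LIMSEQ_iff)
  have p0: "0 \<le> p k" for k
    by (rule LIMSEQ_le_const[OF p]) auto
  have partial: "(\<lambda>n. \<Sum>k\<le>K. pmf (waiting_law n) k * g k) \<longlonglongrightarrow> (\<Sum>k\<le>K. p k * g k)" for K and g :: "nat \<Rightarrow> real"
    by (intro tendsto_intros p)
  have int: "integrable (measure_pmf (waiting_law n)) real" for n
    using waiting_law_mean_le[of n] by (intro integrableI_nonneg) (auto simp: le_less_trans[OF _ ennreal_less_top])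
  have mean: "(\<lambda>k. pmf (waiting_law n) k * real k) sums measure_pmf.expectation (waiting_law n) real"
    "measure_pmf.expectation (waiting_law n) real \<le> b" for n
    using integral_pmf_nat_sums[OF int[of n]] waiting_law_mean_le[of n] b0
      nn_integral_eq_integral[OF int[of n]] by (auto simp: b_def)
  have up: "(\<Sum>k\<le>K. pmf (waiting_law n) k) \<le> 1" for K n
    using sum_le_suminf[of "pmf (waiting_law n)" "{..K}"] pmf_nat_sums[of "waiting_law n"] by (auto simp: sums_iff)
  have meanK: "(\<Sum>k\<le>K. pmf (waiting_law n) k * real k) \<le> b" for K n
    using sum_le_suminf[of "\<lambda>k. pmf (waiting_law n) k * real k" "{..K}"] mean[of n] by (auto simp: sums_iff)
  have lo: "1 - b / real (Suc K) \<le> (\<Sum>k\<le>K. pmf (waiting_law n) k)" for K n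
  proof -
    have "real (Suc K) * (1 - (\<Sum>k\<le>K. pmf (waiting_law n) k)) = (\<Sum>k. real (Suc K) * pmf (waiting_law n) (k + Suc K))"
    proof -
      have "summable (\<lambda>k. pmf (waiting_law n) (k + Suc K))"
        using pmf_nat_sums[of "waiting_law n"] by (subst summable_iff_shift) (simp add: sums_iff)
      from suminf_mult[OF this, of "real (Suc K)"] show ?thesis
        using suminf_minus_initial_segment[of "pmf (waiting_law n)" "Suc K"] pmf_nat_sums[of "waiting_law n"]
        by (simp only: sums_iff lessThan_Suc_atMost)
    qed
    also have "\<dots> \<le> (\<Sum>k. pmf (waiting_law n) (k + Suc K) * real (k + Suc K))"
      using pmf_nat_sums[of "waiting_law n"] mean[of n]
      by (intro suminf_le summable_mult summable_ignore_initial_segment[of _ "Suc K"])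
         (auto simp: sums_iff mult.commute[of "pmf _ _"] intro!: mult_right_mono)
    also have "\<dots> \<le> b"
    proof -
      have "(\<Sum>k. pmf (waiting_law n) (k + Suc K) * real (k + Suc K)) =
          measure_pmf.expectation (waiting_law n) real - (\<Sum>k<Suc K. pmf (waiting_law n) k * real k)"
        using suminf_minus_initial_segment[of "\<lambda>k. pmf (waiting_law n) k * real k" "Suc K"] mean[of n] by (simp add: sums_iff)
      moreover have "0 \<le> (\<Sum>k<Suc K. pmf (waiting_law n) k * real k)" by (intro sum_nonneg) auto
      ultimately show ?thesis using mean(2)[of n] by linarith
    qed
    finally show ?thesis by (simp add: field_simps)
  qed
  have pup: "(\<Sum>k\<le>K. p k) \<le> 1" for K
    using LIMSEQ_le_const2[OF partial[of "\<lambda>_. 1" K], of 1] up by auto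
  have plo: "1 - b / real (Suc K) \<le> (\<Sum>k\<le>K. p k)" for K
    using LIMSEQ_le_const[OF partial[of "\<lambda>_. 1" K], of "1 - b / real (Suc K)"] lo by auto
  have pmean: "(\<Sum>k\<le>K. p k * real k) \<le> b" for K
    using LIMSEQ_le_const2[OF partial[of real K], of b] meanK by auto
  have "p sums 1"
    unfolding sums_def_le
  proof (rule tendsto_sandwich)
    show "(\<lambda>K. 1 - b / real (Suc K)) \<longlonglongrightarrow> 1"
      using tendsto_diff[OF tendsto_const lim_const_over_n[of b, THEN LIMSEQ_Suc], of 1] by simp
  qed (use pup plo in auto)
  then have "(\<integral>\<^sup>+k. ennreal (p k) \<partial>count_space UNIV) = 1"
    by (simp add: nn_integral_count_space_nat suminf_ennreal2 p0 sums_iff)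
  then have pi: "pmf (embed_pmf p) k = p k" for k
    using p0 by (intro pmf_embed_pmf)
  have "summable (\<lambda>k. p k * real k)"
    by (rule bounded_imp_summable[OF _ pmean]) (use p0 in auto)
  then have "integrable (measure_pmf (embed_pmf p)) real"
    by (intro integrable_pmf_nat) (auto simp: pi)
  then show ?thesis using p by (intro exI[of _ "embed_pmf p"]) (simp add: pi)
qed

definition stationary_law :: "nat pmf" where
  "stationary_law = (SOME \<pi>. (\<forall>k. (\<lambda>n. pmf (waiting_law n) k) \<longlonglongrightarrow> pmf \<pi> k) \<and> integrable (measure_pmf \<pi>) real)"

lemma waiting_law_tendsto: "(\<lambda>n. pmf (waiting_law n) k) \<longlonglongrightarrow> pmf stationary_law k"
  and stationary_mean_integrable: "integrable (measure_pmf stationary_law) real"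
  using someI_ex[OF limit_law_exists] unfolding stationary_law_def by blast+

lemma bind_stationary_law: "bind_pmf stationary_law kernel = stationary_law"
proof (rule pmf_eqI)
  fix w
  have "(\<lambda>n. pmf (waiting_law (Suc n)) w) \<longlonglongrightarrow> measure_pmf.expectation stationary_law (\<lambda>k. pmf (kernel k) w)"
    unfolding waiting_law.simps pmf_bind
    by (rule pmf_limit_expectation[of _ _ _ 1]) (simp_all add: waiting_law_tendsto pmf_le_1)
  moreover have "(\<lambda>n. pmf (waiting_law (Suc n)) w) \<longlonglongrightarrow> pmf stationary_law w"
    by (rule LIMSEQ_Suc[OF waiting_law_tendsto])
  ultimately show "pmf (bind_pmf stationary_law kernel) w = pmf stationary_law w"
    unfolding pmf_bind by (rule LIMSEQ_unique)
qed

sublocale chain: customer_chain kernel stationary_law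
  by unfold_locales (simp_all add: bind_stationary_law kernel_def arrivals_law_pos)

abbreviation mean_waiting :: real where
  "mean_waiting \<equiv> measure_pmf.expectation stationary_law real"

lemma expectation_max_1:
  "measure_pmf.expectation stationary_law (\<lambda>k. real (max k 1)) = mean_waiting + pmf stationary_law 0"
  "integrable (measure_pmf stationary_law) (\<lambda>k. real (max k 1))"
proof -
  have e: "real (max k 1) = real k + indicator {0} k" for k by (simp add: indicator_def max_def)
  show "integrable (measure_pmf stationary_law) (\<lambda>k. real (max k 1))"
    unfolding e by (intro Bochner_Integration.integrable_add stationary_mean_integrable
        integrable_pmf_bounded[of "indicator {0}" 1]) (simp add: indicator_def)
  show "measure_pmf.expectation stationary_law (\<lambda>k. real (max k 1)) = mean_waiting + pmf stationary_law 0"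
    unfolding e using stationary_mean_integrable integrable_pmf_bounded[of "indicator {0} :: nat \<Rightarrow> real" 1]
    by (subst Bochner_Integration.integral_add) (simp_all add: measure_pmf_single indicator_def)
qed

text \<open>The mean of the stationarity equation: the customers left behind by a batch are the
  Poisson arrivals during its service. The identity simplifies the utilization and later the delay
  formula.\<close>

lemma mean_waiting_eq: "mean_waiting = lam * mean_batch_service FH FV stationary_law"
proof -
  have "ennreal mean_waiting = (\<integral>\<^sup>+k. ennreal (real k) \<partial>stationary_law)"
    using nn_integral_eq_integral[OF stationary_mean_integrable] by simp
  also have "\<dots> = (\<integral>\<^sup>+k. (\<integral>\<^sup>+w. ennreal (real w) \<partial>kernel k) \<partial>stationary_law)"
    by (subst bind_stationary_law[symmetric]) simp
  also have "\<dots> = (\<integral>\<^sup>+k. ennreal (lam * (real (max k 1) * mean FH + mean FV)) \<partial>stationary_law)"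
    by (simp add: kernel_def arrivals_law_mean)
  also have "\<dots> = ennreal (measure_pmf.expectation stationary_law (\<lambda>k. lam * (real (max k 1) * mean FH + mean FV)))"
    using lam_pos mean_nonneg expectation_max_1(2) by (intro nn_integral_eq_integral) auto
  also have "measure_pmf.expectation stationary_law (\<lambda>k. lam * (real (max k 1) * mean FH + mean FV)) =
      lam * mean_batch_service FH FV stationary_law"
    using expectation_max_1 by (simp add: mean_batch_service_def)
  finally show ?thesis
    using lam_pos mean_nonneg by (simp add: mean_batch_service_def integral_nonneg_AE)
qed

lemma mean_batch_service_pos: "0 < mean_batch_service FH FV stationary_law"
proof (rule ccontr)
  assume "\<not> 0 < mean_batch_service FH FV stationary_law"
  moreover have m: "0 \<le> mean_waiting" by (simp add: integral_nonneg_AE)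
  ultimately have "mean_batch_service FH FV stationary_law = 0"
    using mean_waiting_eq lam_pos by (simp add: not_less zero_le_mult_iff)
  then have "(mean_waiting + pmf stationary_law 0) * mean FH = 0 \<and> mean FV = 0"
    using m mean_nonneg by (simp add: mean_batch_service_def add_nonneg_eq_0_iff)
  moreover have "0 < mean_waiting + pmf stationary_law 0"
    using m chain.stationary_pos by linarith
  ultimately show False using mean_pos by simp
qed

text \<open>By the identity for \<open>mean_waiting\<close>, the numerator is the mean queue length,
  and the denominator exceeds it by \<open>pmf stationary_law 0\<close>.\<close>

lemma utilization_eq:
  "utilization lam FH FV stationary_law = mean_waiting / (mean_waiting + pmf stationary_law 0)"
  using mean_waiting_eq by (simp add: utilization_def mean_batch_service_def Let_def algebra_simps)

section \<open>The generating function of the stationary law\<close>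

lemma pgf_kernel:
  assumes "norm z \<le> 1"
  shows "pgf (kernel w) z = arrivals_gf lam FH z ^ (max w 1) * arrivals_gf lam FV z"
  unfolding kernel_def using assms by (rule pgf_arrivals_law)

lemma pgf_batch_size:
  assumes "norm z \<le> 1"
  shows "measure_pmf.expectation p (\<lambda>k. z ^ max k 1) = pgf p z + (z - 1) * pgf p 0"
proof -
  have i: "integrable (measure_pmf p) (\<lambda>k. z ^ k)" if "norm z \<le> 1" for z :: complex
    by (rule integrable_pmf_bounded[of _ 1]) (use that in \<open>simp add: norm_power power_le_one\<close>)
  \<comment> \<open>\<open>0 ^ k\<close> is the indicator of \<open>k = 0\<close>; its expectation
    is the value of the generating function at 0.\<close>
  have e: "z ^ max k 1 = z ^ k + (z - 1) * 0 ^ k" for k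
    by (cases k) auto
  show ?thesis
    unfolding e pgf_def using i[OF assms] i[of 0] by simp
qed

lemma norm_arrivals_gf:
  assumes "norm z \<le> 1"
  shows "norm (arrivals_gf lam FH z) \<le> 1" "norm (arrivals_gf lam FV z) \<le> 1"
    "norm (1 - arrivals_gf lam FH z) \<le> lam * mean FH * norm (1 - z)"
    "norm (1 - arrivals_gf lam FV z) \<le> lam * mean FV * norm (1 - z)"
  using norm_lst_le_1[OF FH.prob_space_axioms _ H_nonneg, of "of_real lam - of_real lam * z"]
    norm_lst_le_1[OF FV.prob_space_axioms _ V_nonneg, of "of_real lam - of_real lam * z"]
    norm_one_minus_lst_le[OF FH.prob_space_axioms _ H_nonneg _ H_int, of "of_real lam - of_real lam * z"]
    norm_one_minus_lst_le[OF FV.prob_space_axioms _ V_nonneg _ V_int, of "of_real lam - of_real lam * z"]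
    norm_arrivals_gf_arg[OF _ assms, of lam] lam_pos
  by (simp_all add: arrivals_gf_def mult_ac)

lemma pgf_stationary:
  assumes z: "norm z \<le> 1"
  defines "a \<equiv> arrivals_gf lam FH z"
  shows "pgf stationary_law z = arrivals_gf lam FV z * (pgf stationary_law a - (1 - a) * pgf stationary_law 0)"
proof -
  have "pgf stationary_law z = measure_pmf.expectation stationary_law (\<lambda>w. a ^ max w 1 * arrivals_gf lam FV z)"
    using pgf_bind[OF z, of stationary_law kernel] by (simp add: bind_stationary_law pgf_kernel z a_def)
  also have "\<dots> = (pgf stationary_law a + (a - 1) * pgf stationary_law 0) * arrivals_gf lam FV z"
    using pgf_batch_size[of a stationary_law] norm_arrivals_gf[OF z] by (simp add: a_def)
  finally show ?thesis by (simp add: algebra_simps)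
qed

text \<open>The finite mean makes the generating function Lipschitz at 1. Since
  \<open>psi_H lam FH n z\<close> tends to 1 geometrically, the remainder factor of the iterated
  equation tends to 1.\<close>

lemma norm_pgf_stationary_diff:
  assumes "norm z \<le> 1"
  shows "norm (1 - pgf stationary_law z) \<le> mean_waiting * norm (1 - z)"
proof -
  have i: "integrable (measure_pmf stationary_law) (\<lambda>k. z ^ k)"
    by (rule integrable_pmf_bounded[of _ 1]) (use assms in \<open>simp add: norm_power power_le_one\<close>)
  have "1 - pgf stationary_law z = measure_pmf.expectation stationary_law (\<lambda>k. 1 - z ^ k)"
    using i by (simp add: pgf_def)
  also have "norm \<dots> \<le> measure_pmf.expectation stationary_law (\<lambda>k. norm (1 - z ^ k))"
    by (rule integral_norm_bound)
  also have "\<dots> \<le> measure_pmf.expectation stationary_law (\<lambda>k. real k * norm (1 - z))"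
  proof (rule integral_mono)
    show "norm (1 - z ^ k) \<le> real k * norm (1 - z)" for k
      using norm_power_diff[of 1 z k] assms by simp
  qed (use i stationary_mean_integrable in auto)
  finally show ?thesis using stationary_mean_integrable by simp
qed

lemma psi_H_0: "psi_H lam FH 0 z = z"
  and psi_H_Suc: "psi_H lam FH (Suc n) z = arrivals_gf lam FH (psi_H lam FH n z)"
  and psi_V_Suc: "psi_V lam FH FV (Suc n) z = arrivals_gf lam FV (psi_H lam FH n z)"
  by (simp_all add: psi_H_def psi_V_def)

lemma norm_psi_H:
  assumes z: "norm z \<le> 1"
  shows "norm (psi_H lam FH n z) \<le> 1" "norm (1 - psi_H lam FH n z) \<le> (lam * mean FH) ^ n * norm (1 - z)"
proof (induction n)
  case (Suc n)
  {
    case 1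
    show ?case using Suc norm_arrivals_gf(1) by (simp add: psi_H_Suc)
  next
    case 2
    have "norm (1 - psi_H lam FH (Suc n) z) \<le> lam * mean FH * norm (1 - psi_H lam FH n z)"
      unfolding psi_H_Suc using Suc(1) by (rule norm_arrivals_gf(3))
    also have "\<dots> \<le> lam * mean FH * ((lam * mean FH) ^ n * norm (1 - z))"
      using Suc(2) lam_pos mean_nonneg by (intro mult_left_mono) auto
    finally show ?case by (simp add: mult_ac)
  }
qed (use z in \<open>simp_all add: psi_H_0\<close>)

abbreviation series_term :: "nat \<Rightarrow> complex \<Rightarrow> complex" where
  "series_term n z \<equiv> (1 - psi_H lam FH (Suc n) z) * (\<Prod>k=1..Suc n. psi_V lam FH FV k z)"

lemma pgf_stationary_iterate:
  assumes z: "norm z \<le> 1"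
  shows "pgf stationary_law z = (\<Prod>k<n. psi_V lam FH FV (Suc k) z) * pgf stationary_law (psi_H lam FH n z)
    - pgf stationary_law 0 * (\<Sum>m<n. series_term m z)"
proof (induction n)
  case (Suc n)
  have P: "(\<Prod>k=1..Suc n. psi_V lam FH FV k z) = (\<Prod>k<Suc n. psi_V lam FH FV (Suc k) z)"
    using prod.shift_bounds_cl_Suc_ivl[of "\<lambda>k. psi_V lam FH FV k z" 0 n]
    by (simp only: atLeast0AtMost lessThan_Suc_atMost One_nat_def)
  have "pgf stationary_law (psi_H lam FH n z) = psi_V lam FH FV (Suc n) z *
      (pgf stationary_law (psi_H lam FH (Suc n) z) - (1 - psi_H lam FH (Suc n) z) * pgf stationary_law 0)"
    unfolding psi_H_Suc psi_V_Suc using pgf_stationary[OF norm_psi_H(1)[OF z]] .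
  moreover have "(\<Sum>m<Suc n. series_term m z) =
      (\<Sum>m<n. series_term m z) +
      (1 - psi_H lam FH (Suc n) z) * ((\<Prod>k<n. psi_V lam FH FV (Suc k) z) * psi_V lam FH FV (Suc n) z)"
    by (simp only: sum.lessThan_Suc P prod.lessThan_Suc)
  ultimately show ?case
    using Suc.IH by (simp only: prod.lessThan_Suc) (simp only: algebra_simps)
qed (simp add: psi_H_0)

theorem pgf_stationary_formula:
  assumes z: "norm z \<le> 1"
  shows "convergent_prod (\<lambda>k. psi_V lam FH FV (Suc k) z)"
    and "summable (\<lambda>n. series_term n z)"
    and "pgf stationary_law z = (\<Prod>k. psi_V lam FH FV (Suc k) z)
      - pgf stationary_law 0 * (\<Sum>n. series_term n z)"
proof -
  define r where "r = lam * mean FH"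
  have r: "0 \<le> r" "r < 1" using lam_pos mean_nonneg rho_less_1 by (simp_all add: r_def)
  have geo: "summable (\<lambda>n. r ^ n * c)" for c :: real
    using r by (intro summable_mult2 summable_geometric) simp
  have "norm (psi_V lam FH FV (Suc k) z - 1) \<le> r ^ k * (lam * mean FV * norm (1 - z))" for k
  proof -
    have "norm (psi_V lam FH FV (Suc k) z - 1) \<le> lam * mean FV * norm (1 - psi_H lam FH k z)"
      unfolding psi_V_Suc using norm_arrivals_gf(4)[OF norm_psi_H(1)[OF z]] by (simp add: norm_minus_commute)
    also have "\<dots> \<le> lam * mean FV * (r ^ k * norm (1 - z))"
      unfolding r_def using norm_psi_H(2)[OF z] lam_pos mean_nonneg by (intro mult_left_mono) auto
    finally show ?thesis by (simp add: mult_ac)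
  qed
  then have "summable (\<lambda>k. norm (psi_V lam FH FV (Suc k) z - 1))"
    by (intro summable_comparison_test[OF _ geo]) auto
  then show cp: "convergent_prod (\<lambda>k. psi_V lam FH FV (Suc k) z)"
    by (intro abs_convergent_prod_imp_convergent_prod summable_imp_abs_convergent_prod)
  have pV: "norm (psi_V lam FH FV (Suc k) z) \<le> 1" for k
    unfolding psi_V_Suc by (rule norm_arrivals_gf(2)[OF norm_psi_H(1)[OF z]])
  have "norm (series_term n z) \<le> r ^ n * (r * norm (1 - z))" for n
  proof -
    have "norm (\<Prod>k=1..Suc n. psi_V lam FH FV k z) \<le> 1"
      unfolding prod_norm[symmetric]
    proof (intro prod_le_1 conjI)
      show "norm (psi_V lam FH FV k z) \<le> 1" if "k \<in> {1..Suc n}" for k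
        using pV[of "k - 1"] that by simp
    qed simp
    then have "norm (series_term n z) \<le> norm (1 - psi_H lam FH (Suc n) z) * 1"
      unfolding norm_mult by (rule mult_left_mono) simp
    then show ?thesis using norm_psi_H(2)[OF z, of "Suc n"] by (simp add: r_def mult_ac)
  qed
  then show sm: "summable (\<lambda>n. series_term n z)"
    by (intro summable_comparison_test[OF _ geo]) auto
  have "(\<lambda>n. 1 - pgf stationary_law (psi_H lam FH n z)) \<longlonglongrightarrow> 0"
  proof (rule Lim_null_comparison)
    show "\<forall>\<^sub>F n in sequentially. norm (1 - pgf stationary_law (psi_H lam FH n z)) \<le> mean_waiting * (r ^ n * norm (1 - z))"
    proof (intro always_eventually allI)
      fix n
      have "norm (1 - pgf stationary_law (psi_H lam FH n z)) \<le> mean_waiting * norm (1 - psi_H lam FH n z)"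
        by (rule norm_pgf_stationary_diff[OF norm_psi_H(1)[OF z]])
      also have "\<dots> \<le> mean_waiting * (r ^ n * norm (1 - z))"
        unfolding r_def using norm_psi_H(2)[OF z] by (intro mult_left_mono) (auto simp: integral_nonneg_AE)
      finally show "norm (1 - pgf stationary_law (psi_H lam FH n z)) \<le> mean_waiting * (r ^ n * norm (1 - z))" .
    qed
    show "(\<lambda>n. mean_waiting * (r ^ n * norm (1 - z))) \<longlonglongrightarrow> 0"
      using r by (intro tendsto_mult_right_zero tendsto_mult_left_zero LIMSEQ_realpow_zero)
  qed
  then have g: "(\<lambda>n. pgf stationary_law (psi_H lam FH n z)) \<longlonglongrightarrow> 1"
    using tendsto_diff[OF tendsto_const[of 1]] by fastforce
  have P: "(\<lambda>n. \<Prod>k<n. psi_V lam FH FV (Suc k) z) \<longlonglongrightarrow> (\<Prod>k. psi_V lam FH FV (Suc k) z)"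
    using convergent_prod_LIMSEQ[OF cp] by (subst (asm) LIMSEQ_lessThan_iff_atMost[symmetric])
  have "(\<lambda>n. (\<Prod>k<n. psi_V lam FH FV (Suc k) z) * pgf stationary_law (psi_H lam FH n z)
      - pgf stationary_law 0 * (\<Sum>m<n. series_term m z))
    \<longlonglongrightarrow> (\<Prod>k. psi_V lam FH FV (Suc k) z) * 1
      - pgf stationary_law 0 * (\<Sum>n. series_term n z)"
    by (intro tendsto_intros P g summable_LIMSEQ sm)
  then show "pgf stationary_law z = (\<Prod>k. psi_V lam FH FV (Suc k) z)
      - pgf stationary_law 0 * (\<Sum>n. series_term n z)"
    unfolding pgf_stationary_iterate[OF z, symmetric] by (simp add: LIMSEQ_const_iff)
qed

text \<open>The maps \<open>arrivals_gf\<close> send \<open>[0, 1]\<close> into itself and the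
  iteration starts at 0. Hence all terms of the series in \<open>pgf_stationary_0\<close> are
  nonnegative, and its denominator is nonzero.\<close>

lemma psi_0_real:
  "\<exists>x\<in>{0..1}. psi_H lam FH n 0 = complex_of_real x" "\<exists>x\<in>{0..1}. psi_V lam FH FV (Suc n) 0 = complex_of_real x"
proof -
  have *: "\<exists>y\<in>{0..1}. arrivals_gf lam F (complex_of_real x) = complex_of_real y"
    if "x \<in> {0..1}" "F = FH \<or> F = FV" for x F
  proof -
    have "arrivals_gf lam F (complex_of_real x) = complex_of_real (\<integral>y. exp (- (lam - lam * x) * y) \<partial>F)"
      unfolding arrivals_gf_def using lst_of_real[of F "lam - lam * x"] by simp
    moreover have "norm (arrivals_gf lam F (complex_of_real x)) \<le> 1"
      using that norm_arrivals_gf(1,2)[of "complex_of_real x"] by auto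
    ultimately show ?thesis
      by (intro bexI[of _ "\<integral>y. exp (- (lam - lam * x) * y) \<partial>F"]) (auto simp: integral_nonneg_AE)
  qed
  show H: "\<exists>x\<in>{0..1}. psi_H lam FH n 0 = complex_of_real x" for n
  proof (induction n)
    case 0
    show ?case by (auto simp: psi_H_0 intro: bexI[of _ 0])
  next
    case (Suc n)
    then show ?case using * by (auto simp: psi_H_Suc)
  qed
  show "\<exists>x\<in>{0..1}. psi_V lam FH FV (Suc n) 0 = complex_of_real x"
    using H[of n] * by (auto simp: psi_V_Suc)
qed

theorem pgf_stationary_0:
  "pgf stationary_law 0 = (\<Prod>k. psi_V lam FH FV (Suc k) 0)
    / (1 + (\<Sum>n. (1 - psi_H lam FH (Suc n) 0) * (\<Prod>k=1..Suc n. psi_V lam FH FV k 0)))"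
proof -
  define t where "t n = (1 - psi_H lam FH (Suc n) 0) * (\<Prod>k=1..Suc n. psi_V lam FH FV k 0)" for n
  have "\<exists>x\<ge>0. t n = complex_of_real x" for n
  proof -
    have "\<exists>y\<ge>0. (\<Prod>k=1..m. psi_V lam FH FV k 0) = complex_of_real y" for m
    proof (induction m)
      case (Suc m)
      then obtain y where "0 \<le> y" "(\<Prod>k=1..m. psi_V lam FH FV k 0) = complex_of_real y" by auto
      moreover obtain x where "0 \<le> x" "psi_V lam FH FV (Suc m) 0 = complex_of_real x"
        using psi_0_real(2)[of m] by auto
      ultimately show ?case by (intro exI[of _ "y * x"]) simp
    qed (auto intro: exI[of _ 1])
    then obtain y where "0 \<le> y" "(\<Prod>k=1..Suc n. psi_V lam FH FV k 0) = complex_of_real y" by blast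
    moreover obtain x where "0 \<le> x" "x \<le> 1" "psi_H lam FH (Suc n) 0 = complex_of_real x"
      using psi_0_real(1)[of "Suc n"] by auto
    ultimately show ?thesis unfolding t_def by (intro exI[of _ "(1 - x) * y"]) simp
  qed
  then obtain x where x: "\<And>n. 0 \<le> x n" "t = (\<lambda>n. complex_of_real (x n))"
    unfolding fun_eq_iff by metis
  have smt: "summable t" using pgf_stationary_formula(2)[of 0] by (simp add: t_def[abs_def])
  then have "summable x" unfolding x(2) by (simp add: summable_complex_of_real)
  then have "suminf t = complex_of_real (suminf x)" "0 \<le> suminf x"
    using suminf_nonneg x(1) unfolding x(2) by (auto simp: suminf_of_real)
  then have "Re (1 + suminf t) \<noteq> 0" by simp
  then have nz: "1 + suminf t \<noteq> 0" by (metis zero_complex.simps(1))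
  have "pgf stationary_law 0 = (\<Prod>k. psi_V lam FH FV (Suc k) 0) - pgf stationary_law 0 * suminf t"
    using pgf_stationary_formula(3)[of 0] by (simp add: t_def[abs_def])
  then have "pgf stationary_law 0 * (1 + suminf t) = (\<Prod>k. psi_V lam FH FV (Suc k) 0)"
    by (simp add: algebra_simps)
  then show ?thesis unfolding t_def[symmetric] using nz by (simp add: field_simps)
qed

end

section \<open>The Markov property along sample paths\<close>

locale stable_queue = batch_queue M lam FH FV A H V
  for M :: "'a measure" and lam :: real and FH FV :: "real measure"
    and A :: "nat \<Rightarrow> 'a \<Rightarrow> real" and H :: "nat \<Rightarrow> nat \<Rightarrow> 'a \<Rightarrow> real" and V :: "nat \<Rightarrow> 'a \<Rightarrow> real" +
  assumes H_integrable: "integrable FH (\<lambda>h. h)" and V_integrable: "integrable FV (\<lambda>v. v)"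
    and service_mean_pos: "0 < mean FH + mean FV" and stable: "lam * mean FH < 1"
begin

lemma source_measurable [measurable]:
  "A n \<in> borel_measurable M" "H n i \<in> borel_measurable M" "V n \<in> borel_measurable M"
  using indep[unfolded indep_vars_def, THEN conjunct1, rule_format, of "Interarrival n"]
    indep[unfolded indep_vars_def, THEN conjunct1, rule_format, of "Individual n i"]
    indep[unfolded indep_vars_def, THEN conjunct1, rule_format, of "Common n"]
  by simp_all

sublocale service_laws lam FH FV
proof -
  have "real_distribution FH" "real_distribution FV"
    unfolding law_H[of 0 0, symmetric] law_V[of 0, symmetric]
    by (intro real_distribution_distr source_measurable)+
  then show "service_laws lam FH FV"
    unfolding service_laws_def service_laws_axioms_def poisson_arrivals_def
    using lam_pos H_nonneg V_nonneg H_integrable V_integrable service_mean_pos stable by simp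
qed

section \<open>The joint law of interarrival times and service data\<close>

definition block :: "nat \<Rightarrow> 'a \<Rightarrow> nat \<Rightarrow> real" where
  "block n x = case_nat (V n x) (\<lambda>i. H n i x)"

definition blocks_law :: "(nat \<Rightarrow> nat \<Rightarrow> real) measure" where
  "blocks_law = (\<Pi>\<^sub>M n\<in>UNIV. block_law)"

definition path_law :: "((nat \<Rightarrow> real) \<times> (nat \<Rightarrow> nat \<Rightarrow> real)) measure" where
  "path_law = gaps_law \<Otimes>\<^sub>M blocks_law"

abbreviation source_var :: "source \<Rightarrow> 'a \<Rightarrow> real" where
  "source_var \<equiv> \<lambda>s. case s of Interarrival n \<Rightarrow> A n | Individual n i \<Rightarrow> H n i | Common n \<Rightarrow> V n"

abbreviation block_source :: "nat \<Rightarrow> nat \<Rightarrow> source" where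
  "block_source n i \<equiv> (case i of 0 \<Rightarrow> Common n | Suc i \<Rightarrow> Individual n i)"

lemma space_blocks_law [simp]: "space blocks_law = UNIV"
  by (simp add: blocks_law_def space_PiM)

lemma space_path_law [simp]: "space path_law = UNIV"
  by (simp add: path_law_def space_pair_measure)

sublocale blocks: sequence_space block_law
  by (simp add: sequence_space_def product_prob_space_def product_sigma_finite_def
      product_prob_space_axioms_def B.sigma_finite_measure_axioms B.prob_space_axioms)

sublocale blocks_law: prob_space blocks_law
  unfolding blocks_law_def by (rule prob_space_PiM) (rule B.prob_space_axioms)

sublocale path: pair_prob_space gaps_law blocks_law ..

lemma measurable_block_law:
  "(\<And>i. (\<lambda>x. f x i) \<in> borel_measurable N) \<Longrightarrow> f \<in> measurable N block_law"
  by (simp cong: measurable_cong_sets add: sets_block_law)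
     (auto intro: measurable_PiM_single' simp: space_PiM)

lemma measurable_blocks_law:
  "(\<And>n. (\<lambda>x. f x n) \<in> measurable N block_law) \<Longrightarrow> f \<in> measurable N blocks_law"
  unfolding blocks_law_def by (auto intro: measurable_PiM_single' simp: space_PiM)

lemma block_measurable [measurable]: "block n \<in> measurable M block_law"
proof (rule measurable_block_law)
  show "(\<lambda>x. block n x i) \<in> borel_measurable M" for i
    unfolding block_def by (cases i) simp_all
qed

lemma indep_source: "indep_vars (\<lambda>_. borel) source_var UNIV"
  using indep .

lemma distr_A: "distr M borel (A n) = interarrival_law"
proof -
  have "distr M borel (A n) = distr M lborel (A n)" by (rule distr_cong) simp_all
  also have "\<dots> = interarrival_law"
    using law_A[of n] unfolding distributed_def interarrival_law_def by simp
  finally show ?thesis .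
qed

lemma distr_arrivals: "distr M gaps_law (\<lambda>x i. A i x) = gaps_law"
proof -
  have "indep_vars (\<lambda>i. Pi\<^sub>M {Interarrival i} (\<lambda>_. borel)) (\<lambda>i x. restrict (\<lambda>s. source_var s x) {Interarrival i}) UNIV"
    by (rule indep_vars_restrict[OF indep_source]) (auto simp: disjoint_family_on_def)
  then have "indep_vars (\<lambda>_. interarrival_law) (\<lambda>i x. restrict (\<lambda>s. source_var s x) {Interarrival i} (Interarrival i)) UNIV"
    by (rule indep_vars_compose2) (simp cong: measurable_cong_sets)
  then have "indep_vars (\<lambda>_. interarrival_law) A UNIV" by simp
  then have "distr M (\<Pi>\<^sub>M i\<in>UNIV. interarrival_law) (\<lambda>x. \<lambda>i\<in>UNIV. A i x) = (\<Pi>\<^sub>M i\<in>UNIV. distr M interarrival_law (A i))"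
    by (subst (asm) indep_vars_iff_distr_eq_PiM) (simp_all cong: measurable_cong_sets)
  moreover have "distr M interarrival_law (A i) = interarrival_law" for i
    using distr_A[of i] distr_cong[of M M interarrival_law borel "A i" "A i"] by simp
  ultimately show ?thesis by (simp add: gaps_law_def restrict_UNIV)
qed

lemma distr_block: "distr M block_law (block n) = block_law"
proof -
  have c: "block_source n i = block_source n j \<Longrightarrow> i = j" for i j
    by (cases i; cases j) auto
  have "indep_vars (\<lambda>i. Pi\<^sub>M {block_source n i} (\<lambda>_. borel)) (\<lambda>i x. restrict (\<lambda>s. source_var s x) {block_source n i}) UNIV"
    by (rule indep_vars_restrict[OF indep_source]) (auto simp: disjoint_family_on_def dest: c)
  then have "indep_vars component_law (\<lambda>i x. restrict (\<lambda>s. source_var s x) {block_source n i} (block_source n i)) UNIV"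
    by (rule indep_vars_compose2) (simp cong: measurable_cong_sets)
  moreover have "(\<lambda>i x. restrict (\<lambda>s. source_var s x) {block_source n i} (block_source n i)) = (\<lambda>i x. block n x i)"
    by (auto simp: block_def fun_eq_iff split: nat.split)
  ultimately have "indep_vars component_law (\<lambda>i x. block n x i) UNIV" by (simp only:)
  moreover have m: "(\<lambda>x. block n x i) \<in> borel_measurable M" for i
    unfolding block_def by (cases i) simp_all
  ultimately have "distr M (Pi\<^sub>M UNIV component_law) (\<lambda>x. \<lambda>i\<in>UNIV. block n x i) = (\<Pi>\<^sub>M i\<in>UNIV. distr M (component_law i) (\<lambda>x. block n x i))"
    by (subst (asm) indep_vars_iff_distr_eq_PiM) (simp_all cong: measurable_cong_sets)
  moreover have "distr M (component_law i) (\<lambda>x. block n x i) = component_law i" for i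
  proof -
    have "distr M (component_law i) (\<lambda>x. block n x i) = distr M borel (\<lambda>x. block n x i)"
      by (rule distr_cong) simp_all
    also have "\<dots> = component_law i"
      by (cases i) (simp_all add: block_def component_law_def law_H law_V)
    finally show ?thesis .
  qed
  ultimately show ?thesis by (simp add: block_law_def restrict_UNIV)
qed

lemma distr_blocks: "distr M blocks_law (\<lambda>x n. block n x) = blocks_law"
proof -
  define S where "S n = range (block_source n)" for n
  have "indep_vars (\<lambda>n. Pi\<^sub>M (S n) (\<lambda>_. borel)) (\<lambda>n x. restrict (\<lambda>s. source_var s x) (S n)) UNIV"
    by (rule indep_vars_restrict[OF indep_source]) (auto simp: disjoint_family_on_def S_def split: nat.splits)
  then have "indep_vars (\<lambda>_. block_law) (\<lambda>n x i. restrict (\<lambda>s. source_var s x) (S n) (block_source n i)) UNIV"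
  proof (rule indep_vars_compose2)
    show "(\<lambda>f i. f (block_source n i)) \<in> measurable (Pi\<^sub>M (S n) (\<lambda>_. borel)) block_law" for n
      by (rule measurable_block_law, rule measurable_component_singleton) (simp add: S_def)
  qed
  moreover have "(\<lambda>n x i. restrict (\<lambda>s. source_var s x) (S n) (block_source n i)) = block"
    by (auto simp: block_def fun_eq_iff S_def split: nat.split)
  ultimately have "indep_vars (\<lambda>_. block_law) block UNIV" by (simp only:)
  then have "distr M (\<Pi>\<^sub>M n\<in>UNIV. block_law) (\<lambda>x. \<lambda>n\<in>UNIV. block n x) = (\<Pi>\<^sub>M n\<in>UNIV. distr M block_law (block n))"
    by (subst (asm) indep_vars_iff_distr_eq_PiM) simp_all
  then show ?thesis by (simp add: distr_block blocks_law_def restrict_UNIV)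
qed

lemma arrivals_measurable [measurable]: "(\<lambda>x i. A i x) \<in> measurable M gaps_law"
  by (rule measurable_gaps_law) simp

lemma blocks_measurable [measurable]: "(\<lambda>x n. block n x) \<in> measurable M blocks_law"
  by (rule measurable_blocks_law) simp

text \<open>\<open>indep_var\<close> relates variables of equal type only, so the arrival sequence is first repeated
  in every row of a matrix.\<close>

lemma distr_path: "distr M path_law (\<lambda>x. (\<lambda>i. A i x, \<lambda>n. block n x)) = path_law"
proof -
  define SA where "SA = range Interarrival"
  define SB where "SB = - SA"
  define R where "R = (\<Pi>\<^sub>M n\<in>(UNIV :: nat set). gaps_law)"
  let ?a = "\<lambda>x (n::nat) i. A i x" and ?b = "\<lambda>x n. block n x"
  have "indep_var (Pi\<^sub>M SA (\<lambda>_. borel)) (\<lambda>x. restrict (\<lambda>s. source_var s x) SA)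
      (Pi\<^sub>M SB (\<lambda>_. borel)) (\<lambda>x. restrict (\<lambda>s. source_var s x) SB)"
    by (rule indep_var_restrict[OF indep_source]) (auto simp: SB_def)
  moreover have "(\<lambda>f n i. f (Interarrival i)) \<in> measurable (Pi\<^sub>M SA (\<lambda>_. borel)) R"
  proof -
    have "(\<lambda>f i. f (Interarrival i)) \<in> measurable (Pi\<^sub>M SA (\<lambda>_. borel)) gaps_law"
      by (rule measurable_gaps_law, rule measurable_component_singleton) (simp add: SA_def)
    then show ?thesis unfolding R_def by (auto intro: measurable_PiM_single' simp: space_PiM)
  qed
  moreover have "(\<lambda>f n i. f (block_source n i)) \<in> measurable (Pi\<^sub>M SB (\<lambda>_. borel)) blocks_law"
    by (rule measurable_blocks_law, rule measurable_block_law, rule measurable_component_singleton)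
       (auto simp: SA_def SB_def split: nat.splits)
  ultimately have "indep_var R ((\<lambda>f n i. f (Interarrival i)) \<circ> (\<lambda>x. restrict (\<lambda>s. source_var s x) SA))
      blocks_law ((\<lambda>f n i. f (block_source n i)) \<circ> (\<lambda>x. restrict (\<lambda>s. source_var s x) SB))"
    by (rule indep_var_compose)
  moreover have "(\<lambda>f n i. f (Interarrival i)) \<circ> (\<lambda>x. restrict (\<lambda>s. source_var s x) SA) = ?a"
    by (auto simp: SA_def fun_eq_iff)
  moreover have "(\<lambda>f n i. f (block_source n i)) \<circ> (\<lambda>x. restrict (\<lambda>s. source_var s x) SB) = ?b"
    by (auto simp: SA_def SB_def fun_eq_iff block_def split: nat.splits)
  ultimately have "indep_var R ?a blocks_law ?b" by (simp only:)
  then have a: "?a \<in> measurable M R" and joint: "distr M R ?a \<Otimes>\<^sub>M blocks_law = distr M (R \<Otimes>\<^sub>M blocks_law) (\<lambda>x. (?a x, ?b x))"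
    unfolding indep_var_distribution_eq by (simp_all add: distr_blocks)
  have z: "(\<lambda>p. p 0) \<in> measurable R gaps_law" unfolding R_def by measurable
  have "gaps_law = distr (distr M R ?a) gaps_law (\<lambda>p. p 0)"
    by (subst distr_distr[OF z a]) (simp add: comp_def distr_arrivals)
  then have "path_law = distr (distr M R ?a) gaps_law (\<lambda>p. p 0) \<Otimes>\<^sub>M distr blocks_law blocks_law (\<lambda>q. q)"
    by (simp add: path_law_def)
  also have "\<dots> = distr (distr M R ?a \<Otimes>\<^sub>M blocks_law) (gaps_law \<Otimes>\<^sub>M blocks_law) (\<lambda>(p, q). (p 0, q))"
    by (rule pair_measure_distr)
       (use z blocks_law.sigma_finite_measure_axioms in simp_all)
  also have "\<dots> = distr M path_law (\<lambda>x. (\<lambda>i. A i x, \<lambda>n. block n x))"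
  proof -
    have "(\<lambda>(p, q). (p 0, q)) \<in> measurable (R \<Otimes>\<^sub>M blocks_law) (gaps_law \<Otimes>\<^sub>M blocks_law)"
      using measurable_Pair[OF measurable_compose[OF measurable_fst z] measurable_snd]
      by (simp add: case_prod_unfold)
    moreover have "(\<lambda>x. (?a x, ?b x)) \<in> measurable M (R \<Otimes>\<^sub>M blocks_law)"
      using a by simp
    ultimately show ?thesis
      unfolding joint by (subst distr_distr) (simp_all add: comp_def path_law_def)
  qed
  finally show ?thesis ..
qed

text \<open>The state of the system when the service of batch \<open>n\<close> starts: the first customer and the
  number of waiting customers at the end of the previous service, the residual interarrival times
  as seen from the start of the service, and the service data of the batches from \<open>n\<close> on.\<close>

definition first_customer :: "nat \<Rightarrow> 'a \<Rightarrow> nat" where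
  "first_customer n x = fst (epoch A H V n x)"

definition epoch_time :: "nat \<Rightarrow> 'a \<Rightarrow> real" where
  "epoch_time n x = snd (epoch A H V n x)"

definition queue_length :: "nat \<Rightarrow> 'a \<Rightarrow> nat" where
  "queue_length n x = waiting A (first_customer n x) (epoch_time n x) x"

definition start_time :: "nat \<Rightarrow> 'a \<Rightarrow> real" where
  "start_time n x = (if queue_length n x = 0 then arrival_time A (first_customer n x) x else epoch_time n x)"

text \<open>The sequence begins with the first customer after batch \<open>n\<close>, since the
  members of batch \<open>n\<close> have all arrived by the start of its service. Only the first gap
  is cut at the start time.\<close>

definition arrivals_from :: "nat \<Rightarrow> 'a \<Rightarrow> nat \<Rightarrow> real" where
  "arrivals_from n x = case_nat (arrival_time A (first_customer (Suc n) x) x - start_time n x)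
     (\<lambda>i. A (Suc (first_customer (Suc n) x + i)) x)"

definition path_from :: "nat \<Rightarrow> 'a \<Rightarrow> (nat \<Rightarrow> real) \<times> (nat \<Rightarrow> nat \<Rightarrow> real)" where
  "path_from n x = (arrivals_from n x, \<lambda>k. block (n + k) x)"

definition arrivals_in :: "nat \<Rightarrow> (nat \<Rightarrow> real) \<times> (nat \<Rightarrow> nat \<Rightarrow> real) \<Rightarrow> nat" where
  "arrivals_in w \<xi> = arrivals_upto (fst \<xi>) (service (max w 1) (snd \<xi> 0))"

definition next_path :: "nat \<Rightarrow> (nat \<Rightarrow> real) \<times> (nat \<Rightarrow> nat \<Rightarrow> real) \<Rightarrow> (nat \<Rightarrow> real) \<times> (nat \<Rightarrow> nat \<Rightarrow> real)" where
  "next_path w \<xi> = (next_arrivals (arrivals_in w \<xi>) (fst \<xi>) (service (max w 1) (snd \<xi> 0)), \<lambda>k. snd \<xi> (Suc k))"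

lemma service_block: "service m (block n x) = (\<Sum>i<m. H n i x) + V n x"
  unfolding service_def by (subst sum.atMost_shift) (simp add: block_def)

lemma first_customer_Suc: "first_customer (Suc n) x = first_customer n x + max (queue_length n x) 1"
  by (simp add: first_customer_def queue_length_def epoch_time_def split_beta Let_def)

lemma epoch_time_Suc: "epoch_time (Suc n) x = start_time n x + service (max (queue_length n x) 1) (block n x)"
  by (simp add: first_customer_def queue_length_def epoch_time_def start_time_def split_beta Let_def service_block add.assoc)

lemma sum_arrivals_from:
  "(\<Sum>i\<le>l. arrivals_from n x i) = arrival_time A (first_customer (Suc n) x + l) x - start_time n x"
  by (induction l) (simp_all add: arrivals_from_def arrival_time_def)

text \<open>Shifting indices by the first customer of the next batch, and time by the start of the
  current service, expresses the next queue length through the current one and the path from here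
  on.\<close>

lemma queue_length_Suc: "queue_length (Suc n) x = arrivals_in (queue_length n x) (path_from n x)"
proof -
  have "{j. first_customer (Suc n) x \<le> j \<and> arrival_time A j x \<le> epoch_time (Suc n) x} =
      (+) (first_customer (Suc n) x) ` {l. (\<Sum>i\<le>l. arrivals_from n x i) \<le> service (max (queue_length n x) 1) (block n x)}"
  proof (intro set_eqI iffI)
    fix j assume "j \<in> {j. first_customer (Suc n) x \<le> j \<and> arrival_time A j x \<le> epoch_time (Suc n) x}"
    then show "j \<in> (+) (first_customer (Suc n) x) ` {l. (\<Sum>i\<le>l. arrivals_from n x i) \<le> service (max (queue_length n x) 1) (block n x)}"
      unfolding sum_arrivals_from epoch_time_Suc
      by (intro image_eqI[of _ _ "j - first_customer (Suc n) x"]) (auto simp: algebra_simps)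
  next
    fix j assume "j \<in> (+) (first_customer (Suc n) x) ` {l. (\<Sum>i\<le>l. arrivals_from n x i) \<le> service (max (queue_length n x) 1) (block n x)}"
    then show "j \<in> {j. first_customer (Suc n) x \<le> j \<and> arrival_time A j x \<le> epoch_time (Suc n) x}"
      unfolding sum_arrivals_from epoch_time_Suc by auto
  qed
  then show ?thesis
    by (simp add: queue_length_def[of "Suc n"] waiting_def arrivals_in_def path_from_def arrivals_upto_def card_image)
qed

lemma path_from_Suc: "path_from (Suc n) x = next_path (queue_length n x) (path_from n x)"
proof -
  have "arrivals_from (Suc n) x = next_arrivals (queue_length (Suc n) x) (arrivals_from n x)
      (service (max (queue_length n x) 1) (block n x))"
  proof
    fix i
    show "arrivals_from (Suc n) x i = next_arrivals (queue_length (Suc n) x) (arrivals_from n x)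
      (service (max (queue_length n x) 1) (block n x)) i"
    proof (cases "queue_length (Suc n) x = 0")
      case True
      have c: "first_customer (Suc (Suc n)) x = Suc (first_customer (Suc n) x)"
        using True by (simp add: first_customer_Suc[of "Suc n"])
      show ?thesis
        using True c by (cases i; simp add: arrivals_from_def next_arrivals_def start_time_def arrival_time_def)
    next
      case False
      have "first_customer (Suc (Suc n)) x = first_customer (Suc n) x + queue_length (Suc n) x"
        using False by (simp add: first_customer_Suc[of "Suc n"])
      moreover have "start_time (Suc n) x = start_time n x + service (max (queue_length n x) 1) (block n x)"
        using False by (simp add: start_time_def[of "Suc n"] epoch_time_Suc)
      ultimately show ?thesis
        using False unfolding next_arrivals_def residual_def sum_arrivals_from
        by (cases i; simp add: arrivals_from_def add.assoc)
    qed
  qed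
  then show ?thesis
    by (simp add: path_from_def[of "Suc n"] next_path_def queue_length_Suc[symmetric]) (simp add: path_from_def)
qed

section \<open>The Markov property at the starts of services\<close>

primrec state_law :: "nat \<Rightarrow> (nat \<times> nat) pmf" where
  "state_law 0 = return_pmf (0, 0)"
| "state_law (Suc n) = bind_pmf (state_law n) (\<lambda>(c, w). map_pmf (\<lambda>w'. (c + max w 1, w')) (kernel w))"

lemma path_law_iterate:
  assumes [measurable]: "F \<in> borel_measurable path_law"
  shows "(\<integral>\<^sup>+\<xi>. F \<xi> \<partial>path_law) = (\<integral>\<^sup>+r. (\<integral>\<^sup>+\<xi>. F (fst \<xi>, case_nat r (snd \<xi>)) \<partial>path_law) \<partial>block_law)"
    and "(\<integral>\<^sup>+\<xi>. F \<xi> \<partial>path_law) = (\<integral>\<^sup>+R. (\<integral>\<^sup>+X. F (X, R) \<partial>gaps_law) \<partial>blocks_law)"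
proof -
  have mF [measurable]: "F \<in> borel_measurable (gaps_law \<Otimes>\<^sub>M blocks_law)" using assms by (simp add: path_law_def)
  have 2: "(\<integral>\<^sup>+\<xi>. F \<xi> \<partial>path_law) = (\<integral>\<^sup>+R. (\<integral>\<^sup>+X. F (X, R) \<partial>gaps_law) \<partial>blocks_law)"
    if "F \<in> borel_measurable (gaps_law \<Otimes>\<^sub>M blocks_law)" for F
    unfolding path_law_def using path.nn_integral_snd[OF that] by simp
  have cn: "(\<lambda>(r, R). case_nat r R) \<in> measurable (block_law \<Otimes>\<^sub>M blocks_law) blocks_law"
    unfolding blocks_law_def by measurable
  have iter: "distr (block_law \<Otimes>\<^sub>M blocks_law) blocks_law (\<lambda>(r, R). case_nat r R) = blocks_law"
    using blocks.PiM_iter by (simp add: blocks_law_def)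
  show "(\<integral>\<^sup>+\<xi>. F \<xi> \<partial>path_law) = (\<integral>\<^sup>+R. (\<integral>\<^sup>+X. F (X, R) \<partial>gaps_law) \<partial>blocks_law)"
    by (rule 2[OF mF])
  define g where "g R = (\<integral>\<^sup>+X. F (X, R) \<partial>gaps_law)" for R
  have [measurable]: "g \<in> borel_measurable blocks_law" unfolding g_def[abs_def] by measurable
  have "(\<integral>\<^sup>+R. g R \<partial>blocks_law) = (\<integral>\<^sup>+p. g (case_nat (fst p) (snd p)) \<partial>(block_law \<Otimes>\<^sub>M blocks_law))"
    by (subst iter[symmetric], subst nn_integral_distr[OF cn]) (simp_all add: case_prod_unfold)
  also have "\<dots> = (\<integral>\<^sup>+r. (\<integral>\<^sup>+R. g (case_nat r R) \<partial>blocks_law) \<partial>block_law)"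
    using measurable_compose[OF cn \<open>g \<in> borel_measurable blocks_law\<close>]
    by (subst blocks_law.nn_integral_fst[symmetric]) (simp_all add: case_prod_unfold)
  also have "\<dots> = (\<integral>\<^sup>+r. (\<integral>\<^sup>+\<xi>. F (fst \<xi>, case_nat r (snd \<xi>)) \<partial>path_law) \<partial>block_law)"
  proof (rule nn_integral_cong)
    fix r
    have cr: "case_nat r \<in> measurable blocks_law blocks_law"
      using measurable_compose[OF measurable_Pair1' cn, of r] by simp
    have "(\<lambda>p. (fst p, case_nat r (snd p))) \<in> measurable (gaps_law \<Otimes>\<^sub>M blocks_law) (gaps_law \<Otimes>\<^sub>M blocks_law)"
      by (intro measurable_Pair measurable_fst measurable_compose[OF measurable_snd cr])
    from measurable_compose[OF this mF]
    show "(\<integral>\<^sup>+R. g (case_nat r R) \<partial>blocks_law) = (\<integral>\<^sup>+\<xi>. F (fst \<xi>, case_nat r (snd \<xi>)) \<partial>path_law)"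
      by (subst 2) (simp_all add: g_def)
  qed
  finally show "(\<integral>\<^sup>+\<xi>. F \<xi> \<partial>path_law) = (\<integral>\<^sup>+r. (\<integral>\<^sup>+\<xi>. F (fst \<xi>, case_nat r (snd \<xi>)) \<partial>path_law) \<partial>block_law)"
    by (simp add: 2[OF mF] g_def)
qed

lemma fst_snd_path [measurable]:
  "fst \<in> measurable path_law gaps_law" "(\<lambda>\<xi>. snd \<xi> n) \<in> measurable path_law block_law"
  "(\<lambda>\<xi> k. snd \<xi> (Suc k)) \<in> measurable path_law blocks_law"
proof -
  have c: "(\<lambda>\<xi>. snd \<xi> n) \<in> measurable path_law block_law" for n
    unfolding path_law_def blocks_law_def by measurable
  then show "(\<lambda>\<xi>. snd \<xi> n) \<in> measurable path_law block_law" .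
  show "fst \<in> measurable path_law gaps_law" unfolding path_law_def by measurable
  show "(\<lambda>\<xi> k. snd \<xi> (Suc k)) \<in> measurable path_law blocks_law"
    by (rule measurable_blocks_law) (rule c)
qed

lemma service_snd_measurable [measurable]: "(\<lambda>\<xi>. service m (snd \<xi> n)) \<in> borel_measurable path_law"
  by (rule measurable_compose[OF fst_snd_path(2) service_measurable])

lemma arrivals_in_measurable [measurable]: "arrivals_in w \<in> measurable path_law (count_space UNIV)"
  unfolding arrivals_in_def[abs_def] by (rule arrivals_upto_measurable) simp_all

lemma next_path_const_measurable:
  "(\<lambda>\<xi>. (next_arrivals w' (fst \<xi>) (service m (snd \<xi> 0)), \<lambda>k. snd \<xi> (Suc k))) \<in> measurable path_law path_law"
proof -
  have "(\<lambda>\<xi>. (next_arrivals w' (fst \<xi>) (service m (snd \<xi> 0)), \<lambda>k. snd \<xi> (Suc k))) \<in> measurable path_law (gaps_law \<Otimes>\<^sub>M blocks_law)"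
    by (intro measurable_Pair next_arrivals_measurable) simp_all
  then show ?thesis by (simp add: path_law_def)
qed

lemma cons_path_measurable: "(\<lambda>\<xi>. (fst \<xi>, case_nat r (snd \<xi>))) \<in> measurable path_law path_law"
proof -
  have "(\<lambda>\<xi>. case_nat r (snd \<xi>)) \<in> measurable path_law blocks_law"
  proof (rule measurable_blocks_law)
    show "(\<lambda>\<xi>. case_nat r (snd \<xi>) n) \<in> measurable path_law block_law" for n
      by (cases n) (simp_all add: fst_snd_path(2))
  qed
  then have "(\<lambda>\<xi>. (fst \<xi>, case_nat r (snd \<xi>))) \<in> measurable path_law (gaps_law \<Otimes>\<^sub>M blocks_law)"
    by (intro measurable_Pair fst_snd_path(1))
  then show ?thesis by (simp add: path_law_def)
qed

lemma step_measurable: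
  assumes "\<And>w'. \<Psi> w' \<in> borel_measurable path_law"
  shows "(\<lambda>\<xi>. \<Psi> (arrivals_in w \<xi>) (next_path w \<xi>)) \<in> borel_measurable path_law"
  unfolding next_path_def
  by (rule measurable_compose_countable[OF _ arrivals_in_measurable])
     (rule measurable_compose[OF next_path_const_measurable assms])

text \<open>After a service started with \<open>w\<close> customers waiting, the system starts afresh, independently
  of the number of customers left behind.\<close>

lemma nn_integral_step:
  assumes \<Psi>: "\<And>w'. \<Psi> w' \<in> borel_measurable path_law"
  shows "(\<integral>\<^sup>+\<xi>. \<Psi> (arrivals_in w \<xi>) (next_path w \<xi>) \<partial>path_law) =
    (\<integral>\<^sup>+w'. (\<integral>\<^sup>+\<xi>. \<Psi> w' \<xi> \<partial>path_law) \<partial>kernel w)"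
proof -
  define F where "F \<xi> = \<Psi> (arrivals_in w \<xi>) (next_path w \<xi>)" for \<xi>
  have F: "F \<in> borel_measurable path_law"
    unfolding F_def[abs_def] by (rule step_measurable[OF \<Psi>])
  have "(\<integral>\<^sup>+\<xi>. F \<xi> \<partial>path_law) = (\<integral>\<^sup>+r. (\<integral>\<^sup>+\<xi>. F (fst \<xi>, case_nat r (snd \<xi>)) \<partial>path_law) \<partial>block_law)"
    by (rule path_law_iterate(1)[OF F])
  also have "\<dots> = (\<integral>\<^sup>+r. (\<Sum>w'. ennreal (poisson_weight (lam * service (max w 1) r) w') * (\<integral>\<^sup>+\<xi>. \<Psi> w' \<xi> \<partial>path_law)) \<partial>block_law)"
  proof (rule nn_integral_cong_AE)
    show "AE r in block_law. (\<integral>\<^sup>+\<xi>. F (fst \<xi>, case_nat r (snd \<xi>)) \<partial>path_law) =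
      (\<Sum>w'. ennreal (poisson_weight (lam * service (max w 1) r) w') * (\<integral>\<^sup>+\<xi>. \<Psi> w' \<xi> \<partial>path_law))"
      using AE_service_nonneg[of "max w 1"]
    proof eventually_elim
      case (elim r)
      let ?S = "service (max w 1) r"
      have Fr: "F (X, case_nat r R) = \<Psi> (arrivals_upto X ?S) (next_arrivals (arrivals_upto X ?S) X ?S, R)" for X R
        by (simp add: F_def arrivals_in_def next_path_def)
      have m: "(\<lambda>X. \<Psi> w' (X, R)) \<in> borel_measurable gaps_law" for w' R
        using measurable_compose[OF measurable_Pair2' \<Psi>[of w', unfolded path_law_def], of R] by simp
      have J: "(\<lambda>R. \<integral>\<^sup>+X. \<Psi> w' (X, R) \<partial>gaps_law) \<in> borel_measurable blocks_law" for w'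
        using \<Psi>[of w', unfolded path_law_def] by measurable
      have mF: "(\<lambda>\<xi>. F (fst \<xi>, case_nat r (snd \<xi>))) \<in> borel_measurable path_law"
        by (rule measurable_compose[OF cons_path_measurable F])
      have "(\<integral>\<^sup>+\<xi>. F (fst \<xi>, case_nat r (snd \<xi>)) \<partial>path_law) = (\<integral>\<^sup>+R. (\<integral>\<^sup>+X. F (X, case_nat r R) \<partial>gaps_law) \<partial>blocks_law)"
        using path_law_iterate(2)[OF mF] by simp
      also have "\<dots> = (\<integral>\<^sup>+R. (\<Sum>w'. ennreal (poisson_weight (lam * ?S) w') * (\<integral>\<^sup>+X. \<Psi> w' (X, R) \<partial>gaps_law)) \<partial>blocks_law)"
        unfolding Fr
        by (intro nn_integral_cong nn_integral_next_arrivals[of "\<lambda>w' X. \<Psi> w' (X, R)" "?S" for R] m elim)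
      also have "\<dots> = (\<Sum>w'. ennreal (poisson_weight (lam * ?S) w') * (\<integral>\<^sup>+R. (\<integral>\<^sup>+X. \<Psi> w' (X, R) \<partial>gaps_law) \<partial>blocks_law))"
        using J by (subst nn_integral_suminf) (simp_all add: nn_integral_cmult)
      also have "\<dots> = (\<Sum>w'. ennreal (poisson_weight (lam * ?S) w') * (\<integral>\<^sup>+\<xi>. \<Psi> w' \<xi> \<partial>path_law))"
        by (simp add: path_law_iterate(2)[OF \<Psi>])
      finally show ?case .
    qed
  qed
  also have "\<dots> = (\<integral>\<^sup>+w'. (\<integral>\<^sup>+\<xi>. \<Psi> w' \<xi> \<partial>path_law) \<partial>kernel w)"
    by (simp add: kernel_def nn_integral_arrivals_law)
  finally show ?thesis by (simp add: F_def)
qed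

lemma AE_arrivals_pos: "AE x in M. \<forall>i. 0 < A i x"
proof -
  have "AE y in interarrival_law. 0 < y"
  proof -
    have "AE y in lborel. y \<noteq> (0::real)" by (rule AE_lborel_singleton)
    then show ?thesis
      unfolding interarrival_law_def by (subst AE_density) (auto simp: exponential_density_def elim: eventually_mono)
  qed
  then have "AE x in M. 0 < A i x" for i
    unfolding distr_A[of i, symmetric] by (subst (asm) AE_distr_iff) simp_all
  then show ?thesis by (simp add: AE_all_countable)
qed

text \<open>An arrival at time 0 itself would count as waiting, hence the strict positivity, which
  holds almost surely.\<close>

lemma queue_length_0:
  assumes "\<forall>i. 0 < A i x"
  shows "queue_length 0 x = 0"
proof -
  have "0 < arrival_time A j x" for j
    unfolding arrival_time_def by (rule sum_pos) (use assms in auto)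
  then have "{j. first_customer 0 x \<le> j \<and> arrival_time A j x \<le> epoch_time 0 x} = {}"
    by (auto simp: epoch_time_def not_le)
  then show ?thesis by (simp only: queue_length_def waiting_def card.empty)
qed

text \<open>The path from the start of service \<open>n\<close> is a fresh copy of
  \<open>path_law\<close>, independent of the state. Initially the first gap is used up by the idle
  period before customer 0, and the shifted gaps have the same law; each later step is
  \<open>nn_integral_step\<close>.\<close>

theorem nn_integral_state:
  assumes "\<And>cw. \<Phi> cw \<in> borel_measurable path_law"
  shows "(\<integral>\<^sup>+x. \<Phi> (first_customer n x, queue_length n x) (path_from n x) \<partial>M) =
    (\<integral>\<^sup>+cw. (\<integral>\<^sup>+\<xi>. \<Phi> cw \<xi> \<partial>path_law) \<partial>state_law n)"
  using assms
proof (induction n arbitrary: \<Phi>)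
  case 0
  have sh: "(\<lambda>\<xi>. (\<lambda>i. fst \<xi> (Suc i), snd \<xi>)) \<in> measurable path_law path_law"
    unfolding path_law_def by (intro measurable_Pair measurable_snd shift_gaps_law(1) measurable_fst)
  note m = measurable_compose[OF sh 0[of "(0, 0)"]]
  have "(\<integral>\<^sup>+x. \<Phi> (first_customer 0 x, queue_length 0 x) (path_from 0 x) \<partial>M) =
      (\<integral>\<^sup>+x. \<Phi> (0, 0) (\<lambda>i. A (Suc i) x, \<lambda>n. block n x) \<partial>M)"
  proof (rule nn_integral_cong_AE)
    show "AE x in M. \<Phi> (first_customer 0 x, queue_length 0 x) (path_from 0 x) =
      \<Phi> (0, 0) (\<lambda>i. A (Suc i) x, \<lambda>n. block n x)"
      using AE_arrivals_pos
    proof eventually_elim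
      case (elim x)
      have q: "queue_length 0 x = 0" by (rule queue_length_0[OF elim])
      have c0: "first_customer 0 x = 0" by (simp add: first_customer_def)
      have c1: "first_customer (Suc 0) x = 1" using q c0 by (simp add: first_customer_Suc)
      have "arrivals_from 0 x i = A (Suc i) x" for i
        by (cases i) (simp_all add: arrivals_from_def c1 c0 q start_time_def arrival_time_def)
      then have "arrivals_from 0 x = (\<lambda>i. A (Suc i) x)" by auto
      then show ?case by (simp add: q c0 path_from_def)
    qed
  qed
  also have "\<dots> = (\<integral>\<^sup>+\<xi>. \<Phi> (0, 0) (\<lambda>i. fst \<xi> (Suc i), snd \<xi>) \<partial>distr M path_law (\<lambda>x. (\<lambda>i. A i x, \<lambda>n. block n x)))"
    by (subst nn_integral_distr) (use m in \<open>simp_all add: path_law_def\<close>)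
  also have "\<dots> = (\<integral>\<^sup>+R. (\<integral>\<^sup>+X. \<Phi> (0, 0) (\<lambda>i. X (Suc i), R) \<partial>gaps_law) \<partial>blocks_law)"
    unfolding distr_path using path_law_iterate(2)[OF m] by simp
  also have "\<dots> = (\<integral>\<^sup>+R. (\<integral>\<^sup>+X. \<Phi> (0, 0) (X, R) \<partial>gaps_law) \<partial>blocks_law)"
  proof (rule nn_integral_cong)
    fix R
    have "(\<lambda>X. \<Phi> (0, 0) (X, R)) \<in> borel_measurable gaps_law"
      using measurable_compose[OF measurable_Pair2' 0[of "(0, 0)", unfolded path_law_def], of R] by simp
    from nn_integral_gaps_law_shift[OF this]
    show "(\<integral>\<^sup>+X. \<Phi> (0, 0) (\<lambda>i. X (Suc i), R) \<partial>gaps_law) = (\<integral>\<^sup>+X. \<Phi> (0, 0) (X, R) \<partial>gaps_law)" .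
  qed
  also have "\<dots> = (\<integral>\<^sup>+\<xi>. \<Phi> (0, 0) \<xi> \<partial>path_law)"
    by (rule path_law_iterate(2)[symmetric, OF 0])
  finally show ?case by simp
next
  case (Suc n)
  define \<Phi>' where "\<Phi>' cw \<xi> = \<Phi> (fst cw + max (snd cw) 1, arrivals_in (snd cw) \<xi>) (next_path (snd cw) \<xi>)" for cw \<xi>
  have m: "\<Phi>' cw \<in> borel_measurable path_law" for cw
    unfolding \<Phi>'_def[abs_def] by (rule step_measurable[of "\<lambda>w'. \<Phi> (fst cw + max (snd cw) 1, w')"]) (rule Suc.prems)
  have "(\<integral>\<^sup>+x. \<Phi> (first_customer (Suc n) x, queue_length (Suc n) x) (path_from (Suc n) x) \<partial>M) =
      (\<integral>\<^sup>+x. \<Phi>' (first_customer n x, queue_length n x) (path_from n x) \<partial>M)"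
    by (simp add: \<Phi>'_def first_customer_Suc queue_length_Suc path_from_Suc)
  also have "\<dots> = (\<integral>\<^sup>+cw. (\<integral>\<^sup>+\<xi>. \<Phi>' cw \<xi> \<partial>path_law) \<partial>state_law n)"
    by (rule Suc.IH[OF m])
  also have "\<dots> = (\<integral>\<^sup>+cw. (\<integral>\<^sup>+w'. (\<integral>\<^sup>+\<xi>. \<Phi> (fst cw + max (snd cw) 1, w') \<xi> \<partial>path_law) \<partial>kernel (snd cw)) \<partial>state_law n)"
    unfolding \<Phi>'_def
    by (intro nn_integral_cong nn_integral_step[of "\<lambda>w'. \<Phi> (fst cw + max (snd cw) 1, w')" for cw]) (rule Suc.prems)
  also have "\<dots> = (\<integral>\<^sup>+cw. (\<integral>\<^sup>+\<xi>. \<Phi> cw \<xi> \<partial>path_law) \<partial>state_law (Suc n))"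
    by (simp add: case_prod_unfold)
  finally show ?case .
qed

lemma snd_state_law: "map_pmf snd (state_law n) = waiting_law n"
proof (induction n)
  case (Suc n)
  have "map_pmf snd (state_law (Suc n)) = bind_pmf (state_law n) (\<lambda>cw. kernel (snd cw))"
    by (simp add: map_bind_pmf case_prod_unfold map_pmf_comp)
  also have "\<dots> = bind_pmf (map_pmf snd (state_law n)) kernel"
    by (simp add: bind_map_pmf)
  finally show ?case by (simp add: Suc)
qed simp

lemma path_law_prob: "emeasure path_law UNIV = 1"
  using path.P.emeasure_space_1 by (simp add: path_law_def space_pair_measure)

lemma nn_integral_queue_length:
  "(\<integral>\<^sup>+x. f (queue_length n x) \<partial>M) = (\<integral>\<^sup>+w. f w \<partial>waiting_law n)"
proof -
  have "(\<integral>\<^sup>+x. f (queue_length n x) \<partial>M) = (\<integral>\<^sup>+cw. f (snd cw) \<partial>state_law n)"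
    using nn_integral_state[of "\<lambda>cw _. f (snd cw)" n] path_law_prob by simp
  also have "\<dots> = (\<integral>\<^sup>+w. f w \<partial>map_pmf snd (state_law n))" by simp
  finally show ?thesis by (simp add: snd_state_law)
qed

lemma waiting_measurable:
  assumes c: "c \<in> measurable M (count_space UNIV)" and t: "t \<in> borel_measurable M"
  shows "(\<lambda>x. waiting A (c x) (t x) x) \<in> measurable M (count_space UNIV)"
proof -
  note [measurable] = c t
  have [measurable]: "arrival_time A j \<in> borel_measurable M" for j
    unfolding arrival_time_def[abs_def] by measurable
  show ?thesis unfolding waiting_def by measurable
qed

lemma epoch_measurable:
  "first_customer n \<in> measurable M (count_space UNIV)" "epoch_time n \<in> borel_measurable M"
  "queue_length n \<in> measurable M (count_space UNIV)"
proof (induction n)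
  case 0
  have c: "first_customer 0 \<in> measurable M (count_space UNIV)" "epoch_time 0 \<in> borel_measurable M"
    by (simp_all add: first_customer_def[abs_def] epoch_time_def[abs_def])
  {
    case 1 show ?case by (rule c)
    case 2 show ?case by (rule c)
    case 3 show ?case unfolding queue_length_def[abs_def] by (rule waiting_measurable[OF c])
  }
next
  case (Suc n)
  note [measurable] = Suc
  have [measurable]: "arrival_time A j \<in> borel_measurable M" for j
    unfolding arrival_time_def[abs_def] by measurable
  have st [measurable]: "start_time n \<in> borel_measurable M"
    unfolding start_time_def[abs_def]
  proof (rule measurable_If)
    show "(\<lambda>x. arrival_time A (first_customer n x) x) \<in> borel_measurable M"
      by (rule measurable_compose_countable[OF _ Suc(1)]) simp
  qed simp_all
  have sv [measurable]: "(\<lambda>x. service (max (queue_length n x) 1) (block n x)) \<in> borel_measurable M"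
    by (rule measurable_compose_countable[OF _ Suc(3)]) simp
  have c: "first_customer (Suc n) \<in> measurable M (count_space UNIV)" "epoch_time (Suc n) \<in> borel_measurable M"
    unfolding first_customer_Suc[abs_def] epoch_time_Suc[abs_def]
    by (rule measurable_compose_countable[OF _ Suc(3)], rule measurable_compose[OF Suc(1)], simp)
       (rule borel_measurable_add[OF st sv])
  {
    case 1 show ?case by (rule c)
    case 2 show ?case by (rule c)
    case 3 show ?case unfolding queue_length_def[abs_def] by (rule waiting_measurable[OF c])
  }
qed

text \<open>The parameters serve both limit laws of batches: \<open>g = Suc\<close> for the number
  left behind, and \<open>f k = max k 1\<close> for the batch size.\<close>

lemma steady_state_nat_queue_length:
  "steady_state_nat M (\<lambda>n x. f (queue_length (g n) x)) (map_pmf f stationary_law)"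
  if g: "filterlim g at_top sequentially"
  unfolding steady_state_nat_def
proof (intro conjI allI)
  fix n k
  show m: "(\<lambda>x. f (queue_length (g n) x)) \<in> measurable M (count_space UNIV)" for n
    using measurable_compose[OF epoch_measurable(3), of f "count_space UNIV" "g n"] by simp
  have e: "measure M {x \<in> space M. f (queue_length (g n) x) = k} =
      measure_pmf.expectation (waiting_law (g n)) (indicat_real {w. f w = k})" for n
  proof -
    have "emeasure M {x \<in> space M. f (queue_length (g n) x) = k} = (\<integral>\<^sup>+x. indicator {w. f w = k} (queue_length (g n) x) \<partial>M)"
    proof -
      have "{x \<in> space M. f (queue_length (g n) x) = k} \<in> sets M"
        using measurable_sets[OF m[of n], of "{k}"] by (simp add: vimage_def Int_def conj_commute)
      from nn_integral_indicator[OF this] show ?thesis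
        by (rule trans[OF sym]) (auto simp: indicator_def intro!: nn_integral_cong)
    qed
    also have "\<dots> = emeasure (waiting_law (g n)) {w. f w = k}"
      by (simp add: nn_integral_queue_length)
    finally show ?thesis by (simp add: measure_def)
  qed
  have "(\<lambda>n. measure_pmf.expectation (waiting_law n) (indicat_real {w. f w = k})) \<longlonglongrightarrow>
      measure_pmf.expectation stationary_law (indicat_real {w. f w = k})"
    by (rule pmf_limit_expectation[of _ _ _ 1]) (simp_all add: waiting_law_tendsto)
  from filterlim_compose[OF this g]
  show "(\<lambda>n. measure M {x \<in> space M. f (queue_length (g n) x) = k}) \<longlonglongrightarrow> pmf (map_pmf f stationary_law) k"
    unfolding e by (simp add: pmf_map vimage_def)
qed

lemma left_behind_eq: "left_behind A H V n = queue_length (Suc n)"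
  by (simp only: fun_eq_iff left_behind_def queue_length_def first_customer_def epoch_time_def simp_thms)

lemma batch_size_eq: "batch_size A H V n x = max (queue_length n x) 1"
  using first_customer_Suc[of n x] unfolding batch_size_def first_customer_def by (metis add_diff_cancel_left')

section \<open>The delay of a customer\<close>

text \<open>\<open>served w \<xi> l\<close>: if a service starts with \<open>w\<close> customers waiting, the first of whom (or the
  next customer to arrive, if \<open>w = 0\<close>) has index \<open>c\<close>, then customer \<open>c + l\<close> either arrives
  during this service, or is its only customer and did not wait. Every customer is covered in
  this way by exactly one service, see \<open>system_delay_eq\<close>.\<close>

definition served :: "nat \<Rightarrow> (nat \<Rightarrow> real) \<times> (nat \<Rightarrow> nat \<Rightarrow> real) \<Rightarrow> nat \<Rightarrow> bool" where
  "served w \<xi> l \<longleftrightarrow> w = 0 \<and> l = 0 \<or> max w 1 \<le> l \<and> l < max w 1 + arrivals_in w \<xi>"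

text \<open>A customer arriving during the service waits for the rest of it and is then served
  together with all other arrivals of that service: the next batch has size
  \<open>arrivals_in w \<xi>\<close> and uses block 1 of the path. The offset
  \<open>l - max w 1\<close> numbers these arrivals from 0.\<close>

definition delay :: "nat \<Rightarrow> (nat \<Rightarrow> real) \<times> (nat \<Rightarrow> nat \<Rightarrow> real) \<Rightarrow> nat \<Rightarrow> real" where
  "delay w \<xi> l = (if w = 0 \<and> l = 0 then service 1 (snd \<xi> 0)
     else service (max w 1) (snd \<xi> 0) - (\<Sum>i\<le>l - max w 1. fst \<xi> i) + service (arrivals_in w \<xi>) (snd \<xi> 1))"

lemma first_customer_strict: "first_customer n x < first_customer (Suc n) x"
  by (simp add: first_customer_Suc)

lemma first_customer_mono: "n \<le> n' \<Longrightarrow> first_customer n x \<le> first_customer n' x"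
  using strict_mono_less_eq[of "\<lambda>n. first_customer n x" n n'] strict_mono_Suc_iff first_customer_strict by blast

lemma first_customer_ge: "n \<le> first_customer n x"
proof (induction n)
  case (Suc n)
  then show ?case using first_customer_strict[of n x] by simp
qed simp

lemma batch_of_iff:
  "batch_of A H V j x = n \<longleftrightarrow> first_customer n x \<le> j \<and> j < first_customer (Suc n) x"
proof -
  define b where "b = (LEAST n. j < first_customer (Suc n) x)"
  have b: "j < first_customer (Suc b) x"
    unfolding b_def by (rule LeastI[of _ j]) (use first_customer_ge[of "Suc j" x] in simp)
  have b': "first_customer b x \<le> j"
  proof (cases b)
    case 0
    then show ?thesis by (simp add: first_customer_def)
  next
    case (Suc m)
    then show ?thesis using not_less_Least[of m "\<lambda>n. j < first_customer (Suc n) x"] by (simp add: b_def)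
  qed
  have "batch_of A H V j x = b" by (simp only: batch_of_def b_def first_customer_def)
  moreover have "n = b" if "first_customer n x \<le> j" "j < first_customer (Suc n) x"
    using that b b' first_customer_mono[of "Suc n" b x] first_customer_mono[of "Suc b" n x]
    by (metis leD le_trans not_less_eq_eq order_antisym)
  ultimately show ?thesis using b b' by auto
qed

lemma served_path_iff:
  "first_customer n x \<le> j \<and> served (queue_length n x) (path_from n x) (j - first_customer n x) \<longleftrightarrow>
    queue_length n x = 0 \<and> first_customer n x = j \<or>
    first_customer (Suc n) x \<le> j \<and> j < first_customer (Suc n) x + queue_length (Suc n) x"
  unfolding served_def queue_length_Suc[symmetric] first_customer_Suc by auto

text \<open>The covering service is the customer's own batch if that found nobody waiting, and
  otherwise the preceding batch. The hypothesis guarantees that in the second case there is a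
  preceding batch; its number is at most \<open>j\<close> because every batch has at least one
  customer.\<close>

lemma system_delay_eq:
  assumes q0: "queue_length 0 x = 0"
  shows "(f (system_delay A H V j x) :: ennreal) = (\<Sum>n\<le>j.
    of_bool (first_customer n x \<le> j \<and> served (queue_length n x) (path_from n x) (j - first_customer n x)) *
    f (delay (queue_length n x) (path_from n x) (j - first_customer n x)))"
proof -
  define b where "b = batch_of A H V j x"
  have b: "first_customer b x \<le> j" "j < first_customer (Suc b) x"
    using batch_of_iff[of j x b] by (simp_all add: b_def)
  have bn: "n = b" if "first_customer n x \<le> j" "j < first_customer (Suc n) x" for n
    using batch_of_iff[of j x n] that by (simp add: b_def)
  have sd: "system_delay A H V j x = epoch_time (Suc b) x - arrival_time A j x"
    by (simp only: system_delay_def b_def epoch_time_def)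
  define n0 where "n0 = (if queue_length b x = 0 then b else b - 1)"
  have "(first_customer n x \<le> j \<and> served (queue_length n x) (path_from n x) (j - first_customer n x) \<longleftrightarrow> n = n0) \<and>
     system_delay A H V j x = delay (queue_length n0 x) (path_from n0 x) (j - first_customer n0 x) \<and> n0 \<le> j" for n
  proof (cases "queue_length b x = 0")
    case True
    have j: "j = first_customer b x"
      using b True by (simp add: first_customer_Suc)
    have "first_customer n x = j \<Longrightarrow> n = b" for n
      using bn[of n] first_customer_strict[of n x] by simp
    moreover have "first_customer (Suc n) x \<le> j \<Longrightarrow> j < first_customer (Suc n) x + queue_length (Suc n) x \<Longrightarrow> False"
    proof -
      assume a: "first_customer (Suc n) x \<le> j" "j < first_customer (Suc n) x + queue_length (Suc n) x"
      then have "j < first_customer (Suc (Suc n)) x" by (simp add: first_customer_Suc[of "Suc n"])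
      with a bn[of "Suc n"] True show False by auto
    qed
    ultimately have "first_customer n x \<le> j \<and> served (queue_length n x) (path_from n x) (j - first_customer n x) \<longleftrightarrow> n = b"
      unfolding served_path_iff using True j by auto
    moreover have "system_delay A H V j x = delay (queue_length b x) (path_from b x) (j - first_customer b x)"
      unfolding sd using True j by (simp add: epoch_time_Suc start_time_def delay_def path_from_def)
    ultimately show ?thesis
      using True b first_customer_ge[of b x] by (simp add: n0_def)
  next
    case False
    then obtain n1 where n1: "b = Suc n1" using q0 by (cases b) auto
    have "\<not> (queue_length n x = 0 \<and> first_customer n x = j)"
      using bn[of n] first_customer_strict[of n x] False by auto
    moreover have "first_customer (Suc n) x \<le> j \<and> j < first_customer (Suc n) x + queue_length (Suc n) x \<longleftrightarrow> n = n1"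
    proof
      assume a: "first_customer (Suc n) x \<le> j \<and> j < first_customer (Suc n) x + queue_length (Suc n) x"
      then have "j < first_customer (Suc (Suc n)) x" by (simp add: first_customer_Suc[of "Suc n"])
      with a bn[of "Suc n"] n1 show "n = n1" by auto
    next
      assume "n = n1"
      then show "first_customer (Suc n) x \<le> j \<and> j < first_customer (Suc n) x + queue_length (Suc n) x"
        using b False n1 by (simp add: first_customer_Suc[of "Suc n1"])
    qed
    ultimately have "first_customer n x \<le> j \<and> served (queue_length n x) (path_from n x) (j - first_customer n x) \<longleftrightarrow> n = n1"
      unfolding served_path_iff by auto
    moreover have "system_delay A H V j x = delay (queue_length n1 x) (path_from n1 x) (j - first_customer n1 x)"
    proof -
      have l: "j - first_customer n1 x - max (queue_length n1 x) 1 = j - first_customer (Suc n1) x"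
        by (simp add: first_customer_Suc)
      have "j - first_customer n1 x \<noteq> 0"
        using b(1) n1 first_customer_strict[of n1 x] by simp
      moreover have "(\<Sum>i\<le>j - first_customer (Suc n1) x. arrivals_from n1 x i) = arrival_time A j x - start_time n1 x"
        using b(1) n1 by (simp add: sum_arrivals_from)
      moreover have "start_time b x = start_time n1 x + service (max (queue_length n1 x) 1) (block n1 x)"
        using False unfolding n1 by (simp add: start_time_def[of "Suc n1"] epoch_time_Suc)
      moreover have "arrivals_in (queue_length n1 x) (path_from n1 x) = queue_length b x"
        by (simp add: queue_length_Suc n1)
      ultimately show ?thesis
        using False n1 unfolding sd delay_def l by (simp add: epoch_time_Suc[of "Suc n1"] path_from_def)
    qed
    moreover have "n1 \<le> j" using b(1) first_customer_ge[of b x] n1 by simp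
    ultimately show ?thesis using False n1 by (simp add: n0_def)
  qed
  then have *: "first_customer n x \<le> j \<and> served (queue_length n x) (path_from n x) (j - first_customer n x) \<longleftrightarrow> n = n0"
    "system_delay A H V j x = delay (queue_length n0 x) (path_from n0 x) (j - first_customer n0 x)" "n0 \<le> j" for n
    by blast+
  have "(\<Sum>n\<le>j. of_bool (n = n0) * f (delay (queue_length n x) (path_from n x) (j - first_customer n x))) =
      (\<Sum>n\<le>j. if n = n0 then f (system_delay A H V j x) else 0)"
    by (intro sum.cong) (auto simp: *(2))
  then show ?thesis using *(3) unfolding *(1) by simp
qed

lemma served_measurable [measurable]: "Measurable.pred path_law (\<lambda>\<xi>. served w \<xi> l)"
  unfolding served_def by measurable

lemma delay_measurable [measurable]: "(\<lambda>\<xi>. delay w \<xi> l) \<in> borel_measurable path_law"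
proof -
  have [measurable]: "(\<lambda>\<xi>. fst \<xi> i) \<in> borel_measurable path_law" for i
    by (rule measurable_compose[OF fst_snd_path(1)]) measurable
  have [measurable]: "(\<lambda>\<xi>. service (arrivals_in w \<xi>) (snd \<xi> 1)) \<in> borel_measurable path_law"
    by (rule measurable_compose_countable[OF _ arrivals_in_measurable]) simp
  show ?thesis unfolding delay_def by measurable
qed

lemma arrival_time_measurable [measurable]: "arrival_time A j \<in> borel_measurable M"
  unfolding arrival_time_def[abs_def] by measurable

lemma path_from_measurable: "path_from n \<in> measurable M path_law"
proof -
  have sv: "(\<lambda>x. service (max (queue_length n x) 1) (block n x)) \<in> borel_measurable M"
    by (rule measurable_compose_countable[OF _ epoch_measurable(3)]) simp
  have "start_time n x = epoch_time (Suc n) x - service (max (queue_length n x) 1) (block n x)" for x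
    by (simp add: epoch_time_Suc)
  then have st: "start_time n \<in> borel_measurable M"
    using borel_measurable_diff[OF epoch_measurable(2) sv] by (simp cong: measurable_cong)
  have "arrivals_from n \<in> measurable M gaps_law"
  proof (rule measurable_gaps_law)
    fix i
    show "(\<lambda>x. arrivals_from n x i) \<in> borel_measurable M"
    proof (cases i)
      case 0
      have "(\<lambda>x. arrival_time A (first_customer (Suc n) x) x) \<in> borel_measurable M"
        by (rule measurable_compose_countable[OF _ epoch_measurable(1)]) simp
      then show ?thesis using st 0 by (simp add: arrivals_from_def)
    next
      case (Suc i')
      have "(\<lambda>x. A (Suc (first_customer (Suc n) x + i')) x) \<in> borel_measurable M"
        by (rule measurable_compose_countable[OF _ epoch_measurable(1)]) simp
      then show ?thesis using Suc by (simp add: arrivals_from_def)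
    qed
  qed
  moreover have "(\<lambda>x k. block (n + k) x) \<in> measurable M blocks_law"
    by (rule measurable_blocks_law) simp
  ultimately show ?thesis
    unfolding path_from_def[abs_def] path_law_def by (rule measurable_Pair)
qed

lemma system_delay_measurable: "system_delay A H V j \<in> borel_measurable M"
proof -
  have [measurable]: "first_customer n \<in> measurable M (count_space UNIV)" for n
    by (rule epoch_measurable(1))
  have "batch_of A H V j = (\<lambda>x. LEAST n. j < first_customer (Suc n) x)"
    by (intro ext) (simp only: batch_of_def first_customer_def)
  then have b: "batch_of A H V j \<in> measurable M (count_space UNIV)" by simp
  have "(\<lambda>x. epoch_time (Suc (batch_of A H V j x)) x) \<in> borel_measurable M"
    by (rule measurable_compose_countable[OF _ b]) (rule epoch_measurable(2))
  moreover have "system_delay A H V j = (\<lambda>x. epoch_time (Suc (batch_of A H V j x)) x - arrival_time A j x)"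
    by (simp only: system_delay_def[abs_def] epoch_time_def)
  ultimately show ?thesis by simp
qed

section \<open>Delays as a convolution over the starts of services\<close>

definition delay_weight :: "(real \<Rightarrow> ennreal) \<Rightarrow> nat \<Rightarrow> nat \<Rightarrow> ennreal" where
  "delay_weight f w l = (\<integral>\<^sup>+\<xi>. of_bool (served w \<xi> l) * f (delay w \<xi> l) \<partial>path_law)"

lemma delay_weight_0: "l < w \<Longrightarrow> delay_weight f w l = 0"
  by (auto simp: delay_weight_def served_def)

lemma state_law_support: "(i, w) \<in> set_pmf (state_law n) \<Longrightarrow> n \<le> i"
proof (induction n arbitrary: i w)
  case (Suc n)
  then obtain c v where "(c, v) \<in> set_pmf (state_law n)" "i = c + max v 1" by auto
  with Suc.IH[of c v] show ?case by simp
qed simp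

text \<open>Probability that some service starts with customer \<open>i\<close> while
  \<open>w\<close> wait. At most one service starts with customer \<open>i\<close>, so the
  probabilities add up, and its number is at most \<open>i\<close>.\<close>

definition visits :: "nat \<Rightarrow> nat \<Rightarrow> real" where
  "visits i w = (\<Sum>n\<le>i. pmf (state_law n) (i, w))"

lemma visits_eq: "i \<le> j \<Longrightarrow> visits i w = (\<Sum>n\<le>j. pmf (state_law n) (i, w))"
  unfolding visits_def
  by (rule sum.mono_neutral_left) (auto simp: set_pmf_iff[symmetric] dest: state_law_support)

text \<open>Conditioning on the preceding batch yields the recursion under which the renewal
  decomposition was derived.\<close>

lemma visits_rec:
  "visits i w = of_bool (i = 0 \<and> w = 0) + (\<Sum>k\<in>{k. max k 1 \<le> i}. visits (i - max k 1) k * pmf (kernel k) w)"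
proof -
  define S where "S = {k. max k 1 \<le> i}"
  have S: "finite S" unfolding S_def by simp
  have step: "pmf (state_law (Suc n)) (i, w) = (\<Sum>k\<in>S. pmf (state_law n) (i - max k 1, k) * pmf (kernel k) w)" for n
  proof -
    have p: "pmf (map_pmf (\<lambda>w'. (c + max k 1, w')) (kernel k)) (i, w) = of_bool (c + max k 1 = i) * pmf (kernel k) w" for c k
    proof (cases "c + max k 1 = i")
      case True
      then show ?thesis using pmf_map_inj'[of "\<lambda>w'. (c + max k 1, w')" "kernel k" w] by (simp add: inj_def)
    next
      case False
      then have "(i, w) \<notin> set_pmf (map_pmf (\<lambda>w'. (c + max k 1, w')) (kernel k))" by auto
      then have "pmf (map_pmf (\<lambda>w'. (c + max k 1, w')) (kernel k)) (i, w) = 0"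
        unfolding pmf_eq_0_set_pmf .
      then show ?thesis using False by simp
    qed
    have "pmf (state_law (Suc n)) (i, w) = measure_pmf.expectation (state_law n) (\<lambda>cw. of_bool (fst cw + max (snd cw) 1 = i) * pmf (kernel (snd cw)) w)"
      by (simp add: pmf_bind case_prod_unfold p[simplified])
    also have "\<dots> = (\<Sum>cw\<in>(\<lambda>k. (i - max k 1, k)) ` S. of_bool (fst cw + max (snd cw) 1 = i) * pmf (kernel (snd cw)) w * pmf (state_law n) cw)"
      by (rule integral_measure_pmf_real) (use S in \<open>auto simp: S_def image_iff split: if_splits\<close>)
    also have "\<dots> = (\<Sum>k\<in>S. pmf (state_law n) (i - max k 1, k) * pmf (kernel k) w)"
      by (subst sum.reindex) (auto simp: inj_on_def S_def intro!: sum.cong)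
    finally show ?thesis .
  qed
  have "visits i w = (\<Sum>n\<le>Suc i. pmf (state_law n) (i, w))" by (rule visits_eq) simp
  also have "\<dots> = pmf (state_law 0) (i, w) + (\<Sum>n\<le>i. pmf (state_law (Suc n)) (i, w))"
    by (rule sum.atMost_Suc_shift)
  also have "(\<Sum>n\<le>i. pmf (state_law (Suc n)) (i, w)) = (\<Sum>k\<in>S. (\<Sum>n\<le>i. pmf (state_law n) (i - max k 1, k)) * pmf (kernel k) w)"
    unfolding step by (subst sum.swap) (simp add: sum_distrib_right)
  also have "\<dots> = (\<Sum>k\<in>S. visits (i - max k 1) k * pmf (kernel k) w)"
    by (intro sum.cong refl) (subst visits_eq[of _ i]; simp)
  finally show ?thesis by (auto simp: S_def)
qed

text \<open>The Markov property integrates each term of the pathwise decomposition: the state at the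
  start of a service contributes to \<open>visits\<close>, the fresh path gives
  \<open>delay_weight\<close>.\<close>

lemma nn_integral_system_delay:
  assumes f [measurable]: "f \<in> borel_measurable borel"
  shows "(\<integral>\<^sup>+x. f (system_delay A H V j x) \<partial>M) = (\<Sum>i\<le>j. \<Sum>w\<le>j. ennreal (visits i w) * delay_weight f w (j - i))"
proof -
  define \<Phi> where "\<Phi> cw \<xi> = of_bool (fst cw \<le> j \<and> served (snd cw) \<xi> (j - fst cw)) * f (delay (snd cw) \<xi> (j - fst cw))" for cw \<xi>
  have \<Phi>: "\<Phi> cw \<in> borel_measurable path_law" for cw
    unfolding \<Phi>_def[abs_def] by measurable
  have m: "(\<lambda>x. \<Phi> (first_customer n x, queue_length n x) (path_from n x)) \<in> borel_measurable M" for n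
    by (rule measurable_compose_countable[OF measurable_compose_countable[OF _ epoch_measurable(3)] epoch_measurable(1)])
       (rule measurable_compose[OF path_from_measurable \<Phi>])
  have "(\<integral>\<^sup>+x. f (system_delay A H V j x) \<partial>M) = (\<integral>\<^sup>+x. (\<Sum>n\<le>j. \<Phi> (first_customer n x, queue_length n x) (path_from n x)) \<partial>M)"
  proof (rule nn_integral_cong_AE)
    show "AE x in M. f (system_delay A H V j x) = (\<Sum>n\<le>j. \<Phi> (first_customer n x, queue_length n x) (path_from n x))"
      using AE_arrivals_pos
    proof eventually_elim
      case (elim x)
      show ?case unfolding \<Phi>_def fst_conv snd_conv by (rule system_delay_eq[OF queue_length_0[OF elim]])
    qed
  qed
  also have "\<dots> = (\<Sum>n\<le>j. \<integral>\<^sup>+cw. (\<integral>\<^sup>+\<xi>. \<Phi> cw \<xi> \<partial>path_law) \<partial>state_law n)"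
    by (subst nn_integral_sum[OF m]) (intro sum.cong refl nn_integral_state \<Phi>)
  also have "\<dots> = (\<Sum>n\<le>j. \<integral>\<^sup>+cw. of_bool (fst cw \<le> j) * delay_weight f (snd cw) (j - fst cw) \<partial>state_law n)"
    by (intro sum.cong nn_integral_cong refl) (auto simp: \<Phi>_def delay_weight_def)
  also have "\<dots> = (\<Sum>n\<le>j. \<Sum>cw\<in>{..j} \<times> {..j}. of_bool (fst cw \<le> j) * delay_weight f (snd cw) (j - fst cw) * ennreal (pmf (state_law n) cw))"
    by (intro sum.cong refl nn_integral_measure_pmf_support) (auto, rule ccontr, simp add: delay_weight_0)
  also have "\<dots> = (\<Sum>n\<le>j. \<Sum>i\<le>j. \<Sum>w\<le>j. ennreal (pmf (state_law n) (i, w)) * delay_weight f w (j - i))"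
    by (intro sum.cong refl, subst sum.cartesian_product, rule sum.cong) (auto simp: mult.commute)
  also have "\<dots> = (\<Sum>i\<le>j. \<Sum>w\<le>j. \<Sum>n\<le>j. ennreal (pmf (state_law n) (i, w)) * delay_weight f w (j - i))"
    by (subst sum.swap) (intro sum.cong refl sum.swap)
  also have "\<dots> = (\<Sum>i\<le>j. \<Sum>w\<le>j. ennreal (visits i w) * delay_weight f w (j - i))"
    by (intro sum.cong refl) (simp add: visits_eq[of _ j] sum_distrib_right[symmetric])
  finally show ?thesis .
qed

lemma path_law_prob_space: "prob_space path_law"
  unfolding path_law_def by (rule path.P.prob_space_axioms)

lemma delay_weight_le: "(\<And>y. f y \<le> g y) \<Longrightarrow> delay_weight f w l \<le> delay_weight g w l"
  unfolding delay_weight_def by (intro nn_integral_mono mult_left_mono) auto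

lemma delay_weight_le_1: "(\<And>y. f y \<le> 1) \<Longrightarrow> delay_weight f w l \<le> 1"
proof -
  assume "\<And>y. f y \<le> 1"
  then have "delay_weight f w l \<le> (\<integral>\<^sup>+\<xi>. 1 \<partial>path_law)"
    unfolding delay_weight_def by (intro nn_integral_mono) auto
  then show ?thesis by (simp add: path_law_prob)
qed

text \<open>Offsets below \<open>max w 1\<close> are the members of the batch itself, charged to an
  earlier service unless the batch found nobody waiting. From \<open>max w 1\<close> on, the offsets
  run through the arrivals during the service.\<close>

lemma suminf_served:
  "(\<Sum>l. of_bool (served w \<xi> l) * f (delay w \<xi> l)) =
    of_bool (w = 0) * (f (service 1 (snd \<xi> 0)) :: ennreal) +
    (\<Sum>l. of_bool (l < arrivals_in w \<xi>) *
      f (service (max w 1) (snd \<xi> 0) - (\<Sum>i\<le>l. fst \<xi> i) + service (arrivals_in w \<xi>) (snd \<xi> 1)))"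
proof -
  let ?m = "max w 1"
  let ?F = "\<lambda>l. of_bool (served w \<xi> l) * f (delay w \<xi> l)"
  have sh: "?F (l + ?m) = of_bool (l < arrivals_in w \<xi>) *
      f (service ?m (snd \<xi> 0) - (\<Sum>i\<le>l. fst \<xi> i) + service (arrivals_in w \<xi>) (snd \<xi> 1))" for l
    by (simp add: served_def delay_def)
  have "(\<Sum>l<?m. ?F l) = (\<Sum>l<?m. if l = 0 then of_bool (w = 0) * f (service 1 (snd \<xi> 0)) else 0)"
    by (intro sum.cong) (auto simp: served_def delay_def)
  also have "\<dots> = of_bool (w = 0) * f (service 1 (snd \<xi> 0))" by simp
  finally show ?thesis
    using suminf_offset[of ?F ?m] unfolding sh by (simp only: add.commute summableI simp_thms)
qed

lemma suminf_delay_weight: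
  assumes [measurable]: "f \<in> borel_measurable borel"
  shows "(\<Sum>l. delay_weight f w l) = (\<integral>\<^sup>+\<xi>. (\<Sum>l. of_bool (served w \<xi> l) * f (delay w \<xi> l)) \<partial>path_law)"
  unfolding delay_weight_def by (rule nn_integral_suminf[symmetric]) measurable

text \<open>Mean number of customers charged to a service started with \<open>w\<close> waiting: its
  own customer if \<open>w = 0\<close>, and the Poisson arrivals during the service.\<close>

definition served_mean :: "nat \<Rightarrow> real" where
  "served_mean w = of_bool (w = 0) + lam * (real (max w 1) * mean FH + mean FV)"

lemma served_mean_nonneg: "0 \<le> served_mean w"
  using lam_pos mean_nonneg by (simp add: served_mean_def)

lemma suminf_delay_weight_1: "(\<Sum>l. delay_weight (\<lambda>_. 1) w l) = ennreal (served_mean w)"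
proof -
  have "(\<Sum>l. of_bool (l < n)) = ennreal (real n)" for n :: nat
  proof -
    have "(\<Sum>l. of_bool (l < n)) = (\<Sum>l<n. of_bool (l < n) :: ennreal)"
      by (rule suminf_finite) auto
    then show ?thesis by (simp add: ennreal_of_nat_eq_real_of_nat)
  qed
  then have "(\<Sum>l. delay_weight (\<lambda>_. 1) w l) = (\<integral>\<^sup>+\<xi>. of_bool (w = 0) + ennreal (real (arrivals_in w \<xi>)) \<partial>path_law)"
    using suminf_served[of w _ "\<lambda>_. 1"] by (subst suminf_delay_weight) simp_all
  also have "\<dots> = of_bool (w = 0) + (\<integral>\<^sup>+\<xi>. ennreal (real (arrivals_in w \<xi>)) \<partial>path_law)"
    by (subst nn_integral_add) (simp_all add: path_law_prob)
  also have "(\<integral>\<^sup>+\<xi>. ennreal (real (arrivals_in w \<xi>)) \<partial>path_law) = ennreal (lam * (real (max w 1) * mean FH + mean FV))"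
    using nn_integral_step[of "\<lambda>w' _. ennreal (real w')" w] by (simp add: path_law_prob kernel_def arrivals_law_mean)
  also have "of_bool (w = 0) + ennreal (lam * (real (max w 1) * mean FH + mean FV)) = ennreal (served_mean w)"
    using lam_pos mean_nonneg by (simp add: served_mean_def ennreal_plus)
  finally show ?thesis .
qed

abbreviation customers_mean :: real where
  "customers_mean \<equiv> mean_waiting + pmf stationary_law 0"

lemma customers_mean_pos: "0 < customers_mean"
  using chain.stationary_pos by (intro add_nonneg_pos) (simp_all add: integral_nonneg_AE)

text \<open>A balance: under the stationary law, a service is charged on average with as many
  customers as it serves, because the mean number of arrivals during it is
  \<open>mean_waiting\<close>.\<close>

lemma expectation_served_mean:
  "integrable (measure_pmf stationary_law) served_mean"
  "measure_pmf.expectation stationary_law served_mean = customers_mean"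
proof -
  have e: "served_mean w = indicator {0} w + lam * (real (max w 1) * mean FH + mean FV)" for w
    by (simp add: served_mean_def indicator_def)
  have i: "integrable (measure_pmf stationary_law) (indicator {0} :: nat \<Rightarrow> real)"
    by (rule integrable_pmf_bounded[of _ 1]) (simp add: indicator_def)
  have i': "integrable (measure_pmf stationary_law) (\<lambda>w. lam * (real (max w 1) * mean FH + mean FV))"
    by (intro Bochner_Integration.integrable_add integrable_mult_right integrable_mult_left
        expectation_max_1(2) measure_pmf.integrable_const)
  show "integrable (measure_pmf stationary_law) served_mean"
    unfolding e[abs_def] by (rule Bochner_Integration.integrable_add[OF i i'])
  have "measure_pmf.expectation stationary_law served_mean =
      measure_pmf.expectation stationary_law (indicat_real {0}) +
      measure_pmf.expectation stationary_law (\<lambda>w. lam * (real (max w 1) * mean FH + mean FV))"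
    unfolding e[abs_def] by (rule Bochner_Integration.integral_add[OF i i'])
  also have "measure_pmf.expectation stationary_law (indicat_real {0}) = pmf stationary_law 0"
    by (simp add: measure_pmf_single)
  also have "measure_pmf.expectation stationary_law (\<lambda>w. lam * (real (max w 1) * mean FH + mean FV)) =
      lam * (customers_mean * mean FH + mean FV)"
    using expectation_max_1 by simp
  also have "\<dots> = mean_waiting"
    using mean_waiting_eq by (simp only: mean_batch_service_def)
  finally show "measure_pmf.expectation stationary_law served_mean = customers_mean"
    by simp
qed

text \<open>The steady-state law of the delay: the delays of the customers assigned to one service,
  averaged over the stationary law of the queue length and normalized by their mean number.\<close>

definition delay_law :: "real measure" where
  "delay_law = distr (density (count_space UNIV \<Otimes>\<^sub>M path_law)
     (\<lambda>((w, l), \<xi>). ennreal (pmf stationary_law w / customers_mean) * of_bool (served w \<xi> l)))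
     borel (\<lambda>((w, l), \<xi>). delay w \<xi> l)"

lemma nn_integral_delay_law:
  assumes [measurable]: "f \<in> borel_measurable borel"
  shows "(\<integral>\<^sup>+y. f y \<partial>delay_law) = (\<integral>\<^sup>+w. (\<Sum>l. delay_weight f w l) \<partial>stationary_law) / ennreal customers_mean"
proof -
  interpret P: prob_space path_law by (rule path_law_prob_space)
  let ?N = "count_space UNIV \<Otimes>\<^sub>M path_law"
  define d where "d p = ennreal (pmf stationary_law (fst (fst p)) / customers_mean) * of_bool (served (fst (fst p)) (snd p) (snd (fst p)))" for p
  define D where "D p = delay (fst (fst p)) (snd p) (snd (fst p))" for p
  have d: "d \<in> borel_measurable ?N" and D: "D \<in> borel_measurable ?N"
    unfolding d_def[abs_def] D_def[abs_def]
    by (rule measurable_pair_measure_countable1; simp)+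
  have dF: "(\<lambda>p. d p * f (D p)) \<in> borel_measurable ?N"
    by (intro borel_measurable_times_ennreal d measurable_compose[OF D assms])
  have law: "delay_law = distr (density ?N d) borel D"
    unfolding delay_law_def d_def[abs_def] D_def[abs_def] by (simp add: case_prod_unfold)
  have "(\<integral>\<^sup>+y. f y \<partial>delay_law) = (\<integral>\<^sup>+p. d p * f (D p) \<partial>?N)"
    unfolding law
    by (subst nn_integral_distr) (use D in simp_all, rule nn_integral_density[OF d measurable_compose[OF D assms]])
  also have "\<dots> = (\<integral>\<^sup>+wl. (\<integral>\<^sup>+\<xi>. ennreal (pmf stationary_law (fst wl) / customers_mean) * of_bool (served (fst wl) \<xi> (snd wl)) * f (delay (fst wl) \<xi> (snd wl)) \<partial>path_law) \<partial>count_space UNIV)"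
    by (subst P.nn_integral_fst[symmetric, OF dF]) (simp add: d_def D_def)
  also have "\<dots> = (\<integral>\<^sup>+wl. ennreal (pmf stationary_law (fst wl) / customers_mean) * delay_weight f (fst wl) (snd wl) \<partial>count_space UNIV)"
    unfolding delay_weight_def mult.assoc by (intro nn_integral_cong nn_integral_cmult) measurable
  also have "\<dots> = (\<integral>\<^sup>+w. (\<integral>\<^sup>+l. ennreal (pmf stationary_law w / customers_mean) * delay_weight f w l \<partial>count_space UNIV) \<partial>count_space UNIV)"
    by (subst nn_integral_fst_count_space[symmetric]) simp
  also have "\<dots> = (\<integral>\<^sup>+w. ennreal (pmf stationary_law w) * (\<Sum>l. delay_weight f w l) / ennreal customers_mean \<partial>count_space UNIV)"
    using customers_mean_pos
    by (simp add: nn_integral_count_space_nat divide_ennreal[symmetric] ennreal_times_divide mult.commute)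
  also have "\<dots> = (\<integral>\<^sup>+w. (\<Sum>l. delay_weight f w l) \<partial>stationary_law) / ennreal customers_mean"
    by (simp add: nn_integral_measure_pmf nn_integral_divide)
  finally show ?thesis .
qed

lemma real_distribution_delay_law: "real_distribution delay_law"
proof -
  have "(\<integral>\<^sup>+w. ennreal (served_mean w) \<partial>stationary_law) = ennreal customers_mean"
    using nn_integral_eq_integral[OF expectation_served_mean(1)] served_mean_nonneg
    by (simp add: expectation_served_mean(2))
  then have "(\<integral>\<^sup>+y. 1 \<partial>delay_law) = 1"
    using customers_mean_pos
    by (subst nn_integral_delay_law) (simp_all add: suminf_delay_weight_1 ennreal_divide_self)
  then have "emeasure delay_law (space delay_law) = 1" by simp
  then show ?thesis
    by (intro real_distribution.intro prob_spaceI real_distribution_axioms.intro) (simp_all add: delay_law_def)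
qed

text \<open>Both weights of \<open>customer_average_limit\<close> come from
  \<open>delay_weight\<close>: the constant function 1 gives \<open>a\<close>, whose convolution
  with \<open>visits\<close> is the total mass 1, and \<open>f\<close> gives
  \<open>g\<close>.\<close>

theorem expectation_system_delay_tendsto:
  fixes f :: "real \<Rightarrow> real"
  assumes f [measurable]: "f \<in> borel_measurable borel" and f01: "\<And>y. 0 \<le> f y" "\<And>y. f y \<le> 1"
  shows "(\<lambda>j. \<integral>x. f (system_delay A H V j x) \<partial>M) \<longlonglongrightarrow> (\<integral>y. f y \<partial>delay_law)"
proof -
  interpret D: real_distribution delay_law by (rule real_distribution_delay_law)
  define a where "a w l = enn2real (delay_weight (\<lambda>_. 1) w l)" for w l
  define g where "g w l = enn2real (delay_weight (\<lambda>y. ennreal (f y)) w l)" for w l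
  have a: "delay_weight (\<lambda>_. 1) w l = ennreal (a w l)" for w l
    unfolding a_def using delay_weight_le_1[of "\<lambda>_. 1" w l]
    by (simp add: le_less_trans[OF _ ennreal_one_less_top])
  have gle: "delay_weight (\<lambda>y. ennreal (f y)) w l \<le> delay_weight (\<lambda>_. 1) w l" for w l
    by (rule delay_weight_le) (use f01 in \<open>simp add: ennreal_le_1\<close>)
  have g: "delay_weight (\<lambda>y. ennreal (f y)) w l = ennreal (g w l)" for w l
    unfolding g_def using le_less_trans[OF gle[of w l]] by (simp add: a)
  have a0: "0 \<le> a w l" and g0: "0 \<le> g w l" for w l by (simp_all add: a_def g_def)
  have ga: "g w l \<le> a w l" for w l using gle[of w l] a0[of w l] by (simp add: a g)
  have sa: "a w sums served_mean w" for w
  proof -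
    have e: "(\<Sum>l. ennreal (a w l)) = ennreal (served_mean w)"
      using suminf_delay_weight_1[of w] by (simp add: a)
    have s: "summable (a w)" by (rule summable_suminf_not_top[OF a0]) (simp add: e)
    have "ennreal (suminf (a w)) = ennreal (served_mean w)"
      using suminf_ennreal2[OF a0 s] e by simp
    then show ?thesis using s suminf_nonneg[OF s a0] served_mean_nonneg by (simp add: sums_iff)
  qed
  define G where "G w = (\<Sum>l. g w l)" for w
  have sg: "g w sums G w" for w
    unfolding G_def
    by (rule summable_sums, rule summable_comparison_test'[of "a w" 0])
       (use sa ga g0 in \<open>auto simp: sums_iff\<close>)
  have G0: "0 \<le> G w" and GA: "G w \<le> served_mean w" for w
    using sums_le[of "\<lambda>_. 0" "g w" 0 "G w"] sg[of w] g0 sums_le[OF ga sg sa] by auto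
  have intG: "integrable (measure_pmf stationary_law) G"
    by (rule Bochner_Integration.integrable_bound[OF expectation_served_mean(1)])
       (use G0 GA served_mean_nonneg in auto)
  have v0: "0 \<le> visits i w" for i w unfolding visits_def by (intro sum_nonneg) simp
  have E: "(\<integral>x. h (system_delay A H V j x) \<partial>M) = (\<Sum>i\<le>j. \<Sum>w\<le>j. visits i w * c w (j - i))"
    if h: "h \<in> borel_measurable borel" "\<And>y. 0 \<le> h y" "\<And>w l. delay_weight (\<lambda>y. ennreal (h y)) w l = ennreal (c w l)" "\<And>w l. 0 \<le> c w l"
    for h c j
  proof -
    have "(\<integral>\<^sup>+x. ennreal (h (system_delay A H V j x)) \<partial>M) = ennreal (\<Sum>i\<le>j. \<Sum>w\<le>j. visits i w * c w (j - i))"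
      using nn_integral_system_delay[of "\<lambda>y. ennreal (h y)" j] h v0
      by (simp add: ennreal_mult[symmetric] sum_nonneg)
    then show ?thesis
      using h v0 measurable_compose[OF system_delay_measurable h(1)]
      by (subst integral_eq_nn_integral) (simp_all add: sum_nonneg)
  qed
  have one: "(\<Sum>i\<le>j. \<Sum>w\<le>j. visits i w * a w (j - i)) = 1" for j
    using E[of "\<lambda>_. 1" a j] a a0 prob_space by simp
  \<comment> \<open>A service that finds nobody waiting always covers its own customer, so
    \<open>a 0 0 = 1\<close> and \<open>visits i 0\<close> is a single term of a nonnegative sum
    equal to 1.\<close>
  have "visits i 0 \<le> 1" for i
  proof -
    have "delay_weight (\<lambda>_. 1) 0 0 = 1"
      by (simp add: delay_weight_def served_def path_law_prob)
    then have "a 0 0 = 1" by (simp add: a_def)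
    then have "visits i 0 = visits i 0 * a 0 (i - i)" by simp
    also have "\<dots> \<le> (\<Sum>w\<le>i. visits i w * a w (i - i))"
      by (rule member_le_sum[of 0]) (auto simp: v0 a0)
    also have "\<dots> \<le> (\<Sum>i'\<le>i. \<Sum>w\<le>i. visits i' w * a w (i - i'))"
      by (rule member_le_sum[of i]) (auto simp: v0 a0 intro!: sum_nonneg)
    finally show ?thesis by (simp add: one)
  qed
  then have "(\<lambda>j. \<Sum>i\<le>j. \<Sum>w\<le>j. visits i w * g w (j - i)) \<longlonglongrightarrow>
      measure_pmf.expectation stationary_law G / measure_pmf.expectation stationary_law served_mean"
    by (intro chain.customer_average_limit[where v = visits and a = a and A = served_mean, OF visits_rec])
       (simp_all only: v0 one ga g0 sa sg expectation_served_mean(1), simp add: a_def delay_weight_0)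
  moreover have "(\<integral>y. f y \<partial>delay_law) = measure_pmf.expectation stationary_law G / measure_pmf.expectation stationary_law served_mean"
  proof -
    have gw: "(\<Sum>l. delay_weight (\<lambda>y. ennreal (f y)) w l) = ennreal (G w)" for w
      using suminf_ennreal2[of "g w", OF g0] sg[of w] by (simp only: g sums_iff)
    have "(\<integral>\<^sup>+y. ennreal (f y) \<partial>delay_law) = (\<integral>\<^sup>+w. ennreal (G w) \<partial>stationary_law) / ennreal customers_mean"
      by (subst nn_integral_delay_law) (simp_all only: gw, simp)
    also have "\<dots> = ennreal (measure_pmf.expectation stationary_law G / customers_mean)"
      using nn_integral_eq_integral[OF intG] G0 customers_mean_pos
      by (simp add: divide_ennreal integral_nonneg_AE del: ennreal_plus)
    finally show ?thesis
      using f01 G0 customers_mean_pos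
      by (subst integral_eq_nn_integral) (simp_all add: expectation_served_mean(2) integral_nonneg_AE)
  qed
  ultimately show ?thesis
    using E[of f g] g g0 f01 by simp
qed

lemma steady_state_system_delay: "steady_state_real M (system_delay A H V) delay_law"
  unfolding steady_state_real_def weak_conv_m_def weak_conv_def
proof (intro conjI allI impI)
  show m: "system_delay A H V n \<in> borel_measurable M" for n by (rule system_delay_measurable)
  show "real_distribution delay_law" by (rule real_distribution_delay_law)
  then interpret D: real_distribution delay_law .
  fix y
  \<comment> \<open>Indicators of half-lines are admissible test functions for the convergence of
    expectations.\<close>
  have "cdf (distr M borel (system_delay A H V n)) y = (\<integral>x. indicator {..y} (system_delay A H V n x) \<partial>M)" for n
    using m[of n] unfolding cdf_def by (simp add: integral_distr[symmetric] del: integral_distr)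
  moreover have "cdf delay_law y = (\<integral>x. indicator {..y} x \<partial>delay_law)"
    unfolding cdf_def by simp
  ultimately show "(\<lambda>n. cdf (distr M borel (system_delay A H V n)) y) \<longlonglongrightarrow> cdf delay_law y"
    using expectation_system_delay_tendsto[of "indicat_real {..y}"] by simp
qed

section \<open>The Laplace transform of the limit law\<close>

definition rlst :: "real measure \<Rightarrow> real \<Rightarrow> real" where
  "rlst F s = (\<integral>y. exp (- s * y) \<partial>F)"

lemma lst_rlst: "lst F (of_real s) = of_real (rlst F s)"
  unfolding rlst_def by (rule lst_of_real)

lemma rlst_bounds:
  assumes "0 \<le> s"
  shows "0 \<le> rlst FH s" "rlst FH s \<le> 1" "0 \<le> rlst FV s" "rlst FV s \<le> 1"
  using norm_lst_le_1[OF FH.prob_space_axioms _ H_nonneg, of "of_real s"]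
    norm_lst_le_1[OF FV.prob_space_axioms _ V_nonneg, of "of_real s"] assms
  by (auto simp: lst_rlst) (simp_all add: rlst_def integral_nonneg_AE)

lemma rlst_service:
  assumes s: "0 \<le> s"
  shows "integrable block_law (\<lambda>r. exp (- s * service m r))"
    and "(\<integral>r. exp (- s * service m r) \<partial>block_law) = rlst FH s ^ m * rlst FV s"
proof -
  show "integrable block_law (\<lambda>r. exp (- s * service m r))"
  proof (rule B.integrable_const_bound[where B = 1])
    show "AE r in block_law. norm (exp (- s * service m r)) \<le> 1"
      using AE_service_nonneg[of m] by eventually_elim (use s in simp)
  qed simp
  have e: "exp (- complex_of_real s * complex_of_real (service m r)) = complex_of_real (exp (- s * service m r))" for r
    by (simp add: exp_of_real[symmetric])
  have "complex_of_real (\<integral>r. exp (- s * service m r) \<partial>block_law) = complex_of_real (rlst FH s ^ m * rlst FV s)"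
    using lst_service[of "complex_of_real s" m] s unfolding e lst_rlst integral_complex_of_real by simp
  then show "(\<integral>r. exp (- s * service m r) \<partial>block_law) = rlst FH s ^ m * rlst FV s"
    by (simp only: of_real_eq_iff)
qed

lemma nn_integral_exp_service:
  assumes "0 \<le> s"
  shows "(\<integral>\<^sup>+r. ennreal (exp (- s * service m r)) \<partial>block_law) = ennreal (rlst FH s ^ m * rlst FV s)"
  using rlst_service[OF assms, of m] by (subst nn_integral_eq_integral) simp_all

lemma rlst_service_antimono:
  assumes "0 \<le> s" "s \<le> s'"
  shows "rlst FH s' ^ m * rlst FV s' \<le> rlst FH s ^ m * rlst FV s"
proof -
  have "(\<integral>r. exp (- s' * service m r) \<partial>block_law) \<le> (\<integral>r. exp (- s * service m r) \<partial>block_law)"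
  proof (rule integral_mono_AE)
    show "AE r in block_law. exp (- s' * service m r) \<le> exp (- s * service m r)"
      using AE_service_nonneg[of m] by eventually_elim (use assms in \<open>simp add: mult_right_mono\<close>)
  qed (use assms in \<open>auto intro!: rlst_service(1)[simplified]\<close>)
  then show ?thesis using assms by (simp only: rlst_service(2) order_trans)
qed

lemma nn_integral_blocks_0:
  assumes "g \<in> borel_measurable block_law"
  shows "(\<integral>\<^sup>+R. g (R 0) \<partial>blocks_law) = (\<integral>\<^sup>+r. g r \<partial>block_law)"
proof -
  have "distr blocks_law block_law (\<lambda>R. R 0) = block_law"
    unfolding blocks_law_def by (rule distr_PiM_component) (auto intro: B.prob_space_axioms)
  moreover have "(\<integral>\<^sup>+r. g r \<partial>distr blocks_law block_law (\<lambda>R. R 0)) = (\<integral>\<^sup>+R. g (R 0) \<partial>blocks_law)"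
    by (rule nn_integral_distr) (use assms in \<open>simp_all add: blocks_law_def\<close>)
  ultimately show ?thesis by simp
qed

lemma nn_integral_exp_kernel:
  fixes \<omega> S :: real
  assumes \<omega>: "0 < \<omega>" and S: "0 \<le> S"
  shows "(\<integral>\<^sup>+t. indicator {0..S} t * ennreal (exp (- \<omega> * (S - t))) \<partial>lborel) = ennreal ((1 - exp (- \<omega> * S)) / \<omega>)"
proof -
  have "(\<integral>\<^sup>+t. ennreal (exp (- \<omega> * (S - t))) * indicator {0..S} t \<partial>lborel) =
      ennreal (exp (- \<omega> * (S - S)) / \<omega> - exp (- \<omega> * (S - 0)) / \<omega>)"
    by (rule nn_integral_FTC_Icc) (use assms in \<open>auto intro!: derivative_eq_intros\<close>)
  then show ?thesis by (simp add: mult.commute diff_divide_distrib)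
qed

text \<open>The first summand belongs to the customer that finds the system empty. In the second,
  every arrival during a service of length \<open>S\<close> puts a factor \<open>h\<close> into the
  transform of the next service, so the Poisson arrivals contribute
  \<open>lam * h * exp (- s * S)\<close>. Integrating \<open>exp (- \<omega> * (S - t))\<close> over
  the arrival epoch \<open>t\<close> then gives the difference and the factor
  \<open>1 / \<omega>\<close>.\<close>

definition delay_transform :: "real \<Rightarrow> nat \<Rightarrow> real" where
  "delay_transform \<omega> w = (let h = rlst FH \<omega>; v = rlst FV \<omega>; s = lam * (1 - h) in
     of_bool (w = 0) * (h * v) + v * (lam * h / \<omega>) *
       (rlst FH s ^ max w 1 * rlst FV s - rlst FH (\<omega> + s) ^ max w 1 * rlst FV (\<omega> + s)))"

lemma delay_transform_nonneg:
  assumes "0 < \<omega>"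
  shows "0 \<le> delay_transform \<omega> w"
  using rlst_bounds[of \<omega>] assms lam_pos rlst_service_antimono[of "lam * (1 - rlst FH \<omega>)" "\<omega> + lam * (1 - rlst FH \<omega>)" "max w 1"]
  by (simp add: delay_transform_def Let_def)

lemma suminf_delay_weight_exp:
  assumes \<omega>: "0 < \<omega>"
  shows "(\<Sum>l. delay_weight (\<lambda>y. ennreal (exp (- \<omega> * y))) w l) = ennreal (delay_transform \<omega> w)"
proof -
  define h where "h = rlst FH \<omega>"
  define v where "v = rlst FV \<omega>"
  define s where "s = lam * (1 - h)"
  have hv: "0 \<le> h" "h \<le> 1" "0 \<le> v" using rlst_bounds[of \<omega>] \<omega> by (simp_all add: h_def v_def)
  have s: "0 \<le> s" using hv lam_pos by (simp add: s_def)
  let ?e = "\<lambda>y. ennreal (exp (- \<omega> * y))"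
  let ?m = "max w 1"
  have e_add: "?e (a + b) = ?e a * ?e b" for a b
    by (simp add: ennreal_mult[symmetric] exp_add[symmetric] algebra_simps)
  define J where "J \<xi> = (\<Sum>l. of_bool (l < arrivals_in w \<xi>) *
      ?e (service ?m (snd \<xi> 0) - (\<Sum>i\<le>l. fst \<xi> i) + service (arrivals_in w \<xi>) (snd \<xi> 1)))" for \<xi>
  have J: "J \<in> borel_measurable path_law"
  proof -
    have [measurable]: "(\<lambda>\<xi>. fst \<xi> i) \<in> borel_measurable path_law" for i
      by (rule measurable_compose[OF fst_snd_path(1)]) measurable
    have [measurable]: "(\<lambda>\<xi>. service (arrivals_in w \<xi>) (snd \<xi> 1)) \<in> borel_measurable path_law"
      by (rule measurable_compose_countable[OF _ arrivals_in_measurable]) simp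
    show ?thesis unfolding J_def[abs_def] by measurable
  qed
  have one: "(\<integral>\<^sup>+\<xi>. ?e (service 1 (snd \<xi> 0)) \<partial>path_law) = ennreal (h * v)"
    using nn_integral_exp_service[of \<omega> 1] \<omega>
    by (subst path_law_iterate(1)) (simp_all add: path_law_prob h_def v_def)
  \<comment> \<open>For fixed data of the current batch: the next service is integrated out first,
    leaving \<open>h ^ N * v\<close> for \<open>N\<close> arrivals, and then the arrivals.\<close>
  have inner: "(\<integral>\<^sup>+\<xi>. J (fst \<xi>, case_nat r (snd \<xi>)) \<partial>path_law) =
      ennreal (v * (lam * h / \<omega>) * (exp (- s * service ?m r) - exp (- (\<omega> + s) * service ?m r)))"
    if r: "0 \<le> service ?m r" for r
  proof -
    let ?S = "service ?m r"
    let ?N = "\<lambda>X. arrivals_upto X ?S"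
    have Jr: "J (X, case_nat r R) = (\<Sum>l. of_bool (l < ?N X) * ?e (?S - (\<Sum>i\<le>l. X i))) * ?e (service (?N X) (R 0))" for X R
      unfolding J_def e_add by (simp add: arrivals_in_def mult.assoc[symmetric] ennreal_suminf_multc)
    have m: "(\<lambda>\<xi>. J (fst \<xi>, case_nat r (snd \<xi>))) \<in> borel_measurable (gaps_law \<Otimes>\<^sub>M blocks_law)"
      using measurable_compose[OF cons_path_measurable J] by (simp add: path_law_def)
    have "(\<integral>\<^sup>+\<xi>. J (fst \<xi>, case_nat r (snd \<xi>)) \<partial>path_law) = (\<integral>\<^sup>+X. (\<integral>\<^sup>+R. J (X, case_nat r R) \<partial>blocks_law) \<partial>gaps_law)"
      unfolding path_law_def using blocks_law.nn_integral_fst[OF m] by simp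
    also have "\<dots> = (\<integral>\<^sup>+X. (\<Sum>l. of_bool (l < ?N X) * ?e (?S - (\<Sum>i\<le>l. X i))) * ennreal (h ^ ?N X * v) \<partial>gaps_law)"
    proof (rule nn_integral_cong)
      fix X
      have g: "(\<lambda>r. ?e (service (?N X) r)) \<in> borel_measurable block_law" by simp
      have "(\<lambda>R. ?e (service (?N X) (R 0))) \<in> borel_measurable blocks_law"
        by (rule measurable_compose[OF _ g]) (simp add: blocks_law_def)
      then show "(\<integral>\<^sup>+R. J (X, case_nat r R) \<partial>blocks_law) =
          (\<Sum>l. of_bool (l < ?N X) * ?e (?S - (\<Sum>i\<le>l. X i))) * ennreal (h ^ ?N X * v)"
        unfolding Jr using nn_integral_exp_service[of \<omega> "?N X"] \<omega>
        by (subst nn_integral_cmult) (simp_all only: nn_integral_blocks_0[OF g] h_def v_def less_imp_le)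
    qed
    also have "\<dots> = (\<integral>\<^sup>+X. (\<Sum>l. indicator {..?S} (\<Sum>i\<le>l. X i) * ?e (?S - (\<Sum>i\<le>l. X i)) * ennreal (h ^ ?N X)) * ennreal v \<partial>gaps_law)"
    proof (rule nn_integral_cong_AE)
      show "AE X in gaps_law. (\<Sum>l. of_bool (l < ?N X) * ?e (?S - (\<Sum>i\<le>l. X i))) * ennreal (h ^ ?N X * v) =
          (\<Sum>l. indicator {..?S} (\<Sum>i\<le>l. X i) * ?e (?S - (\<Sum>i\<le>l. X i)) * ennreal (h ^ ?N X)) * ennreal v"
        using AE_gaps_law_nonneg AE_exactly[OF r]
      proof eventually_elim
        case (elim X)
        then obtain n where n: "exactly n X ?S" by blast
        have "(of_bool (l < ?N X) :: ennreal) = indicator {..?S} (\<Sum>i\<le>l. X i)" for l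
          using exactly_iff[of X n ?S l] arrivals_upto_exactly[of X n ?S] n elim by (simp add: indicator_def)
        then show ?case using hv by (simp add: ennreal_suminf_multc ennreal_mult mult.assoc[symmetric])
      qed
    qed
    also have "\<dots> = (ennreal (lam * h * exp (- (lam * ?S * (1 - h)))) * ennreal ((1 - exp (- \<omega> * ?S)) / \<omega>)) * ennreal v"
    proof -
      have "(\<lambda>X. \<Sum>l. indicator {..?S} (\<Sum>i\<le>l. X i) * ?e (?S - (\<Sum>i\<le>l. X i)) * ennreal (h ^ ?N X)) \<in> borel_measurable gaps_law"
        by measurable
      then show ?thesis
        using nn_integral_arrivals_sum[of ?e ?S h] r hv nn_integral_exp_kernel[OF \<omega> r]
        by (subst nn_integral_multc) simp_all
    qed
    also have "\<dots> = ennreal (lam * h * exp (- (lam * ?S * (1 - h))) * ((1 - exp (- \<omega> * ?S)) / \<omega>) * v)"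
      using hv \<omega> r lam_pos by (simp add: ennreal_mult[symmetric])
    also have "lam * h * exp (- (lam * ?S * (1 - h))) * ((1 - exp (- \<omega> * ?S)) / \<omega>) * v =
        v * (lam * h / \<omega>) * (exp (- s * ?S) - exp (- (\<omega> + s) * ?S))"
    proof -
      have 1: "exp (- (\<omega> + s) * ?S) = exp (- s * ?S) * exp (- \<omega> * ?S)"
        by (simp add: exp_add[symmetric] algebra_simps)
      have 2: "- (lam * ?S * (1 - h)) = - s * ?S" by (simp add: s_def)
      show ?thesis unfolding 1 2 by (simp add: diff_divide_distrib right_diff_distrib left_diff_distrib mult_ac)
    qed
    finally show ?thesis .
  qed
  have "(\<integral>\<^sup>+\<xi>. J \<xi> \<partial>path_law) = (\<integral>\<^sup>+r. (\<integral>\<^sup>+\<xi>. J (fst \<xi>, case_nat r (snd \<xi>)) \<partial>path_law) \<partial>block_law)"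
    by (rule path_law_iterate(1)[OF J])
  also have "\<dots> = (\<integral>\<^sup>+r. ennreal (v * (lam * h / \<omega>) * (exp (- s * service ?m r) - exp (- (\<omega> + s) * service ?m r))) \<partial>block_law)"
    by (rule nn_integral_cong_AE) (use AE_service_nonneg[of ?m] inner in \<open>auto elim!: eventually_mono\<close>)
  also have "\<dots> = ennreal (\<integral>r. v * (lam * h / \<omega>) * (exp (- s * service ?m r) - exp (- (\<omega> + s) * service ?m r)) \<partial>block_law)"
  proof (rule nn_integral_eq_integral)
    show "integrable block_law (\<lambda>r. v * (lam * h / \<omega>) * (exp (- s * service ?m r) - exp (- (\<omega> + s) * service ?m r)))"
      using s \<omega> by (intro integrable_mult_right Bochner_Integration.integrable_diff rlst_service(1)) auto
    show "AE r in block_law. 0 \<le> v * (lam * h / \<omega>) * (exp (- s * service ?m r) - exp (- (\<omega> + s) * service ?m r))"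
      using AE_service_nonneg[of ?m]
    proof eventually_elim
      case (elim r)
      have "exp (- (\<omega> + s) * service ?m r) \<le> exp (- s * service ?m r)"
        using mult_nonneg_nonneg[of \<omega> "service ?m r"] elim \<omega> by (simp add: algebra_simps)
      then show ?case using hv lam_pos \<omega> by simp
    qed
  qed
  also have "(\<integral>r. v * (lam * h / \<omega>) * (exp (- s * service ?m r) - exp (- (\<omega> + s) * service ?m r)) \<partial>block_law) =
      v * (lam * h / \<omega>) * (rlst FH s ^ ?m * rlst FV s - rlst FH (\<omega> + s) ^ ?m * rlst FV (\<omega> + s))"
    using rlst_service[OF s, of ?m] rlst_service[of "\<omega> + s" ?m] s \<omega> by simp
  finally have JI: "(\<integral>\<^sup>+\<xi>. J \<xi> \<partial>path_law) = ennreal (v * (lam * h / \<omega>) * (rlst FH s ^ ?m * rlst FV s - rlst FH (\<omega> + s) ^ ?m * rlst FV (\<omega> + s)))" .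
  have "(\<Sum>l. delay_weight ?e w l) = (\<integral>\<^sup>+\<xi>. of_bool (w = 0) * ?e (service 1 (snd \<xi> 0)) + J \<xi> \<partial>path_law)"
    unfolding J_def by (subst suminf_delay_weight, simp, intro nn_integral_cong, rule suminf_served)
  also have "\<dots> = of_bool (w = 0) * ennreal (h * v) + (\<integral>\<^sup>+\<xi>. J \<xi> \<partial>path_law)"
    using J by (subst nn_integral_add) (simp_all add: nn_integral_cmult one[simplified])
  also have "\<dots> = ennreal (delay_transform \<omega> w)"
  proof -
    have "0 \<le> v * (lam * h / \<omega>) * (rlst FH s ^ ?m * rlst FV s - rlst FH (\<omega> + s) ^ ?m * rlst FV (\<omega> + s))"
      using hv lam_pos \<omega> s rlst_service_antimono[of s "\<omega> + s" ?m] by simp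
    then show ?thesis
      unfolding JI delay_transform_def Let_def h_def[symmetric] v_def[symmetric] s_def[symmetric]
      using hv by (cases "w = 0") (simp_all add: ennreal_plus)
  qed
  finally show ?thesis .
qed

lemma expectation_power_max_1:
  assumes "0 \<le> x" "x \<le> 1"
  shows "integrable (measure_pmf p) (\<lambda>k. x ^ max k 1)"
    and "complex_of_real (measure_pmf.expectation p (\<lambda>k. x ^ max k 1)) =
      pgf p (of_real x) + (of_real x - 1) * pgf p 0"
proof -
  show "integrable (measure_pmf p) (\<lambda>k. x ^ max k 1)"
    by (rule integrable_pmf_bounded[of _ 1]) (use assms in \<open>simp add: power_le_one\<close>)
  have "complex_of_real (measure_pmf.expectation p (\<lambda>k. x ^ max k 1)) = measure_pmf.expectation p (\<lambda>k. complex_of_real x ^ max k 1)"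
    by (simp flip: integral_complex_of_real of_real_power)
  then show "complex_of_real (measure_pmf.expectation p (\<lambda>k. x ^ max k 1)) =
      pgf p (of_real x) + (of_real x - 1) * pgf p 0"
    using pgf_batch_size[of "complex_of_real x" p] assms by simp
qed

abbreviation batch_size_law :: "nat pmf" where
  "batch_size_law \<equiv> map_pmf (\<lambda>k. max k 1) stationary_law"

lemma pgf_batch_size_law:
  assumes "norm z \<le> 1"
  shows "pgf batch_size_law z = pgf stationary_law z + (z - 1) * pgf stationary_law 0"
  using pgf_batch_size[OF assms, of stationary_law] by (simp add: pgf_def)

theorem lst_delay_law:
  assumes \<omega>: "0 < \<omega>"
  defines "h \<equiv> lst FH (of_real \<omega>)" and "v \<equiv> lst FV (of_real \<omega>)"
  defines "s \<equiv> of_real \<omega> + of_real lam - of_real lam * h"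
    and "r \<equiv> complex_of_real (utilization lam FH FV stationary_law)"
  shows "lst delay_law (of_real \<omega>) = h * v * (1 - r + r *
    ((pgf stationary_law h - pgf batch_size_law (lst FH s) * lst FV s) /
      (of_real (mean_batch_service FH FV stationary_law) * of_real \<omega>)))"
proof -
  define h' where "h' = rlst FH \<omega>"
  define v' where "v' = rlst FV \<omega>"
  define t where "t = lam * (1 - h')"
  define a where "a = rlst FH t"
  define b where "b = rlst FH (\<omega> + t)"
  define Ea where "Ea = measure_pmf.expectation stationary_law (\<lambda>k. a ^ max k 1)"
  define Eb where "Eb = measure_pmf.expectation stationary_law (\<lambda>k. b ^ max k 1)"
  have hv: "0 \<le> h'" "h' \<le> 1" "0 \<le> v'" using rlst_bounds[of \<omega>] \<omega> by (simp_all add: h'_def v'_def)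
  have t: "0 \<le> t" using hv lam_pos by (simp add: t_def)
  have ab: "0 \<le> a" "a \<le> 1" "0 \<le> b" "b \<le> 1"
    using rlst_bounds[OF t] rlst_bounds[of "\<omega> + t"] t \<omega> by (simp_all add: a_def b_def)
  have h: "h = of_real h'" and v: "v = of_real v'" by (simp_all add: h_def v_def h'_def v'_def lst_rlst)
  have s: "s = of_real (\<omega> + t)" by (simp add: s_def h t_def algebra_simps)
  have T: "delay_transform \<omega> w = h' * v' * indicator {0} w + v' * (lam * h' / \<omega>) * (a ^ max w 1 * rlst FV t - b ^ max w 1 * rlst FV (\<omega> + t))" for w
    by (simp add: delay_transform_def Let_def h'_def v'_def t_def a_def b_def indicator_def)
  note int = expectation_power_max_1(1)[OF ab(1,2), of stationary_law] expectation_power_max_1(1)[OF ab(3,4), of stationary_law]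
  have i0: "integrable (measure_pmf stationary_law) (indicat_real {0})"
    by (rule integrable_pmf_bounded[of _ 1]) (simp add: indicator_def)
  have iT: "integrable (measure_pmf stationary_law) (delay_transform \<omega>)"
    unfolding T[abs_def]
    by (intro Bochner_Integration.integrable_add integrable_mult_right Bochner_Integration.integrable_diff integrable_mult_left int i0)
  have ET: "measure_pmf.expectation stationary_law (delay_transform \<omega>) =
      h' * v' * pmf stationary_law 0 + v' * (lam * h' / \<omega>) * (Ea * rlst FV t - Eb * rlst FV (\<omega> + t))"
    unfolding T[abs_def] Ea_def Eb_def using int i0
    by (subst Bochner_Integration.integral_add) (simp_all add: measure_pmf_single)
  interpret D: real_distribution delay_law by (rule real_distribution_delay_law)
  have "(\<integral>\<^sup>+y. ennreal (exp (- \<omega> * y)) \<partial>delay_law) = (\<integral>\<^sup>+w. ennreal (delay_transform \<omega> w) \<partial>stationary_law) / ennreal customers_mean"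
    by (subst nn_integral_delay_law) (simp_all only: suminf_delay_weight_exp[OF \<omega>], simp)
  also have "\<dots> = ennreal (measure_pmf.expectation stationary_law (delay_transform \<omega>) / customers_mean)"
    using nn_integral_eq_integral[OF iT] delay_transform_nonneg[OF \<omega>] customers_mean_pos
    by (simp add: divide_ennreal integral_nonneg_AE del: ennreal_plus)
  finally have "rlst delay_law \<omega> = measure_pmf.expectation stationary_law (delay_transform \<omega>) / customers_mean"
    unfolding rlst_def
    using delay_transform_nonneg[OF \<omega>] customers_mean_pos
    by (subst integral_eq_nn_integral) (simp_all add: integral_nonneg_AE)
  then have L: "lst delay_law (of_real \<omega>) = of_real ((h' * v' * pmf stationary_law 0 + v' * (lam * h' / \<omega>) * (Ea * rlst FV t - Eb * rlst FV (\<omega> + t))) / customers_mean)"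
    by (simp add: lst_rlst ET)
  have arg: "complex_of_real lam - complex_of_real lam * of_real h' = of_real t"
    by (simp add: t_def algebra_simps)
  \<comment> \<open>The stationarity equation, read from right to left, turns the first term of the
    transform into the generating function at \<open>h\<close>.\<close>
  have E: "pgf stationary_law h = of_real (Ea * rlst FV t)"
  proof -
    have "norm (complex_of_real h') \<le> 1" using hv by simp
    from pgf_stationary[OF this]
    have "pgf stationary_law h = of_real (rlst FV t) * (pgf stationary_law (of_real a) - (1 - of_real a) * pgf stationary_law 0)"
      unfolding arrivals_gf_def arg lst_rlst h a_def[symmetric] .
    moreover have "complex_of_real Ea = pgf stationary_law (of_real a) - (1 - of_real a) * pgf stationary_law 0"
      using expectation_power_max_1(2)[OF ab(1,2), of stationary_law] unfolding Ea_def[symmetric] by (simp add: algebra_simps)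
    ultimately show ?thesis by simp
  qed
  have F: "pgf batch_size_law (lst FH s) * lst FV s = of_real (Eb * rlst FV (\<omega> + t))"
    using expectation_power_max_1(2)[OF ab(3,4), of stationary_law] pgf_batch_size_law[of "complex_of_real b"] ab
    unfolding s lst_rlst b_def[symmetric] by (simp add: Eb_def)
  define ES where "ES = mean_batch_service FH FV stationary_law"
  have ES: "0 < ES" unfolding ES_def by (rule mean_batch_service_pos)
  define c where "c = customers_mean"
  have c: "0 < c" unfolding c_def by (rule customers_mean_pos)
  \<comment> \<open>As \<open>mean_waiting\<close> is \<open>lam * ES\<close>, this ratio and
    \<open>pmf stationary_law 0 / c\<close> add up to 1: they are the weights of the customers that
    wait and of those that find the system empty.\<close>
  have u: "utilization lam FH FV stationary_law = lam * ES / c"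
    unfolding utilization_eq c_def ES_def by (simp only: mean_waiting_eq[symmetric])
  have p: "pmf stationary_law 0 = c - lam * ES"
    unfolding c_def ES_def mean_waiting_eq[symmetric] by simp
  have *: "(h' * v' * (c - lam * ES) + v' * (lam * h' / \<omega>) * X) / c =
      h' * v' * (1 - lam * ES / c + lam * ES / c * (X / (ES * \<omega>)))" for X
    using ES c \<omega> by (simp add: field_simps)
  let ?X = "Ea * rlst FV t - Eb * rlst FV (\<omega> + t)"
  have "lst delay_law (of_real \<omega>) = of_real ((h' * v' * (c - lam * ES) + v' * (lam * h' / \<omega>) * ?X) / c)"
    unfolding L unfolding c_def[symmetric] unfolding p ..
  also have "\<dots> = of_real (h' * v' * (1 - lam * ES / c + lam * ES / c * (?X / (ES * \<omega>))))"
    unfolding * ..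
  finally show ?thesis
    unfolding E F unfolding r_def u ES_def[symmetric] h v by simp
qed

end

theorem theorem12:
  fixes M :: "'a measure" and lam :: real and FH FV :: "real measure"
    and A :: "nat \<Rightarrow> 'a \<Rightarrow> real" and H :: "nat \<Rightarrow> nat \<Rightarrow> 'a \<Rightarrow> real" and V :: "nat \<Rightarrow> 'a \<Rightarrow> real"
  assumes "batch_queue M lam FH FV A H V"
    and "integrable FH (\<lambda>h. h)" and "integrable FV (\<lambda>v. v)"
    and "mean FH + mean FV > 0"
    and "lam * mean FH < 1"
  shows "\<exists>(LE :: nat pmf) (LS :: nat pmf) (FD :: real measure).
    steady_state_nat M (left_behind A H V) LE \<and>
    steady_state_nat M (batch_size A H V) LS \<and>
    steady_state_real M (system_delay A H V) FD \<and>
    integrable (measure_pmf LE) real \<and>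
    (\<forall>z::complex. norm z \<le> 1 \<longrightarrow>
      convergent_prod (\<lambda>k. psi_V lam FH FV (Suc k) z) \<and>
      summable (\<lambda>n. (1 - psi_H lam FH (Suc n) z) * (\<Prod>k=1..Suc n. psi_V lam FH FV k z)) \<and>
      pgf LE z = (\<Prod>k. psi_V lam FH FV (Suc k) z)
        - pgf LE 0 * (\<Sum>n. (1 - psi_H lam FH (Suc n) z) * (\<Prod>k=1..Suc n. psi_V lam FH FV k z)) \<and>
      pgf LS z = pgf LE z + (z - 1) * pgf LE 0) \<and>
    pgf LE 0 = (\<Prod>k. psi_V lam FH FV (Suc k) 0)
      / (1 + (\<Sum>n. (1 - psi_H lam FH (Suc n) 0) * (\<Prod>k=1..Suc n. psi_V lam FH FV k 0))) \<and>
    (\<forall>\<omega>::real. \<omega> > 0 \<longrightarrow>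
      (let h = lst FH (of_real \<omega>); v = lst FV (of_real \<omega>);
           s = of_real \<omega> + of_real lam - of_real lam * h;
           rho_star = of_real (utilization lam FH FV LE)
       in lst FD (of_real \<omega>) =
         h * v * (1 - rho_star + rho_star *
           ((pgf LE h - pgf LS (lst FH s) * lst FV s)
             / (of_real (mean_batch_service FH FV LE) * of_real \<omega>)))))"
proof -
  interpret stable_queue M lam FH FV A H V
    using assms by (simp add: stable_queue_def stable_queue_axioms_def)
  have LE: "steady_state_nat M (left_behind A H V) stationary_law"
    using steady_state_nat_queue_length[of Suc "\<lambda>k. k", OF filterlim_Suc]
    by (simp add: left_behind_eq[abs_def] eta_contract_eq)
  have LS: "steady_state_nat M (batch_size A H V) batch_size_law"
    using steady_state_nat_queue_length[of "\<lambda>n. n" "\<lambda>k. max k 1", OF filterlim_ident]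
    by (simp only: batch_size_eq[abs_def])
  show ?thesis
    using LE LS steady_state_system_delay stationary_mean_integrable pgf_stationary_formula
      pgf_batch_size_law pgf_stationary_0 lst_delay_law
    unfolding Let_def
    by (intro exI[of _ stationary_law] exI[of _ batch_size_law] exI[of _ delay_law] conjI allI impI)
qed

end
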